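(* Let $\alpha$ be an algebraic number that is not a nonnegative integer. For each prime number $p$ let $\mathcal{P}_p'$ be the set of prime ideals $\mathfrak{p}$ of $\mathcal{O}_{\mathbb{Q}(\alpha)}$ lying over $(p)$ such that the ramification index of $\mathfrak{p}$ over $p$ is $1$, $|\mathcal{O}_{\mathbb{Q}(\alpha)}/\mathfrak{p}|=p$, and $v_{\mathfrak{p}}(\alpha)\ge 0$. Then $R_+(\alpha)$ is the set of all elements $\beta\in\mathbb{Q}(\alpha)$ such that $v_{\mathfrak{p}}(\beta)\ge 0$ for all $\mathfrak{p}\in\mathcal{P}_p'$ and all primes $p$.
   Context: For $\alpha\in\mathbb{C}$, $R_+(\alpha)$ denotes the set of all finite sums $\sum_{k\ge 0} a_k\binom{\alpha}{k}$ with $a_k\in\mathbb{Z}_{\ge 0}$, where $\binom{\alpha}{k}=\frac{\alpha(\alpha-1)\cdots(\alpha-k+1)}{k!}$. $\mathcal{O}_{\mathbb{Q}(\alpha)}$ is the ring of integers of the number field $\mathbb{Q}(\alpha)$. For a nonzero prime ideal $\mathfrak{p}$, $v_{\mathfrak{p}}(x)$ is the exponent of $\mathfrak{p}$ in the prime factorization of the fractional ideal generated by $x$, with $v_{\mathfrak{p}}(0)=\infty$. *)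

theory Defs
  imports
    "HOL-Algebra.Algebraic_Closure_Type"
    "HOL-Algebra.Generated_Fields"
    "HOL-Algebra.Ideal_Product"
    "HOL-Algebra.QuotRing"
    "HOL-Library.Extended"
    Complex_Main
begin

text \<open>Number fields are subfields of the complex numbers, given by their carrier sets.\<close>

abbreviation complex_ring :: "complex ring" where
  "complex_ring \<equiv> ring_of_type_algebra"

definition rational_adjoin :: "complex \<Rightarrow> complex set" where
  "rational_adjoin \<alpha> = generate_field complex_ring {\<alpha>}"

definition integer_ring :: "complex set \<Rightarrow> complex ring" where
  "integer_ring F = complex_ring\<lparr>carrier := {x \<in> F. algebraic_int x}\<rparr>"

definition fractional_ideal :: "complex set \<Rightarrow> complex set \<Rightarrow> bool" where
  "fractional_ideal F I \<longleftrightarrow>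
     I \<subseteq> F \<and> subgroup I (add_monoid complex_ring) \<and> I \<noteq> {0} \<and>
     (\<forall>a \<in> carrier (integer_ring F). \<forall>x \<in> I. a * x \<in> I) \<and>
     (\<exists>d \<in> carrier (integer_ring F). d \<noteq> 0 \<and> (\<forall>x \<in> I. d * x \<in> carrier (integer_ring F)))"

text \<open>For a number field this is a group, so that integer powers of prime ideals make sense.\<close>

definition fractional_ideals :: "complex set \<Rightarrow> complex set monoid" where
  "fractional_ideals F =
     \<lparr>carrier = {I. fractional_ideal F I},
      monoid.mult = ideal_prod complex_ring,
      one = carrier (integer_ring F)\<rparr>"

definition principal_ideal :: "complex set \<Rightarrow> complex \<Rightarrow> complex set" where
  "principal_ideal F x = (\<lambda>a. x * a) ` carrier (integer_ring F)"

definition prime_factorization_of ::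
    "complex set \<Rightarrow> complex set \<Rightarrow> (complex set \<Rightarrow> int) \<Rightarrow> bool" where
  "prime_factorization_of F I e \<longleftrightarrow>
     finite {P. e P \<noteq> 0} \<and>
     (\<forall>P. e P \<noteq> 0 \<longrightarrow> primeideal P (integer_ring F) \<and> P \<noteq> {0}) \<and>
     I = finprod (fractional_ideals F) (\<lambda>P. P [^]\<^bsub>fractional_ideals F\<^esub> e P) {P. e P \<noteq> 0}"

text \<open>The description is proper when \<open>F\<close> is a number field and \<open>I\<close> is a fractional ideal, by
  unique factorization in the Dedekind domain \<open>integer_ring F\<close>.\<close>

definition prime_exponent :: "complex set \<Rightarrow> complex set \<Rightarrow> complex set \<Rightarrow> int" where
  "prime_exponent F P I = (THE e. prime_factorization_of F I e) P"

definition valuation :: "complex set \<Rightarrow> complex set \<Rightarrow> complex \<Rightarrow> int extended" where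
  "valuation F P x = (if x = 0 then Pinf else Fin (prime_exponent F P (principal_ideal F x)))"

definition lies_over :: "complex set \<Rightarrow> nat \<Rightarrow> bool" where
  "lies_over P p \<longleftrightarrow> {n :: int. of_int n \<in> P} = {n. int p dvd n}"

definition ramification_index :: "complex set \<Rightarrow> complex set \<Rightarrow> nat \<Rightarrow> int" where
  "ramification_index F P p = prime_exponent F P (principal_ideal F (of_nat p))"

definition unramified_degree_one_primes :: "complex \<Rightarrow> nat \<Rightarrow> complex set set" where
  "unramified_degree_one_primes \<alpha> p =
     (let F = rational_adjoin \<alpha> in
      {P. primeideal P (integer_ring F) \<and> lies_over P p \<and>
          ramification_index F P p = 1 \<and>
          card (carrier (integer_ring F Quot P)) = p \<and>
          valuation F P \<alpha> \<ge> 0})"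

definition R_plus :: "complex \<Rightarrow> complex set" where
  "R_plus \<alpha> = {\<Sum>k\<le>n. of_nat (a k) * (\<alpha> gchoose k) | (a :: nat \<Rightarrow> nat) n. True}"

end

theory Submission
  imports Defs "Jordan_Normal_Form.Char_Poly" "HOL-Number_Theory.Residues"
begin

text \<open>Let \<open>R\<close> be the ring of all \<open>f \<alpha>\<close> with \<open>f\<close> an integer-valued polynomial, equivalently the integer
  combinations of the \<open>\<alpha> gchoose k\<close>. Since \<open>\<alpha>\<close> is a root of a polynomial that is positive on \<open>\<nat>\<close>, every
  \<open>- (\<alpha> gchoose k)\<close> is a nonnegative combination, so \<open>R_plus \<alpha> = R\<close>.

  If \<open>P\<close> is unramified of degree one over \<open>p\<close> and \<open>\<alpha>\<close> is \<open>P\<close>-integral, then \<open>\<alpha>\<close> is congruent to an integer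
  modulo every power of \<open>p\<close>, hence the \<open>\<alpha> gchoose k\<close> are \<open>P\<close>-integral. Conversely, \<open>x ^ p - x\<close> lies in
  \<open>p R\<close> for all \<open>x\<close> in \<open>R\<close>, so \<open>p R\<close> is an intersection of maximal ideals \<open>M\<close>, and the localization of \<open>R\<close>
  at \<open>M\<close> is a discrete valuation ring with uniformizer \<open>p\<close> and residue field of order \<open>p\<close>; it is the local
  ring of a prime \<open>P\<close> in \<open>unramified_degree_one_primes \<alpha> p\<close>. So if \<open>\<gamma>\<close> is integral at these primes and
  \<open>p * \<gamma>\<close> lies in \<open>R\<close>, then \<open>\<gamma>\<close> lies in \<open>R\<close>, and denominators can be removed one prime at a time.\<close>

section \<open>Integer combinations of binomial coefficients\<close>

text \<open>Membership in R is defined by the values at natural numbers, so closure under products,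
  under (x ^ p - x) / p and under x gchoose k is checked value by value. At a prime p the congruence
  x ^ p = x modulo p R is used twice. It makes y ^ (p - 1) idempotent modulo p R, which produces a
  maximal ideal avoiding a given y outside p R. For m in M it puts m * (1 - m ^ (p - 1)) into p R,
  where the second factor is a unit at M, so p generates the maximal ideal of the localization. That
  no nonzero element is divisible by all powers of p comes from integer denominators: every element
  of the field has a positive integer multiple in R.

  Valuations are defined through unique factorization of fractional ideals, so that theory is
  established first; finiteness of A / n A for additive subgroups A supplies its chain conditions
  and pigeonhole arguments. Afterwards it enters mostly through the criterion
  \<open>valuation_nonneg_iff\<close>, which lets the local ring of P be compared with the
  localization of R. Exponents themselves matter for the ramification index and for the integrality
  of \<alpha> at P.\<close>

definition binomial_ring :: "complex \<Rightarrow> complex set" where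
  "binomial_ring \<alpha> = {poly f \<alpha> | f. \<forall>n::nat. poly f (of_nat n) \<in> \<int>}"

lemma binomial_ringI: "(\<And>n::nat. poly f (of_nat n) \<in> \<int>) \<Longrightarrow> poly f \<alpha> \<in> binomial_ring \<alpha>"
  by (auto simp: binomial_ring_def)

lemma of_int_mem_binomial_ring: "of_int z \<in> binomial_ring \<alpha>"
  using binomial_ringI[of "[:of_int z:]" \<alpha>] by simp

lemma zero_mem_binomial_ring: "0 \<in> binomial_ring \<alpha>"
  and one_mem_binomial_ring: "1 \<in> binomial_ring \<alpha>"
  using of_int_mem_binomial_ring[of 0] of_int_mem_binomial_ring[of 1] by simp_all

lemma self_mem_binomial_ring: "\<alpha> \<in> binomial_ring \<alpha>"
  using binomial_ringI[of "[:0, 1:]" \<alpha>] by simp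

lemma add_mem_binomial_ring:
  "x \<in> binomial_ring \<alpha> \<Longrightarrow> y \<in> binomial_ring \<alpha> \<Longrightarrow> x + y \<in> binomial_ring \<alpha>"
  unfolding binomial_ring_def by (clarify, rule exI[of _ "f + g" for f g]) (auto simp: Ints_add)

lemma mult_mem_binomial_ring:
  "x \<in> binomial_ring \<alpha> \<Longrightarrow> y \<in> binomial_ring \<alpha> \<Longrightarrow> x * y \<in> binomial_ring \<alpha>"
  unfolding binomial_ring_def by (clarify, rule exI[of _ "f * g" for f g]) (auto simp: Ints_mult)

lemma minus_mem_binomial_ring: "x \<in> binomial_ring \<alpha> \<Longrightarrow> - x \<in> binomial_ring \<alpha>"
  using mult_mem_binomial_ring[OF of_int_mem_binomial_ring[of "-1"], of x \<alpha>] by simp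

lemma diff_mem_binomial_ring:
  "x \<in> binomial_ring \<alpha> \<Longrightarrow> y \<in> binomial_ring \<alpha> \<Longrightarrow> x - y \<in> binomial_ring \<alpha>"
  using add_mem_binomial_ring[OF _ minus_mem_binomial_ring, of x \<alpha> y] by simp

lemma power_mem_binomial_ring: "x \<in> binomial_ring \<alpha> \<Longrightarrow> x ^ n \<in> binomial_ring \<alpha>"
  by (induction n) (simp_all add: one_mem_binomial_ring mult_mem_binomial_ring)

lemma gbinomial_mem_binomial_ring: "\<alpha> gchoose k \<in> binomial_ring \<alpha>"
proof -
  define f where "f = Polynomial.smult (inverse (fact k)) (\<Prod>i<k. [:- of_nat i, 1 :: complex:])"
  have f: "poly f x = x gchoose k" for x :: complex
    by (simp add: f_def poly_prod gbinomial_prod_rev lessThan_atLeast0 divide_inverse mult.commute)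
  have "poly f (of_nat n) \<in> \<int>" for n
    by (simp add: f flip: binomial_gbinomial)
  from binomial_ringI[OF this, of \<alpha>] show ?thesis
    by (simp add: f)
qed

lemma prime_dvd_power_minus_self:
  fixes z :: int
  assumes "Factorial_Ring.prime p"
  shows "int p dvd z ^ p - z"
proof -
  define a where "a = nat (z mod int p)"
  have p: "p > 0"
    using assms prime_gt_0_nat by blast
  hence a: "[z = int a] (mod int p)"
    by (simp add: a_def Cong.cong_def)
  have "[a ^ p = a] (mod p)"
  proof (cases "p dvd a")
    case True
    thus ?thesis
      using p dvd_trans[OF True dvd_power[of p a]] by (simp add: Cong.cong_def mod_eq_0_iff_dvd)
  next
    case False
    from cong_scalar_left[OF fermat_theorem[OF assms this], of a] show ?thesis
      using p by (cases p) simp_all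
  qed
  hence "[int a ^ p = int a] (mod int p)"
    by (simp flip: cong_int_iff)
  with a have "[z ^ p = z] (mod int p)"
    by (meson Cong.cong_pow Cong.cong_sym Cong.cong_trans)
  thus ?thesis
    by (simp add: cong_iff_dvd_diff)
qed

text \<open>Fermat's little theorem at each value f(n) shows that (f ^ p - f) / p is again
  integer-valued.\<close>

lemma frobenius_mem_binomial_ring:
  assumes "Factorial_Ring.prime p" "x \<in> binomial_ring \<alpha>"
  shows "(x ^ p - x) / of_nat p \<in> binomial_ring \<alpha>"
proof -
  obtain f where f: "x = poly f \<alpha>" "\<And>n::nat. poly f (of_nat n) \<in> \<int>"
    using assms(2) by (auto simp: binomial_ring_def)
  define g where "g = Polynomial.smult (inverse (of_nat p)) (f ^ p - f)"
  have "poly g (of_nat n) \<in> \<int>" for n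
  proof -
    obtain z where z: "poly f (of_nat n) = of_int z"
      using f(2)[of n] by (auto elim: Ints_cases)
    obtain w where w: "z ^ p - z = int p * w"
      using prime_dvd_power_minus_self[OF assms(1), of z] by (auto elim: dvdE)
    have "(of_int z ^ p - of_int z :: complex) = of_nat p * of_int w"
      using arg_cong[OF w, of "of_int :: int \<Rightarrow> complex"] by simp
    hence "poly g (of_nat n) = of_int w"
      using assms(1) by (simp add: g_def z prime_gt_0_nat)
    thus ?thesis by simp
  qed
  from binomial_ringI[OF this, of \<alpha>] show ?thesis
    by (simp add: g_def f(1) divide_inverse mult.commute)
qed

text \<open>The span of the binomial coefficients is stable under multiplication by x, because x *
  (x gchoose k) = k * (x gchoose k) + (k + 1) * (x gchoose (k + 1)).\<close>

lemma poly_eq_sum_gbinomial: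
  fixes f :: "complex poly"
  shows "\<exists>c D. \<forall>x. poly f x = (\<Sum>k\<le>D. c k * (x gchoose k))"
proof (induction f)
  case 0
  show ?case by (intro exI[of _ "\<lambda>_. 0"]) simp
next
  case (pCons a f)
  then obtain c D where c: "\<And>x. poly f x = (\<Sum>k\<le>D. c k * (x gchoose k))" by blast
  \<comment> \<open>\<open>d\<close> collects the constant \<open>a\<close> and the terms whose
    index is raised by one, \<open>e\<close> the terms whose index stays.\<close>
  define d where "d k = (if k = 0 then a else of_nat k * c (k - 1))" for k
  define e where "e k = (if k \<le> D then of_nat k * c k else 0)" for k
  have "poly (pCons a f) x = (\<Sum>k\<le>Suc D. (d k + e k) * (x gchoose k))" for x
  proof -
    have "x * poly f x = (\<Sum>k\<le>D. c k * (x * (x gchoose k)))"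
      by (simp add: c sum_distrib_left mult_ac)
    also have "\<dots> = (\<Sum>k\<le>D. of_nat k * c k * (x gchoose k)) +
        (\<Sum>k\<le>D. of_nat (Suc k) * c k * (x gchoose Suc k))"
      by (subst gbinomial_mult_1) (simp add: algebra_simps sum.distrib)
    also have "(\<Sum>k\<le>D. of_nat k * c k * (x gchoose k)) = (\<Sum>k\<le>Suc D. e k * (x gchoose k))"
      by (simp add: e_def)
    also have "a + ((\<Sum>k\<le>Suc D. e k * (x gchoose k)) +
        (\<Sum>k\<le>D. of_nat (Suc k) * c k * (x gchoose Suc k))) =
        (\<Sum>k\<le>Suc D. e k * (x gchoose k)) + (\<Sum>k\<le>Suc D. d k * (x gchoose k))"
      by (subst (2) sum.atMost_Suc_shift) (simp add: d_def)
    finally show ?thesis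
      by (simp add: ring_distribs sum.distrib)
  qed
  thus ?case by (intro exI allI)
qed

text \<open>Evaluation at n = 0, 1, ... gives a triangular system with diagonal 1, since n choose k
  vanishes for k > n; so the Newton coefficients are integral one after the other.\<close>

lemma poly_eq_int_sum_gbinomial:
  fixes f :: "complex poly"
  assumes "\<And>n::nat. poly f (of_nat n) \<in> \<int>"
  obtains c :: "nat \<Rightarrow> int" and D where
    "\<And>x. poly f x = (\<Sum>k\<le>D. of_int (c k) * (x gchoose k))"
proof -
  obtain c D where c: "\<And>x. poly f x = (\<Sum>k\<le>D. c k * (x gchoose k))"
    using poly_eq_sum_gbinomial by blast
  have "c n \<in> \<int>" if "n \<le> D" for n
    using that
  proof (induction n rule: less_induct)
    case (less n)
    have "poly f (of_nat n) = (\<Sum>k\<le>D. c k * of_nat (n choose k))"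
      by (simp add: c binomial_gbinomial)
    also have "\<dots> = (\<Sum>k\<le>n. c k * of_nat (n choose k))"
      using less.prems by (intro sum.mono_neutral_right) (auto simp: binomial_eq_0)
    also have "\<dots> = (\<Sum>k<n. c k * of_nat (n choose k)) + c n"
      by (simp add: lessThan_Suc_atMost[symmetric])
    finally have "c n = poly f (of_nat n) - (\<Sum>k<n. c k * of_nat (n choose k))"
      by simp
    also have "\<dots> \<in> \<int>"
      using less by (intro Ints_diff assms Ints_sum Ints_mult) auto
    finally show ?case .
  qed
  hence "\<forall>k. \<exists>z. k \<le> D \<longrightarrow> c k = of_int z"
    by (metis Ints_cases)
  then obtain z where z: "\<And>k. k \<le> D \<Longrightarrow> c k = of_int (z k)"
    by metis
  show ?thesis
    by (rule that[of z D]) (simp add: c z)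
qed

text \<open>By Pascal's rule the forward difference of the sum has the same shape with coefficients
  shifted by one and the same leading coefficient. By induction it is eventually at least 1, so the
  sum grows at least linearly.\<close>

lemma sum_binomial_eventually_pos:
  fixes c :: "nat \<Rightarrow> int"
  assumes "c m > 0"
  shows "\<exists>N. \<forall>j\<ge>N. (\<Sum>i\<le>m. c i * int (j choose i)) > 0"
  using assms
proof (induction m arbitrary: c)
  case (Suc m)
  define F where "F j = (\<Sum>i\<le>Suc m. c i * int (j choose i))" for j
  have F_Suc: "F (Suc j) = F j + (\<Sum>i\<le>m. c (Suc i) * int (j choose i))" for j
    unfolding F_def by (simp only: sum.atMost_Suc_shift) (simp add: algebra_simps sum.distrib)
  obtain N where N: "\<And>j. j \<ge> N \<Longrightarrow> (\<Sum>i\<le>m. c (Suc i) * int (j choose i)) > 0"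
    using Suc.IH[of "\<lambda>i. c (Suc i)"] Suc.prems by auto
  have "F (N + k) \<ge> F N + int k" for k
  proof (induction k)
    case (Suc k)
    thus ?case using N[of "N + k"] by (simp add: F_Suc)
  qed simp
  \<comment> \<open>More than |F N| unit steps beyond N compensate a negative starting value F
    N.\<close>
  hence "F j > 0" if "j \<ge> N + nat (\<bar>F N\<bar> + 1)" for j
    using that by (smt (verit) le_add_diff_inverse nat_le_iff of_nat_add add_leD1 int_nat_eq zle_int)
  thus ?case
    unfolding F_def by blast
qed simp

text \<open>Vandermonde for x = (x - j) + j rewrites x gchoose i through (x - j) gchoose l, and
  trinomial revision absorbs the factor x gchoose j. For fixed l the inner sum, as a function of j,
  has leading coefficient \<open>c D\<close>, so \<open>sum_binomial_eventually_pos\<close> applies;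
  for l = 0 it is the value of the given polynomial at j.\<close>

lemma gbinomial_mult_sum_gbinomial:
  fixes x :: complex and c :: "nat \<Rightarrow> int"
  shows "(x gchoose j) * (\<Sum>i\<le>D. of_int (c i) * (x gchoose i)) =
    (\<Sum>l\<le>D. of_int ((\<Sum>i\<le>D - l. c (l + i) * int (j choose i)) * int ((j + l) choose j)) *
      (x gchoose (j + l)))"
proof -
  have rev: "(x gchoose j) * (x - of_nat j gchoose l) = of_nat ((j + l) choose j) * (x gchoose (j + l))"
    for l using gbinomial_trinomial_revision[of j "j + l" x] by (simp add: binomial_gbinomial mult.commute)
  have vdm: "x gchoose i = (\<Sum>l\<le>i. (x - of_nat j gchoose l) * of_nat (j choose (i - l)))" for i
    using gbinomial_Vandermonde[of "x - of_nat j" "of_nat j" i]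
    by (simp add: binomial_gbinomial atMost_atLeast0)
  have "(\<Sum>i\<le>D. of_int (c i) * (x gchoose i)) =
      (\<Sum>i\<le>D. \<Sum>l\<le>i. of_int (c i) * of_nat (j choose (i - l)) * (x - of_nat j gchoose l))"
    by (subst vdm) (simp add: sum_distrib_left mult_ac)
  also have "\<dots> = (\<Sum>(i, l)\<in>(SIGMA i:{..D}. {..i}).
      of_int (c i) * of_nat (j choose (i - l)) * (x - of_nat j gchoose l))"
    by (simp add: sum.Sigma)
  also have "\<dots> = (\<Sum>(l, i)\<in>(SIGMA l:{..D}. {..D - l}).
      of_int (c (l + i)) * of_nat (j choose i) * (x - of_nat j gchoose l))"
    by (rule sum.reindex_bij_witness[of _ "\<lambda>(l, i). (l + i, l)" "\<lambda>(i, l). (l, i - l)"]) auto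
  also have "\<dots> = (\<Sum>l\<le>D. \<Sum>i\<le>D - l.
      of_int (c (l + i)) * of_nat (j choose i) * (x - of_nat j gchoose l))"
    by (simp add: sum.Sigma)
  also have "\<dots> = (\<Sum>l\<le>D. of_int (\<Sum>i\<le>D - l. c (l + i) * int (j choose i)) * (x - of_nat j gchoose l))"
    by (simp add: sum_distrib_right)
  finally have eq: "(\<Sum>i\<le>D. of_int (c i) * (x gchoose i)) = \<dots>" .
  show ?thesis
    unfolding eq sum_distrib_left
    by (intro sum.cong refl) (simp add: mult.left_commute rev mult.assoc del: of_int_sum)
qed

section \<open>The additive monoid \<open>R_plus \<alpha>\<close> and its closure under
  negation\<close>

lemma R_plus_iff: "x \<in> R_plus \<alpha> \<longleftrightarrow> (\<exists>(a::nat \<Rightarrow> nat) n. x = (\<Sum>k\<le>n. of_nat (a k) * (\<alpha> gchoose k)))"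
  by (auto simp: R_plus_def)

lemma add_mem_R_plus:
  assumes "x \<in> R_plus \<alpha>" "y \<in> R_plus \<alpha>"
  shows "x + y \<in> R_plus \<alpha>"
proof -
  obtain a n where a: "x = (\<Sum>k\<le>n. of_nat (a k) * (\<alpha> gchoose k))"
    using assms by (auto simp: R_plus_iff)
  obtain b m where b: "y = (\<Sum>k\<le>m. of_nat (b k) * (\<alpha> gchoose k))"
    using assms by (auto simp: R_plus_iff)
  have "x = (\<Sum>k\<le>n + m. of_nat (if k \<le> n then a k else 0) * (\<alpha> gchoose k))"
    unfolding a by (rule sum.mono_neutral_cong_left) auto
  moreover have "y = (\<Sum>k\<le>n + m. of_nat (if k \<le> m then b k else 0) * (\<alpha> gchoose k))"
    unfolding b by (rule sum.mono_neutral_cong_left) auto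
  ultimately have "x + y = (\<Sum>k\<le>n + m. of_nat ((if k \<le> n then a k else 0) +
      (if k \<le> m then b k else 0)) * (\<alpha> gchoose k))"
    by (simp only: of_nat_add ring_distribs sum.distrib)
  thus ?thesis
    unfolding R_plus_iff by (intro exI) assumption
qed

lemma zero_mem_R_plus: "0 \<in> R_plus \<alpha>"
  unfolding R_plus_iff by (rule exI[of _ "\<lambda>_. 0"]) simp

lemma gbinomial_mem_R_plus: "\<alpha> gchoose k \<in> R_plus \<alpha>"
  unfolding R_plus_iff
  by (rule exI[of _ "\<lambda>i. if i = k then 1 else 0"], rule exI[of _ k])
    (simp add: if_distrib[of of_nat] if_distrib[of "\<lambda>x. x * _"] sum.delta cong: if_cong)

lemma of_nat_mult_mem_R_plus: "x \<in> R_plus \<alpha> \<Longrightarrow> of_nat n * x \<in> R_plus \<alpha>"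
  by (induction n) (simp_all add: zero_mem_R_plus add_mem_R_plus ring_distribs)

lemma sum_mem_R_plus: "(\<And>i. i \<in> A \<Longrightarrow> f i \<in> R_plus \<alpha>) \<Longrightarrow> sum f A \<in> R_plus \<alpha>"
  by (induction A rule: infinite_finite_induct) (simp_all add: zero_mem_R_plus add_mem_R_plus)

text \<open>The disjunction fits sums in which some coefficients are known to be nonnegative while
  the other terms already have their negatives in \<open>R_plus \<alpha>\<close>.\<close>

lemma of_int_mult_mem_R_plus:
  assumes "x \<in> R_plus \<alpha>" "z \<ge> 0 \<or> - x \<in> R_plus \<alpha>"
  shows "of_int z * x \<in> R_plus \<alpha>"
proof (cases "z \<ge> 0")
  case True
  thus ?thesis
    using of_nat_mult_mem_R_plus[OF assms(1), of "nat z"] by simp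
next
  case False
  thus ?thesis
    using of_nat_mult_mem_R_plus[of "- x" \<alpha> "nat (- z)"] assms(2) by simp
qed

text \<open>A natural root n can be divided out as the factor X - n; \<alpha> remains a root of the
  quotient because it differs from n. The degree drops each time.\<close>

lemma algebraic_imp_int_poly_root_no_nat_root:
  fixes \<alpha> :: complex
  assumes "algebraic \<alpha>" "\<alpha> \<notin> \<nat>"
  obtains p :: "int poly" where "poly (map_poly of_int p) \<alpha> = 0" "\<And>n::nat. poly p (int n) \<noteq> 0"
proof -
  obtain p :: "int poly" where p: "p \<noteq> 0" "poly (map_poly of_int p) \<alpha> = 0"
    using assms(1) by (erule algebraicE')
  from p have "\<exists>q::int poly. poly (map_poly of_int q) \<alpha> = 0 \<and> (\<forall>n::nat. poly q (int n) \<noteq> 0)"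
  proof (induction "Polynomial.degree p" arbitrary: p rule: less_induct)
    case less
    show ?case
    proof (cases "\<exists>n::nat. poly p (int n) = 0")
      case True
      then obtain n q where q: "p = [:- int n, 1:] * q"
        by (metis dvdE poly_eq_0_iff_dvd)
      have "map_poly of_int p = [:- of_nat n, 1:] * (map_poly of_int q :: complex poly)"
        unfolding q by (rule poly_eqI) (simp add: coeff_map_poly coeff_pCons split: nat.splits)
      hence "poly (map_poly of_int q) \<alpha> = 0"
        using less.prems(2) assms(2) by auto
      moreover have "q \<noteq> 0"
        using less.prems(1) by (auto simp: q)
      moreover from this have "Polynomial.degree p = 1 + Polynomial.degree q"
        unfolding q by (subst degree_mult_eq) simp_all
      hence "Polynomial.degree q < Polynomial.degree p" by simp
      ultimately show ?thesis
        using less.hyps by blast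
    qed (use less.prems in blast)
  qed
  thus ?thesis
    using that by blast
qed

text \<open>A square of an integer polynomial that kills \<open>\<alpha>\<close> and has no root in \<open>\<nat>\<close>, multiplied by
  \<open>x gchoose j\<close>, is an integral relation among the \<open>\<alpha> gchoose k\<close> with \<open>k \<ge> j\<close> whose coefficient at
  \<open>k = j\<close> is positive. For large \<open>j\<close> all coefficients are nonnegative; smaller \<open>j\<close> follow by downward
  induction.\<close>

lemma uminus_gbinomial_mem_R_plus:
  assumes "algebraic \<alpha>" "\<alpha> \<notin> \<nat>"
  shows "- (\<alpha> gchoose k) \<in> R_plus \<alpha>"
proof -
  obtain p :: "int poly" where p: "poly (map_poly of_int p) \<alpha> = 0" "\<And>n::nat. poly p (int n) \<noteq> 0"
    using algebraic_imp_int_poly_root_no_nat_root[OF assms] by blast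
  define g :: "complex poly" where "g = (map_poly of_int p) ^ 2"
  have g_nat: "poly g (of_nat n) = of_int ((poly p (int n))\<^sup>2)" for n
  proof -
    have "poly (map_poly of_int p) (of_int (int n) :: complex) = of_int (poly p (int n))"
      by (rule of_int_hom.poly_map_poly)
    thus ?thesis by (simp add: g_def)
  qed
  obtain c :: "nat \<Rightarrow> int" and D' where c': "\<And>x. poly g x = (\<Sum>k\<le>D'. of_int (c k) * (x gchoose k))"
    using poly_eq_int_sum_gbinomial[of g] g_nat by (metis Ints_of_int)
  \<comment> \<open>The expansion may end in zeros; the sign arguments need its last nonzero
    coefficient.\<close>
  define D where "D = Max {k. k \<le> D' \<and> c k \<noteq> 0}"
  have "poly g (of_nat 0) \<noteq> 0"
    unfolding g_nat using p(2)[of 0] by simp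
  hence "\<exists>k\<le>D'. c k \<noteq> 0"
    unfolding c' by (metis (no_types, lifting) atMost_iff mult_eq_0_iff of_int_0 sum.neutral)
  hence "D \<in> {k. k \<le> D' \<and> c k \<noteq> 0}"
    unfolding D_def by (intro Max_in) auto
  hence D: "D \<le> D'" "c D \<noteq> 0" by auto
  have "k \<le> D" if "k \<le> D'" "c k \<noteq> 0" for k
    using that unfolding D_def by (intro Max_ge) auto
  hence c: "poly g x = (\<Sum>k\<le>D. of_int (c k) * (x gchoose k))" for x
    unfolding c' using D(1) by (intro sum.mono_neutral_right) force+
  have p_sq: "(poly p (int n))\<^sup>2 = (\<Sum>k\<le>D. c k * int (n choose k))" for n
  proof -
    have "of_int ((poly p (int n))\<^sup>2) = (of_int (\<Sum>k\<le>D. c k * int (n choose k)) :: complex)"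
      using c[of "of_nat n"] unfolding g_nat by (simp add: binomial_gbinomial)
    thus ?thesis by (simp only: of_int_eq_iff)
  qed
  \<comment> \<open>A negative leading coefficient would make the squares p(n)^2 eventually
    negative.\<close>
  have "c D > 0"
  proof (rule ccontr)
    assume "\<not> c D > 0"
    with D obtain N where "(\<Sum>k\<le>D. - c k * int (N choose k)) > 0"
      using sum_binomial_eventually_pos[of "\<lambda>k. - c k" D] by auto
    thus False
      using p_sq[of N] by (simp add: sum_negf) (smt (verit) zero_le_power2)
  qed
  define b where "b j l = (\<Sum>i\<le>D - l. c (l + i) * int (j choose i)) * int ((j + l) choose j)" for j l
  \<comment> \<open>\<open>b j 0\<close> is the value p(j)^2, a positive integer because p has no
    root in the natural numbers.\<close>
  have b0: "b j 0 \<ge> 1" for j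
    using p_sq[of j] p(2)[of j] by (simp add: b_def flip: p_sq) (smt (verit) zero_less_power2)
  have "poly g \<alpha> = 0"
    using p(1) by (simp add: g_def)
  hence rel: "(\<Sum>l\<le>D. of_int (b j l) * (\<alpha> gchoose (j + l))) = 0" for j
    using gbinomial_mult_sum_gbinomial[of \<alpha> j c D] by (simp add: c b_def)
  have "\<exists>N. \<forall>j\<ge>N. b j l \<ge> 0" if "l \<le> D" for l
    using sum_binomial_eventually_pos[of "\<lambda>i. c (l + i)" "D - l"] that \<open>c D > 0\<close>
    unfolding b_def by (fastforce intro: mult_nonneg_nonneg)
  then obtain N where N: "\<And>l j. l \<le> D \<Longrightarrow> j \<ge> N l \<Longrightarrow> b j l \<ge> 0"
    by metis
  define M where "M = Max (N ` {..D})"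
  have M: "b j l \<ge> 0" if "l \<le> D" "j \<ge> M" for j l
    using that by (intro N) (auto simp: M_def)
  show ?thesis
  \<comment> \<open>Downward induction on k: the truncated difference is 0 for all k >= M, and there
    every coefficient is nonnegative, so the induction hypothesis is not called.\<close>
  proof (induction "M - k" arbitrary: k rule: less_induct)
    case less
    \<comment> \<open>The relation is solved for one copy of - (\<alpha> gchoose k); the other
      \<open>b k 0 - 1\<close> copies have a nonnegative coefficient.\<close>
    have "- (\<alpha> gchoose k) = of_int (b k 0 - 1) * (\<alpha> gchoose k) +
        (\<Sum>l<D. of_int (b k (Suc l)) * (\<alpha> gchoose (k + Suc l)))"
      using rel[of k] unfolding sum.atMost_shift by (simp add: algebra_simps eq_neg_iff_add_eq_0)
    also have "\<dots> \<in> R_plus \<alpha>"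
    proof (intro add_mem_R_plus sum_mem_R_plus of_int_mult_mem_R_plus gbinomial_mem_R_plus)
      show "0 \<le> b k 0 - 1 \<or> - (\<alpha> gchoose k) \<in> R_plus \<alpha>"
        using b0[of k] by simp
      fix l assume "l \<in> {..<D}"
      show "0 \<le> b k (Suc l) \<or> - (\<alpha> gchoose (k + Suc l)) \<in> R_plus \<alpha>"
      proof (cases "k \<ge> M")
        case True
        thus ?thesis using M \<open>l \<in> {..<D}\<close> by simp
      next
        case False
        thus ?thesis by (intro disjI2 less) simp
      qed
    qed
    finally show ?case .
  qed
qed

lemma R_plus_eq_binomial_ring:
  assumes "algebraic \<alpha>" "\<alpha> \<notin> \<nat>"
  shows "R_plus \<alpha> = binomial_ring \<alpha>"
proof (intro equalityI subsetI)
  fix x assume "x \<in> R_plus \<alpha>"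
  then obtain a :: "nat \<Rightarrow> nat" and n where a: "x = (\<Sum>k\<le>n. of_nat (a k) * (\<alpha> gchoose k))"
    by (auto simp: R_plus_iff)
  have "(\<Sum>k\<le>m. of_nat (a k) * (\<alpha> gchoose k)) \<in> binomial_ring \<alpha>" for m
    using of_int_mem_binomial_ring[of "int (a _)"]
    by (induction m) (simp_all add: add_mem_binomial_ring mult_mem_binomial_ring gbinomial_mem_binomial_ring)
  thus "x \<in> binomial_ring \<alpha>"
    by (simp add: a)
next
  fix x assume "x \<in> binomial_ring \<alpha>"
  then obtain f where "x = poly f \<alpha>" "\<And>n::nat. poly f (of_nat n) \<in> \<int>"
    by (auto simp: binomial_ring_def)
  then obtain c :: "nat \<Rightarrow> int" and D where "x = (\<Sum>k\<le>D. of_int (c k) * (\<alpha> gchoose k))"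
    using poly_eq_int_sum_gbinomial[of f] by metis
  thus "x \<in> R_plus \<alpha>"
    by (auto intro!: sum_mem_R_plus of_int_mult_mem_R_plus gbinomial_mem_R_plus
        uminus_gbinomial_mem_R_plus[OF assms])
qed

section \<open>Algebraic integers\<close>

interpretation int_span: Modules.module "\<lambda>(n::int) (x::complex). of_int n * x"
  by standard (simp_all add: algebra_simps)

interpretation rat_span: Vector_Spaces.vector_space "\<lambda>(q::rat) (x::complex). of_rat q * x"
  by standard (simp_all add: algebra_simps of_rat_add of_rat_mult)

text \<open>As simp rules these loop with \<open>of_int_mult\<close> and \<open>of_rat_mult\<close>.\<close>

declare int_span.scale_scale [simp del] rat_span.scale_scale [simp del]

text \<open>The determinant trick: x acts on the generators through an integer matrix, and the
  vector of generators, nonzero because of s, is an eigenvector. So x is a root of the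
  characteristic polynomial, which is monic and integral.\<close>

lemma algebraic_int_if_span_stable:
  assumes "finite S" "s \<in> S" "s \<noteq> 0" and stable: "\<And>s. s \<in> S \<Longrightarrow> x * s \<in> int_span.span S"
  shows "algebraic_int x"
proof -
  obtain xs where xs: "set xs = S" "distinct xs"
    using finite_distinct_list[OF \<open>finite S\<close>] by blast
  define n where "n = length xs"
  have "\<exists>u. x * s = (\<Sum>t\<in>S. of_int (u t) * t)" if "s \<in> S" for s
    using stable[OF that] by (auto simp: int_span.span_finite[OF \<open>finite S\<close>])
  then obtain u where u: "\<And>s. s \<in> S \<Longrightarrow> x * s = (\<Sum>t\<in>S. of_int (u s t) * t)"
    by metis
  define A where "A = mat n n (\<lambda>(i, j). u (xs ! i) (xs ! j))"
  define v where "v = vec n (\<lambda>i. xs ! i)"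
  let ?B = "map_mat (of_int :: int \<Rightarrow> complex) A"
  have A: "A \<in> carrier_mat n n"
    by (simp add: A_def)
  have "vec_index (?B *\<^sub>v v) i = vec_index (x \<cdot>\<^sub>v v) i" if "i < n" for i
  proof -
    have "x * xs ! i = (\<Sum>t\<in>set xs. of_int (u (xs ! i) t) * t)"
      using u[OF nth_mem[of i xs, unfolded xs(1)]] that xs(1) by (simp add: n_def)
    also have "\<dots> = (\<Sum>j<n. of_int (u (xs ! i) (xs ! j)) * xs ! j)"
      using bij_betw_nth[OF xs(2) refl refl] by (intro sum.reindex_bij_betw[symmetric]) (simp add: n_def)
    finally show ?thesis
      using that by (simp add: A_def v_def scalar_prod_def lessThan_atLeast0)
  qed
  hence "?B *\<^sub>v v = x \<cdot>\<^sub>v v"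
    using A by (intro eq_vecI) (auto simp: v_def)
  moreover obtain i where "i < n" "xs ! i = s"
    using assms(2) xs(1) by (auto simp: n_def in_set_conv_nth)
  hence "v \<noteq> 0\<^sub>v n"
    using \<open>s \<noteq> 0\<close> by (metis index_vec index_zero_vec(1) v_def)
  ultimately have "eigenvalue ?B x"
    using A by (auto simp: eigenvalue_def eigenvector_def v_def intro!: exI[of _ v])
  hence "poly (char_poly ?B) x = 0"
    using A by (subst (asm) eigenvalue_root_char_poly) auto
  also have "char_poly ?B = map_poly of_int (char_poly A)"
    by (rule of_int_hom.char_poly_hom[OF A])
  finally show ?thesis
    using degree_monic_char_poly[OF A] by (auto simp: algebraic_int_altdef_ipoly)
qed

lemma algebraic_int_power_mem_span:
  fixes x :: complex
  assumes "algebraic_int x"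
  obtains n where "n > 0" "x ^ n \<in> int_span.span ((\<lambda>i. x ^ i) ` {..<n})"
proof -
  obtain p :: "int poly" where p: "poly (map_poly of_int p) x = 0" "lead_coeff p = 1"
    using assms by (auto simp: algebraic_int_altdef_ipoly)
  define n where "n = degree p"
  have "0 = (\<Sum>i\<le>n. of_int (coeff p i) * x ^ i)"
    using p by (simp add: poly_altdef degree_map_poly coeff_map_poly n_def)
  also have "\<dots> = (\<Sum>i<n. of_int (coeff p i) * x ^ i) + x ^ n"
    using p(2) by (simp add: lessThan_Suc_atMost[symmetric] n_def)
  finally have eq: "x ^ n = - (\<Sum>i<n. of_int (coeff p i) * x ^ i)"
    by (simp add: eq_neg_iff_add_eq_0 add.commute)
  show ?thesis
  proof
    show "n > 0"
      using eq by (cases n) auto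
    show "x ^ n \<in> int_span.span ((\<lambda>i. x ^ i) ` {..<n})"
      unfolding eq
      by (intro int_span.span_neg int_span.span_sum int_span.span_scale int_span.span_base) auto
  qed
qed

lemma int_span_mult_closed:
  assumes "\<And>s. s \<in> S \<Longrightarrow> x * s \<in> int_span.span S" "y \<in> int_span.span S"
  shows "x * y \<in> int_span.span S"
  using assms(2)
proof (induction rule: int_span.span_induct_alt)
  case (step c s y)
  have "x * (of_int c * s + y) = of_int c * (x * s) + x * y"
    by (simp add: algebra_simps)
  thus ?case
    using step assms(1) by (simp add: int_span.span_add int_span.span_scale)
qed (simp add: int_span.span_zero)

lemma int_span_mult_right:
  assumes "y \<in> int_span.span S" "\<And>s. s \<in> S \<Longrightarrow> s * z \<in> int_span.span T"
  shows "y * z \<in> int_span.span T"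
  using assms(1)
proof (induction rule: int_span.span_induct_alt)
  case (step c s y)
  have "(of_int c * s + y) * z = of_int c * (s * z) + y * z"
    by (simp add: algebra_simps)
  thus ?case
    using step assms(2) by (simp add: int_span.span_add int_span.span_scale)
qed (simp add: int_span.span_zero)

text \<open>Multiplication by x leaves the box of exponents only at i + 1 = n, where x ^ n is
  rewritten through smaller powers; likewise for y. Hence x + y and x * y also stabilize this
  span.\<close>

lemma algebraic_int_pair_span:
  fixes x y :: complex
  assumes x: "n > 0" "x ^ n \<in> int_span.span ((\<lambda>i. x ^ i) ` {..<n})"
    and y: "m > 0" "y ^ m \<in> int_span.span ((\<lambda>i. y ^ i) ` {..<m})"
  defines "S \<equiv> (\<lambda>(i, j). x ^ i * y ^ j) ` ({..<n} \<times> {..<m})"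
  shows "s \<in> S \<Longrightarrow> x * s \<in> int_span.span S" "s \<in> S \<Longrightarrow> y * s \<in> int_span.span S"
proof -
  have S: "x ^ i * y ^ j \<in> int_span.span S" if "i < n" "j < m" for i j
    using that by (intro int_span.span_base) (auto simp: S_def)
  assume "s \<in> S"
  then obtain i j where s: "s = x ^ i * y ^ j" "i < n" "j < m"
    by (auto simp: S_def)
  show "x * s \<in> int_span.span S"
  proof (cases "Suc i = n")
    case True
    have "x ^ n * y ^ j \<in> int_span.span S"
      by (rule int_span_mult_right[OF x(2)]) (use S s in auto)
    thus ?thesis
      using s(1) by (simp flip: True add: mult.assoc)
  next
    case False
    thus ?thesis
      using S[of "Suc i" j] s by (simp add: mult.assoc)
  qed
  show "y * s \<in> int_span.span S"
  proof (cases "Suc j = m")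
    case True
    have "y ^ m * x ^ i \<in> int_span.span S"
      by (rule int_span_mult_right[OF y(2)]) (use S s in \<open>auto simp: mult.commute\<close>)
    thus ?thesis
      using s(1) by (simp flip: True add: mult_ac)
  next
    case False
    thus ?thesis
      using S[of i "Suc j"] s by (simp add: mult_ac)
  qed
qed

lemma
  fixes x y :: complex
  assumes "algebraic_int x" "algebraic_int y"
  shows algebraic_int_plus: "algebraic_int (x + y)"
    and algebraic_int_times: "algebraic_int (x * y)"
proof -
  obtain n where n: "n > 0" "x ^ n \<in> int_span.span ((\<lambda>i. x ^ i) ` {..<n})"
    using algebraic_int_power_mem_span[OF assms(1)] .
  obtain m where m: "m > 0" "y ^ m \<in> int_span.span ((\<lambda>i. y ^ i) ` {..<m})"
    using algebraic_int_power_mem_span[OF assms(2)] .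
  define S where "S = (\<lambda>(i, j). x ^ i * y ^ j) ` ({..<n} \<times> {..<m})"
  note stable = algebraic_int_pair_span[OF n m, folded S_def]
  have S: "finite S" "1 \<in> S"
    using n m by (auto simp: S_def image_iff intro!: bexI[of _ 0])
  show "algebraic_int (x + y)"
    by (rule algebraic_int_if_span_stable[OF S])
      (auto simp: ring_distribs intro: int_span.span_add stable)
  show "algebraic_int (x * y)"
    by (rule algebraic_int_if_span_stable[OF S])
      (simp_all only: mult.assoc int_span_mult_closed[OF stable(1) stable(2)], simp)
qed

text \<open>A case of transitivity of integrality: x satisfies a monic equation whose coefficients
  are integers except for a term z in the constant coefficient. The monomials x ^ i * z ^ j below
  both degrees span a module stable under x. It is used with z = 0 and with z a difference of
  integral elements.\<close>

lemma algebraic_int_if_power_mem_span_add: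
  fixes x z :: complex
  assumes z: "algebraic_int z" and n: "n > 0"
    and x: "x ^ n - z \<in> int_span.span ((\<lambda>i. x ^ i) ` {..<n})"
  shows "algebraic_int x"
proof -
  obtain m where m: "m > 0" "z ^ m \<in> int_span.span ((\<lambda>i. z ^ i) ` {..<m})"
    using algebraic_int_power_mem_span[OF z] .
  define S where "S = (\<lambda>(i, j). x ^ i * z ^ j) ` ({..<n} \<times> {..<m})"
  have base: "x ^ i * z ^ j \<in> int_span.span S" if "i < n" "j < m" for i j
    using that by (intro int_span.span_base) (auto simp: S_def)
  have S: "finite S" "1 \<in> S"
    using n m by (auto simp: S_def image_iff intro!: bexI[of _ 0])
  have "x * s \<in> int_span.span S" if "s \<in> S" for s
  proof -
    obtain i j where s: "s = x ^ i * z ^ j" "i < n" "j < m"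
      using \<open>s \<in> S\<close> by (auto simp: S_def)
    show ?thesis
    proof (cases "Suc i = n")
      case True
      have "(x ^ n - z) * z ^ j \<in> int_span.span S"
        by (rule int_span_mult_right[OF x]) (use base s in auto)
      moreover have "z * z ^ j \<in> int_span.span S"
      proof (cases "Suc j = m")
        case True
        have "z ^ m * 1 \<in> int_span.span S"
          by (rule int_span_mult_right[OF m(2)]) (use base[of 0] n in auto)
        thus ?thesis by (simp flip: True)
      next
        case False
        thus ?thesis using base[of 0 "Suc j"] n s by simp
      qed
      ultimately have "(x ^ n - z) * z ^ j + z * z ^ j \<in> int_span.span S"
        by (rule int_span.span_add)
      also have "(x ^ n - z) * z ^ j + z * z ^ j = x * s"
        unfolding s(1) True[symmetric] by (simp add: algebra_simps)
      finally show ?thesis .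
    next
      case False
      thus ?thesis
        using base[of "Suc i" j] s by (simp add: mult.assoc)
    qed
  qed
  from algebraic_int_if_span_stable[OF S _ this] show ?thesis by simp
qed

section \<open>Number fields inside the complex numbers\<close>

text \<open>Inverses are left to \<open>number_field\<close>, so that the span of the powers of
  \<alpha> can first be recognized as an instance; its inverses are then obtained from
  \<open>ex_int_poly_mult_eq_of_int\<close>.\<close>

locale rational_algebra =
  fixes F :: "complex set"
  assumes zero_closed: "0 \<in> F" and one_closed: "1 \<in> F"
    and add_closed: "x \<in> F \<Longrightarrow> y \<in> F \<Longrightarrow> x + y \<in> F"
    and uminus_closed: "x \<in> F \<Longrightarrow> - x \<in> F"
    and mult_closed: "x \<in> F \<Longrightarrow> y \<in> F \<Longrightarrow> x * y \<in> F"
    and finite_dim: "\<exists>B. finite B \<and> F \<subseteq> rat_span.span B"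
begin

lemma diff_closed: "x \<in> F \<Longrightarrow> y \<in> F \<Longrightarrow> x - y \<in> F"
  using add_closed[of x "- y"] uminus_closed by simp

lemma power_closed: "x \<in> F \<Longrightarrow> x ^ n \<in> F"
  by (induction n) (simp_all add: one_closed mult_closed)

lemma of_nat_closed: "of_nat n \<in> F"
  by (induction n) (simp_all add: zero_closed one_closed add_closed)

lemma of_int_closed: "of_int n \<in> F"
  by (cases n) (simp_all add: of_nat_closed one_closed add_closed uminus_closed diff_closed)

lemma sum_closed: "(\<And>i. i \<in> A \<Longrightarrow> f i \<in> F) \<Longrightarrow> sum f A \<in> F"
  by (induction A rule: infinite_finite_induct) (simp_all add: zero_closed add_closed)

text \<open>Beyond the size of a finite spanning set there is a rational dependence; the product of
  all its denominators makes it integral. The bound is uniform in the set S.\<close>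

lemma ex_int_relation:
  obtains n where "\<And>S. finite S \<Longrightarrow> S \<subseteq> F \<Longrightarrow> card S > n \<Longrightarrow>
    \<exists>u :: complex \<Rightarrow> int. (\<Sum>v\<in>S. of_int (u v) * v) = 0 \<and> (\<exists>v\<in>S. u v \<noteq> 0)"
proof -
  obtain B where B: "finite B" "F \<subseteq> rat_span.span B"
    using finite_dim by blast
  have "\<exists>u :: complex \<Rightarrow> int. (\<Sum>v\<in>S. of_int (u v) * v) = 0 \<and> (\<exists>v\<in>S. u v \<noteq> 0)"
    if S: "finite S" "S \<subseteq> F" "card S > card B" for S
  proof -
    have "rat_span.dependent S"
      using rat_span.independent_span_bound[OF B(1), of S] S(3) subset_trans[OF S(2) B(2)]
      by (meson not_le)
    then obtain q where q: "(\<Sum>v\<in>S. of_rat (q v) * v) = 0" "\<exists>v\<in>S. q v \<noteq> 0"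
      using rat_span.dependent_finite[OF S(1)] by blast
    have "\<exists>a b. b \<noteq> 0 \<and> q v = of_int a / of_int b" for v
      using quotient_of_div[of "q v"] quotient_of_denom_pos[of "q v"]
      by (cases "quotient_of (q v)") (auto intro!: exI)
    then obtain a b where ab: "\<And>v. b v \<noteq> (0::int)" "\<And>v. q v = of_int (a v) / of_int (b v)"
      by metis
    define u where "u v = a v * (\<Prod>w\<in>S - {v}. b w)" for v
    define P where "P = (\<Prod>w\<in>S. b w)"
    have u: "of_int (u v) = q v * of_int P" if "v \<in> S" for v
      using ab(1)[of v] by (simp add: P_def u_def ab(2) prod.remove[OF S(1) that])
    have "(\<Sum>v\<in>S. of_int (u v) * v) = (\<Sum>v\<in>S. of_rat (of_int (u v)) * v)"
      by simp
    also have "\<dots> = of_int P * (\<Sum>v\<in>S. of_rat (q v) * v)"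
      unfolding sum_distrib_left
      by (intro sum.cong refl) (simp add: u of_rat_mult del: of_rat_of_int_eq, simp add: mult_ac)
    also have "\<dots> = 0"
      by (simp add: q(1))
    finally have "(\<Sum>v\<in>S. of_int (u v) * v) = 0" .
    moreover have "\<exists>v\<in>S. u v \<noteq> 0"
      using q(2) ab S(1) by (auto simp: u_def)
    ultimately show ?thesis by blast
  qed
  thus ?thesis
    using that by blast
qed

text \<open>After division by the gcd of its coefficients a relation cannot vanish modulo p. The
  bound stays independent of p.\<close>

lemma ex_int_relation_mod:
  obtains n where "\<And>S p. finite S \<Longrightarrow> S \<subseteq> F \<Longrightarrow> card S > n \<Longrightarrow> Factorial_Ring.prime (p::nat) \<Longrightarrow>
    \<exists>u :: complex \<Rightarrow> int. (\<Sum>v\<in>S. of_int (u v) * v) = 0 \<and> (\<exists>v\<in>S. \<not> int p dvd u v)"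
proof -
  obtain n where n: "\<And>S. finite S \<Longrightarrow> S \<subseteq> F \<Longrightarrow> card S > n \<Longrightarrow>
    \<exists>u :: complex \<Rightarrow> int. (\<Sum>v\<in>S. of_int (u v) * v) = 0 \<and> (\<exists>v\<in>S. u v \<noteq> 0)"
    using ex_int_relation by blast
  have "\<exists>u :: complex \<Rightarrow> int. (\<Sum>v\<in>S. of_int (u v) * v) = 0 \<and> (\<exists>v\<in>S. \<not> int p dvd u v)"
    if S: "finite S" "S \<subseteq> F" "card S > n" and p: "Factorial_Ring.prime (p::nat)" for S p
  proof -
    obtain u :: "complex \<Rightarrow> int" where u: "(\<Sum>v\<in>S. of_int (u v) * v) = 0" "\<exists>v\<in>S. u v \<noteq> 0"
      using n[OF S] by blast
    define g where "g = Gcd (u ` S)"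
    define w where "w v = u v div g" for v
    have g: "g \<noteq> 0"
      using u(2) by (auto simp: g_def Gcd_0_iff)
    have uw: "u v = g * w v" if "v \<in> S" for v
      using that by (simp add: w_def g_def)
    have "of_int g * (\<Sum>v\<in>S. of_int (w v) * v) = (\<Sum>v\<in>S. of_int (u v) * v)"
      by (simp add: sum_distrib_left uw mult_ac)
    with u g have "(\<Sum>v\<in>S. of_int (w v) * v) = 0" by simp
    moreover have "\<exists>v\<in>S. \<not> int p dvd w v"
    proof (rule ccontr)
      assume "\<not> (\<exists>v\<in>S. \<not> int p dvd w v)"
      hence "g * int p dvd g"
        by (subst (2) g_def, intro Gcd_greatest) (auto simp: uw)
      hence "is_unit (int p)"
        using g by (metis dvd_mult_cancel_left mult.right_neutral)
      thus False using p by (simp add: prime_int_iff)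
    qed
    ultimately show ?thesis by blast
  qed
  thus ?thesis
    using that by blast
qed

text \<open>A / pA is a vector space over F_p. A set independent in it satisfies no integral
  relation that is nontrivial modulo p, so its size is bounded by
  \<open>ex_int_relation_mod\<close>. A largest such set spans A / pA, and coefficients from 0 to p
  - 1 suffice.\<close>

lemma finite_mod_prime:
  assumes A: "A \<subseteq> F" "0 \<in> A" "\<And>x y. x \<in> A \<Longrightarrow> y \<in> A \<Longrightarrow> x + y \<in> A" "\<And>x. x \<in> A \<Longrightarrow> - x \<in> A"
    and p: "Factorial_Ring.prime (p::nat)"
  shows "\<exists>S. finite S \<and> S \<subseteq> A \<and> (\<forall>y\<in>A. \<exists>s\<in>S. \<exists>a\<in>A. y = s + of_nat p * a)"
proof -
  have nat: "of_nat n * x \<in> A" if "x \<in> A" for x n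
    using that A by (induction n) (simp_all add: ring_distribs)
  have int: "of_int n * x \<in> A" if "x \<in> A" for x n
    using nat[OF that] nat[OF A(4)[OF that]] by (cases n rule: int_cases2) simp_all
  have sum: "sum f S \<in> A" if "\<And>i. i \<in> S \<Longrightarrow> f i \<in> A" for f :: "complex \<Rightarrow> complex" and S
    using that A(2,3) by (induction S rule: infinite_finite_induct) simp_all
  obtain n where n: "\<And>S p. finite S \<Longrightarrow> S \<subseteq> F \<Longrightarrow> card S > n \<Longrightarrow> Factorial_Ring.prime (p::nat) \<Longrightarrow>
    \<exists>u :: complex \<Rightarrow> int. (\<Sum>v\<in>S. of_int (u v) * v) = 0 \<and> (\<exists>v\<in>S. \<not> int p dvd u v)"
    using ex_int_relation_mod by blast
  \<comment> \<open>Linear independence over F_p of the images of S in A / pA.\<close>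
  define indep where "indep S \<longleftrightarrow> finite S \<and> S \<subseteq> A \<and> (\<forall>u :: complex \<Rightarrow> int. \<forall>a\<in>A.
    (\<Sum>v\<in>S. of_int (u v) * v) = of_nat p * a \<longrightarrow> (\<forall>v\<in>S. int p dvd u v))" for S
  have bound: "card S < Suc n" if S: "indep S" for S
  proof (rule ccontr)
    assume "\<not> card S < Suc n"
    then obtain u :: "complex \<Rightarrow> int" where u: "(\<Sum>v\<in>S. of_int (u v) * v) = of_nat p * 0" "\<exists>v\<in>S. \<not> int p dvd u v"
      using n[of S p] S A(1) p by (auto simp: indep_def)
    thus False
      using S A(2) unfolding indep_def by blast
  qed
  have "indep {}" by (simp add: indep_def)
  then obtain S where S: "indep S" "\<And>T. indep T \<Longrightarrow> card T \<le> card S"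
    using ex_has_greatest_nat[of indep "{}" card "Suc n"] bound by blast
  have fin: "finite S" and sub: "S \<subseteq> A"
    using S(1) by (simp_all add: indep_def)
  define R where "R = (\<lambda>c. \<Sum>v\<in>S. of_int (c v) * v) ` (S \<rightarrow>\<^sub>E {0..<int p})"
  have red: "\<exists>s\<in>R. \<exists>a\<in>A. (\<Sum>v\<in>S. of_int (c v) * v) = s + of_nat p * a" for c
  proof -
    have "of_int (c v) * v = of_int (c v mod int p) * v + of_nat p * (of_int (c v div int p) * v)" for v :: complex
    proof -
      have "of_int (c v mod int p + int p * (c v div int p)) = (of_int (c v) :: complex)"
        by simp
      hence eq: "of_int (c v mod int p) + of_nat p * of_int (c v div int p) = (of_int (c v) :: complex)"
        by (simp only: of_int_add of_int_mult of_int_of_nat_eq)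
      show ?thesis unfolding eq[symmetric] by (simp add: algebra_simps)
    qed
    hence "(\<Sum>v\<in>S. of_int (c v) * v) =
        (\<Sum>v\<in>S. of_int (restrict (\<lambda>v. c v mod int p) S v) * v) + of_nat p * (\<Sum>v\<in>S. of_int (c v div int p) * v)"
      by (simp add: sum.distrib sum_distrib_left)
    moreover have "restrict (\<lambda>v. c v mod int p) S \<in> S \<rightarrow>\<^sub>E {0..<int p}"
      using p by (auto simp: prime_gt_0_nat)
    moreover have "(\<Sum>v\<in>S. of_int (c v div int p) * v) \<in> A"
      using sub by (intro sum int) auto
    ultimately show ?thesis
      unfolding R_def by blast
  qed
  have "\<exists>s\<in>R. \<exists>a\<in>A. y = s + of_nat p * a" if y: "y \<in> A" for y
  proof (cases "y \<in> S")
    case True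
    have "(\<Sum>v\<in>S. of_int (if v = y then 1 else 0) * v) = y"
      using True fin by (simp add: if_distrib[of of_int] if_distrib[of "\<lambda>x. x * _"] cong: if_cong)
    thus ?thesis
      using red[of "\<lambda>v. if v = y then 1 else 0"] by simp
  next
    case False
    hence "\<not> indep (insert y S)"
      using S(2)[of "insert y S"] fin by auto
    then obtain u :: "complex \<Rightarrow> int" and a where u: "a \<in> A" "(\<Sum>v\<in>insert y S. of_int (u v) * v) = of_nat p * a"
        "\<exists>v\<in>insert y S. \<not> int p dvd u v"
      using fin sub y by (auto simp: indep_def)
    hence eq: "of_int (u y) * y + (\<Sum>v\<in>S. of_int (u v) * v) = of_nat p * a"
      using fin False by simp
    \<comment> \<open>Otherwise the term of y could be moved into pA, and independence of S would
      force p to divide every coefficient.\<close>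
    have "\<not> int p dvd u y"
    proof
      assume dvd: "int p dvd u y"
      then obtain k where k: "u y = int p * k" by blast
      have "(\<Sum>v\<in>S. of_int (u v) * v) = of_nat p * (a + - (of_int k * y))"
        using eq k by (simp add: algebra_simps)
      hence "\<forall>v\<in>S. int p dvd u v"
        using S(1) A(3)[OF u(1) A(4)[OF int[OF y]]] unfolding indep_def by blast
      thus False using u(3) dvd by blast
    qed
    hence "coprime (u y) (int p)"
      using p by (metis coprime_commute prime_imp_coprime prime_nat_int_transfer)
    then obtain w where "[u y * w = 1] (mod int p)"
      using cong_solve_coprime_int by blast
    hence "int p dvd u y * w - 1"
      by (simp add: cong_iff_dvd_diff)
    then obtain k where k: "u y * w - 1 = int p * k" by blast
    have "of_int (u y * w - 1) = (of_nat p * of_int k :: complex)"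
      unfolding k by simp
    hence "(of_int (u y) * of_int w :: complex) = 1 + of_nat p * of_int k"
      by (simp add: algebra_simps)
    \<comment> \<open>The relation is multiplied by the inverse w of \<open>u y\<close> modulo p;
      the error p * k * y belongs to pA.\<close>
    hence "y = of_int w * (of_int (u y) * y) - of_nat p * of_int k * y"
      by (simp add: algebra_simps)
    also have "of_int (u y) * y = of_nat p * a - (\<Sum>v\<in>S. of_int (u v) * v)"
      using eq by (simp add: algebra_simps)
    finally have 1: "y = (\<Sum>v\<in>S. of_int (- w * u v) * v) + of_nat p * (of_int w * a + - (of_int k * y))"
      by (simp add: algebra_simps sum_distrib_left sum_negf)
    obtain s b where s: "s \<in> R" "b \<in> A" "(\<Sum>v\<in>S. of_int (- w * u v) * v) = s + of_nat p * b"
      using red[of "\<lambda>v. - w * u v"] by blast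
    have "y = s + of_nat p * (b + (of_int w * a + - (of_int k * y)))"
      by (subst 1, unfold s(3)) (simp add: algebra_simps)
    thus ?thesis
      using s A(3)[OF s(2) A(3)[OF int[OF u(1)] A(4)[OF int[OF y]]]] by blast
  qed
  moreover have "finite R"
    unfolding R_def using fin by (intro finite_imageI finite_PiE) auto
  moreover have "R \<subseteq> A"
    using sub by (auto simp: R_def intro!: sum int)
  ultimately show ?thesis by blast
qed

text \<open>Expansion by digits: if y = s + p * a and a = t + M * b, then y = (s + p * t) + (p * M)
  * b.\<close>

lemma finite_mod:
  assumes A: "A \<subseteq> F" "0 \<in> A" "\<And>x y. x \<in> A \<Longrightarrow> y \<in> A \<Longrightarrow> x + y \<in> A" "\<And>x. x \<in> A \<Longrightarrow> - x \<in> A"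
    and N: "N > 0"
  shows "\<exists>S. finite S \<and> S \<subseteq> A \<and> (\<forall>y\<in>A. \<exists>s\<in>S. \<exists>a\<in>A. y = s + of_nat N * a)"
  using N
proof (induction N rule: less_induct)
  case (less N)
  show ?case
  proof (cases "N = 1")
    case True
    thus ?thesis
      using A(2) by (intro exI[of _ "{0}"]) auto
  next
    case False
    then obtain p where p: "Factorial_Ring.prime p" "p dvd N"
      using prime_factor_nat by blast
    then obtain M where M: "N = p * M" by blast
    have M': "M < N" "M > 0"
      using M less.prems prime_gt_1_nat[OF p(1)] by auto
    obtain S where S: "finite S" "S \<subseteq> A" "\<And>y. y \<in> A \<Longrightarrow> \<exists>s\<in>S. \<exists>a\<in>A. y = s + of_nat p * a"
      using finite_mod_prime[OF A p(1)] by blast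
    obtain T where T: "finite T" "T \<subseteq> A" "\<And>y. y \<in> A \<Longrightarrow> \<exists>s\<in>T. \<exists>a\<in>A. y = s + of_nat M * a"
      using less.IH[OF M'] by blast
    have nat: "of_nat n * x \<in> A" if "x \<in> A" for x n
      using that A by (induction n) (simp_all add: ring_distribs)
    show ?thesis
    proof (intro exI[of _ "(\<lambda>(s, t). s + of_nat p * t) ` (S \<times> T)"] conjI ballI)
      fix y assume "y \<in> A"
      then obtain s a where s: "s \<in> S" "a \<in> A" "y = s + of_nat p * a"
        using S(3) by blast
      obtain t b where t: "t \<in> T" "b \<in> A" "a = t + of_nat M * b"
        using T(3)[OF s(2)] by blast
      have "y = (s + of_nat p * t) + of_nat N * b"
        by (simp add: s(3) t(3) M algebra_simps)
      thus "\<exists>s\<in>(\<lambda>(s, t). s + of_nat p * t) ` (S \<times> T). \<exists>a\<in>A. y = s + of_nat N * a"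
        using s(1) t(1,2) by (intro bexI[of _ "s + of_nat p * t"] bexI[of _ b]) auto
    qed (use S(1,2) T(1,2) in \<open>auto intro!: A(3) nat\<close>)
  qed
qed

lemma ex_nonzero_int_poly_root:
  assumes "x \<in> F"
  obtains p :: "int poly" where "p \<noteq> 0" "poly (map_poly of_int p) x = 0"
proof -
  obtain n where n: "\<And>S. finite S \<Longrightarrow> S \<subseteq> F \<Longrightarrow> card S > n \<Longrightarrow>
    \<exists>u :: complex \<Rightarrow> int. (\<Sum>v\<in>S. of_int (u v) * v) = 0 \<and> (\<exists>v\<in>S. u v \<noteq> 0)"
    using ex_int_relation by blast
  show ?thesis
  \<comment> \<open>The relation is indexed by a set of numbers, so coinciding powers need their own
    polynomial X^i - X^j.\<close>
  proof (cases "inj_on (\<lambda>i. x ^ i) {..n}")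
    case True
    have "card ((\<lambda>i. x ^ i) ` {..n}) > n"
      using card_image[OF True] by simp
    then obtain u :: "complex \<Rightarrow> int" where u: "(\<Sum>v\<in>(\<lambda>i. x ^ i) ` {..n}. of_int (u v) * v) = 0"
        "\<exists>v\<in>(\<lambda>i. x ^ i) ` {..n}. u v \<noteq> 0"
      using n[of "(\<lambda>i. x ^ i) ` {..n}"] assms power_closed by auto
    define p where "p = (\<Sum>i\<le>n. Polynomial.monom (u (x ^ i)) i)"
    have coeff: "coeff p i = (if i \<le> n then u (x ^ i) else 0)" for i
      by (simp add: p_def coeff_sum)
    have "map_poly of_int p = (\<Sum>i\<le>n. Polynomial.monom (of_int (u (x ^ i)) :: complex) i)"
      by (rule poly_eqI) (simp add: coeff_map_poly coeff coeff_sum)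
    hence "poly (map_poly of_int p) x = 0"
      using u(1) by (simp add: sum.reindex[OF True] poly_sum poly_monom)
    moreover have "p \<noteq> 0"
      using u(2) by (auto simp: poly_eq_iff coeff)
    ultimately show ?thesis
      using that by blast
  next
    case False
    then obtain i j where ij: "i \<noteq> j" "x ^ i = x ^ j"
      by (auto simp: inj_on_def)
    define p :: "int poly" where "p = Polynomial.monom 1 i - Polynomial.monom 1 j"
    have "map_poly of_int p = (Polynomial.monom 1 i - Polynomial.monom 1 j :: complex poly)"
      by (rule poly_eqI) (simp add: p_def coeff_map_poly)
    hence "poly (map_poly of_int p) x = 0"
      by (simp add: poly_monom ij)
    moreover have "coeff p i = 1"
      using ij(1) by (simp add: p_def)
    hence "p \<noteq> 0" by auto
    ultimately show ?thesis
      using that by blast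
  qed
qed

lemma poly_closed: "x \<in> F \<Longrightarrow> poly (map_poly of_int (p :: int poly)) x \<in> F"
  by (induction p) (simp_all add: zero_closed of_int_hom.map_poly_pCons_hom add_closed mult_closed of_int_closed)

text \<open>Factors X are removed from an annihilating polynomial until its constant term c is
  nonzero; then c + X * q vanishes at x. Up to a rational factor, q(x) is the inverse of x.\<close>

lemma ex_int_poly_mult_eq_of_int:
  assumes "x \<in> F" "x \<noteq> 0"
  obtains q :: "int poly" and c :: int where "c \<noteq> 0" "x * poly (map_poly of_int q) x = of_int c"
proof -
  obtain p :: "int poly" where p: "p \<noteq> 0" "poly (map_poly of_int p) x = 0"
    using ex_nonzero_int_poly_root[OF assms(1)] .
  from p have "\<exists>(q :: int poly) c :: int. c \<noteq> 0 \<and> x * poly (map_poly of_int q) x = of_int c"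
  proof (induction p)
    case (pCons c p)
    have eq: "x * poly (map_poly of_int p) x = of_int (- c)"
      using pCons.prems(2) by (simp add: of_int_hom.map_poly_pCons_hom eq_neg_iff_add_eq_0 add.commute)
    show ?case
    proof (cases "c = 0")
      case True
      thus ?thesis
        using eq assms(2) pCons.prems(1) pCons.IH by simp
    next
      case False
      thus ?thesis
        using eq by (metis neg_equal_0_iff_equal)
    qed
  qed simp
  thus ?thesis using that by blast
qed

end

locale number_field = rational_algebra +
  assumes inverse_closed: "x \<in> F \<Longrightarrow> inverse x \<in> F"
begin

lemma divide_closed: "x \<in> F \<Longrightarrow> y \<in> F \<Longrightarrow> x / y \<in> F"
  by (simp add: divide_inverse mult_closed inverse_closed)

end

section \<open>Fractional ideals\<close>

lemma complex_ring_simps [simp]: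
  "carrier complex_ring = UNIV" "x \<otimes>\<^bsub>complex_ring\<^esub> y = x * y" "x \<oplus>\<^bsub>complex_ring\<^esub> y = x + y"
  "\<one>\<^bsub>complex_ring\<^esub> = 1" "\<zero>\<^bsub>complex_ring\<^esub> = 0"
  by (simp_all add: ring_of_type_algebra_def)

lemma complex_ring_a_inv [simp]: "\<ominus>\<^bsub>complex_ring\<^esub> x = - x"
proof -
  interpret field complex_ring by (rule field_from_type_algebra)
  show ?thesis by (rule minus_equality) auto
qed

lemma complex_ring_m_inv: "x \<noteq> 0 \<Longrightarrow> inv\<^bsub>complex_ring\<^esub> x = inverse x"
proof -
  interpret field complex_ring by (rule field_from_type_algebra)
  assume "x \<noteq> 0"
  thus ?thesis by (intro comm_inv_char) auto
qed

lemma subgroup_complex_ring_iff: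
  "subgroup I (add_monoid complex_ring) \<longleftrightarrow> 0 \<in> I \<and> (\<forall>x\<in>I. \<forall>y\<in>I. x + y \<in> I) \<and> (\<forall>x\<in>I. - x \<in> I)"
  using complex_ring_a_inv by (auto simp: subgroup_def a_inv_def)

lemma ideal_prod_complex_subset:
  assumes "\<And>x y. x \<in> I \<Longrightarrow> y \<in> J \<Longrightarrow> x * y \<in> T" "\<And>x y. x \<in> T \<Longrightarrow> y \<in> T \<Longrightarrow> x + y \<in> T"
  shows "ideal_prod complex_ring I J \<subseteq> T"
proof
  fix x assume "x \<in> ideal_prod complex_ring I J"
  thus "x \<in> T"
    by induction (use assms in simp_all)
qed

lemma ideal_prod_complexI: "x \<in> I \<Longrightarrow> y \<in> J \<Longrightarrow> x * y \<in> ideal_prod complex_ring I J"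
  using ideal_prod.prod[of x I y J complex_ring] by simp

lemma ideal_prod_complex_add:
  "x \<in> ideal_prod complex_ring I J \<Longrightarrow> y \<in> ideal_prod complex_ring I J \<Longrightarrow> x + y \<in> ideal_prod complex_ring I J"
  using ideal_prod.sum[of x complex_ring I J y] by simp

lemma ideal_prod_complex_comm: "ideal_prod complex_ring I J = ideal_prod complex_ring J I"
proof -
  have "ideal_prod complex_ring I J \<subseteq> ideal_prod complex_ring J I" for I J
    by (rule ideal_prod_complex_subset)
      (metis ideal_prod_complexI mult.commute, rule ideal_prod_complex_add)
  thus ?thesis by blast
qed

lemma ideal_prod_complex_mult_mem:
  assumes "x \<in> ideal_prod complex_ring I J" "\<And>y. y \<in> I \<Longrightarrow> a * y \<in> I"
  shows "a * x \<in> ideal_prod complex_ring I J"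
proof -
  have "ideal_prod complex_ring I J \<subseteq> {x. a * x \<in> ideal_prod complex_ring I J}"
    by (rule ideal_prod_complex_subset)
      (use assms(2) in \<open>auto simp: ring_distribs simp flip: mult.assoc
        intro: ideal_prod_complexI ideal_prod_complex_add\<close>)
  thus ?thesis using assms(1) by blast
qed

lemma ideal_prod_complex_assoc:
  "ideal_prod complex_ring (ideal_prod complex_ring I J) K =
   ideal_prod complex_ring I (ideal_prod complex_ring J K)"
proof -
  have sub: "ideal_prod complex_ring (ideal_prod complex_ring I J) K \<subseteq>
    ideal_prod complex_ring I (ideal_prod complex_ring J K)" for I J K
  proof (rule ideal_prod_complex_subset)
    fix x k assume x: "x \<in> ideal_prod complex_ring I J" and k: "k \<in> K"
    have "ideal_prod complex_ring I J \<subseteq> {x. x * k \<in> ideal_prod complex_ring I (ideal_prod complex_ring J K)}"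
      by (rule ideal_prod_complex_subset)
        (use k in \<open>auto simp: ring_distribs mult.assoc intro: ideal_prod_complexI ideal_prod_complex_add\<close>)
    thus "x * k \<in> ideal_prod complex_ring I (ideal_prod complex_ring J K)"
      using x by blast
  qed (rule ideal_prod_complex_add)
  show ?thesis
    using sub[of I J K] sub[of K J I] by (simp add: ideal_prod_complex_comm)
qed

lemma ideal_prod_complex_mono:
  "I \<subseteq> I' \<Longrightarrow> J \<subseteq> J' \<Longrightarrow> ideal_prod complex_ring I J \<subseteq> ideal_prod complex_ring I' J'"
  by (rule ideal_prod_complex_subset) (auto intro: ideal_prod_complexI ideal_prod_complex_add)

context number_field
begin

abbreviation ints :: "complex set" where
  "ints \<equiv> carrier (integer_ring F)"

lemma ints_iff: "x \<in> ints \<longleftrightarrow> x \<in> F \<and> algebraic_int x"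
  by (simp add: integer_ring_def)

lemma ints_subset: "ints \<subseteq> F"
  by (auto simp: ints_iff)

lemma ints_of_int: "of_int n \<in> ints"
  by (simp add: ints_iff of_int_closed int_imp_algebraic_int)

lemma ints_of_nat: "of_nat n \<in> ints"
  using ints_of_int[of "int n"] by simp

lemma ints_zero: "0 \<in> ints" and ints_one: "1 \<in> ints"
  using ints_of_int[of 0] ints_of_int[of 1] by simp_all

lemma ints_add: "x \<in> ints \<Longrightarrow> y \<in> ints \<Longrightarrow> x + y \<in> ints"
  by (simp add: ints_iff add_closed algebraic_int_plus)

lemma ints_mult: "x \<in> ints \<Longrightarrow> y \<in> ints \<Longrightarrow> x * y \<in> ints"
  by (simp add: ints_iff mult_closed algebraic_int_times)

lemma ints_uminus: "x \<in> ints \<Longrightarrow> - x \<in> ints"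
  by (simp add: ints_iff uminus_closed)

lemma ints_diff: "x \<in> ints \<Longrightarrow> y \<in> ints \<Longrightarrow> x - y \<in> ints"
  using ints_add[OF _ ints_uminus, of x y] by simp

lemma ints_power: "x \<in> ints \<Longrightarrow> x ^ n \<in> ints"
  by (induction n) (simp_all add: ints_one ints_mult)

lemma ints_poly: "x \<in> ints \<Longrightarrow> poly (map_poly of_int (p :: int poly)) x \<in> ints"
  by (induction p) (simp_all add: ints_zero of_int_hom.map_poly_pCons_hom ints_add ints_mult ints_of_int)

lemma ex_mult_of_nat:
  assumes "x \<in> ints" "x \<noteq> 0"
  obtains y n where "y \<in> ints" "n > 0" "x * y = of_nat n"
proof -
  obtain q :: "int poly" and c :: int where c: "c \<noteq> 0" "x * poly (map_poly of_int q) x = of_int c"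
    using ex_int_poly_mult_eq_of_int[of x] assms ints_subset by blast
  define y where "y = poly (map_poly of_int q) x"
  have y: "y \<in> ints" "c \<noteq> 0" "x * y = of_int c"
    using c ints_poly[OF assms(1)] by (simp_all add: y_def)
  show ?thesis
  proof (rule that)
    \<comment> \<open>The extra factor c replaces an integer of unknown sign by the positive
      c^2.\<close>
    show "of_int c * y \<in> ints" by (intro ints_mult ints_of_int y)
    show "nat (c\<^sup>2) > 0" using y(2) by simp
    show "x * (of_int c * y) = of_nat (nat (c\<^sup>2))"
      using y(3) by (simp add: mult.left_commute power2_eq_square of_nat_nat)
  qed
qed

text \<open>With leading coefficient c and degree m, multiplying the equation of x by c ^ (m - 1)
  gives a monic integral equation for c * x. A second factor c makes the multiplier
  positive.\<close>

lemma ex_of_nat_mult_mem_ints: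
  assumes "x \<in> F"
  obtains n where "n > 0" "of_nat n * x \<in> ints"
proof -
  obtain p :: "int poly" where p: "p \<noteq> 0" "poly (map_poly of_int p) x = 0"
    using ex_nonzero_int_poly_root[OF assms] by blast
  define m where "m = Polynomial.degree p"
  define c where "c = lead_coeff p"
  have c: "c \<noteq> 0" using p(1) by (simp add: c_def)
  show ?thesis
  proof (cases m)
    case 0
    then obtain a where "p = [:a:]"
      by (metis degree_eq_zeroE m_def)
    thus ?thesis using p by (simp add: of_int_hom.map_poly_pCons_hom)
  next
    case (Suc k)
    define y where "y = of_int c * x"
    have "0 = of_int c ^ k * (\<Sum>i\<le>m. of_int (coeff p i) * x ^ i)"
      using p(2) by (simp add: poly_altdef degree_map_poly coeff_map_poly m_def)
    also have "(\<Sum>i\<le>m. of_int (coeff p i) * x ^ i) = (\<Sum>i<m. of_int (coeff p i) * x ^ i) + of_int c * x ^ m"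
      by (simp add: lessThan_Suc_atMost[symmetric] c_def m_def)
    also have "of_int c ^ k * \<dots> = (\<Sum>i<m. of_int (coeff p i * c ^ (k - i)) * y ^ i) + y ^ m"
    proof -
      have "of_int c ^ k * (of_int (coeff p i) * x ^ i) = of_int (coeff p i * c ^ (k - i)) * y ^ i"
        if "i < m" for i
      proof -
        have "(of_int c :: complex) ^ k = of_int c ^ (k - i) * of_int c ^ i"
          using that Suc by (simp flip: power_add)
        thus ?thesis by (simp add: y_def power_mult_distrib)
      qed
      moreover have "of_int c ^ k * (of_int c * x ^ m) = y ^ m"
        by (simp add: y_def power_mult_distrib Suc mult_ac)
      ultimately show ?thesis
        by (simp add: distrib_left sum_distrib_left del: of_int_mult)
    qed
    finally have eq: "y ^ m - 0 = - (\<Sum>i<m. of_int (coeff p i * c ^ (k - i)) * y ^ i)"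
      by (simp add: eq_neg_iff_add_eq_0 add.commute)
    have "algebraic_int y"
    proof (rule algebraic_int_if_power_mem_span_add)
      show "y ^ m - 0 \<in> int_span.span ((\<lambda>i. y ^ i) ` {..<m})"
        unfolding eq
        by (intro int_span.span_neg int_span.span_sum int_span.span_scale int_span.span_base) auto
    qed (use Suc in auto)
    hence "y \<in> ints"
      using assms by (simp add: ints_iff y_def mult_closed of_int_closed)
    hence "of_int c * y \<in> ints"
      by (intro ints_mult ints_of_int)
    moreover have "of_int c * y = of_nat (nat (c\<^sup>2)) * x"
      by (simp add: y_def power2_eq_square)
    ultimately show ?thesis
      using c by (intro that[of "nat (c\<^sup>2)"]) auto
  qed
qed

lemma fractional_ideal_iff:
  "fractional_ideal F I \<longleftrightarrow> I \<subseteq> F \<and> 0 \<in> I \<and> (\<forall>x\<in>I. \<forall>y\<in>I. x + y \<in> I) \<and> (\<forall>a\<in>ints. \<forall>x\<in>I. a * x \<in> I) \<and>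
    (\<exists>x\<in>I. x \<noteq> 0) \<and> (\<exists>d\<in>ints. d \<noteq> 0 \<and> (\<forall>x\<in>I. d * x \<in> ints))"
proof -
  have "- x \<in> I" if "\<forall>a\<in>ints. \<forall>x\<in>I. a * x \<in> I" "x \<in> I" for x
    using that ints_uminus[OF ints_one] by (metis mult_minus1)
  thus ?thesis
    unfolding fractional_ideal_def subgroup_complex_ring_iff by blast
qed

lemma fractional_idealD:
  assumes "fractional_ideal F I"
  shows "I \<subseteq> F" "0 \<in> I" "x \<in> I \<Longrightarrow> y \<in> I \<Longrightarrow> x + y \<in> I" "a \<in> ints \<Longrightarrow> x \<in> I \<Longrightarrow> a * x \<in> I"
    "x \<in> I \<Longrightarrow> - x \<in> I" "x \<in> I \<Longrightarrow> y \<in> I \<Longrightarrow> x - y \<in> I"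
proof -
  show 1: "I \<subseteq> F" "0 \<in> I" "x \<in> I \<Longrightarrow> y \<in> I \<Longrightarrow> x + y \<in> I" "a \<in> ints \<Longrightarrow> x \<in> I \<Longrightarrow> a * x \<in> I" for a x y
    using assms unfolding fractional_ideal_iff by auto
  show 2: "x \<in> I \<Longrightarrow> - x \<in> I" for x
    using 1(4)[OF ints_uminus[OF ints_one], of x] by simp
  show "x \<in> I \<Longrightarrow> y \<in> I \<Longrightarrow> x - y \<in> I"
    using 1(3)[of x "- y"] 2 by simp
qed

lemma fractional_ideal_nonzeroE:
  assumes "fractional_ideal F I"
  obtains x where "x \<in> I" "x \<noteq> 0"
proof -
  have "\<exists>x\<in>I. x \<noteq> 0"
    using assms unfolding fractional_ideal_iff by simp
  thus ?thesis using that by blast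
qed

lemma fractional_ideal_denomE:
  assumes "fractional_ideal F I"
  obtains d where "d \<in> ints" "d \<noteq> 0" "\<And>x. x \<in> I \<Longrightarrow> d * x \<in> ints"
proof -
  have "\<exists>d\<in>ints. d \<noteq> 0 \<and> (\<forall>x\<in>I. d * x \<in> ints)"
    using assms unfolding fractional_ideal_iff by simp
  thus ?thesis using that by blast
qed

lemma fractional_ideal_if_integral:
  assumes "I \<subseteq> ints" "0 \<in> I" "\<And>x y. x \<in> I \<Longrightarrow> y \<in> I \<Longrightarrow> x + y \<in> I"
    "\<And>a x. a \<in> ints \<Longrightarrow> x \<in> I \<Longrightarrow> a * x \<in> I" "x \<in> I" "x \<noteq> 0"
  shows "fractional_ideal F I"
proof -
  have "\<exists>d\<in>ints. d \<noteq> 0 \<and> (\<forall>x\<in>I. d * x \<in> ints)"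
    using assms(1) ints_one by (intro bexI[of _ 1]) auto
  moreover have "I \<subseteq> F" "\<exists>x\<in>I. x \<noteq> 0"
    using assms(1,5,6) ints_subset by blast+
  ultimately show ?thesis
    unfolding fractional_ideal_iff using assms(2-4) by simp
qed

lemma fractional_ideal_ints: "fractional_ideal F ints"
  by (rule fractional_ideal_if_integral[of _ 1])
    (auto simp: ints_zero ints_one intro: ints_add ints_mult)

lemma fractional_ideal_prod:
  assumes I: "fractional_ideal F I" and J: "fractional_ideal F J"
  shows "fractional_ideal F (ideal_prod complex_ring I J)"
proof -
  obtain d where d: "d \<in> ints" "d \<noteq> 0" "\<And>x. x \<in> I \<Longrightarrow> d * x \<in> ints"
    using fractional_ideal_denomE[OF I] by blast
  obtain e where e: "e \<in> ints" "e \<noteq> 0" "\<And>x. x \<in> J \<Longrightarrow> e * x \<in> ints"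
    using fractional_ideal_denomE[OF J] by blast
  obtain x where x: "x \<in> I" "x \<noteq> 0"
    using fractional_ideal_nonzeroE[OF I] by blast
  obtain y where y: "y \<in> J" "y \<noteq> 0"
    using fractional_ideal_nonzeroE[OF J] by blast
  have "ideal_prod complex_ring I J \<subseteq> F"
    by (rule ideal_prod_complex_subset)
      (use fractional_idealD(1)[OF I] fractional_idealD(1)[OF J] in \<open>auto intro: mult_closed add_closed\<close>)
  moreover have "0 \<in> ideal_prod complex_ring I J"
    using ideal_prod_complexI[of 0 I 0 J] I J by (simp add: fractional_idealD)
  moreover have "a * z \<in> ideal_prod complex_ring I J" if "a \<in> ints" "z \<in> ideal_prod complex_ring I J" for a z
    using ideal_prod_complex_mult_mem[OF that(2)] fractional_idealD(4)[OF I that(1)] .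
  moreover have "x * y \<in> ideal_prod complex_ring I J" "x * y \<noteq> 0"
    using x y by (auto intro: ideal_prod_complexI)
  moreover have "ideal_prod complex_ring I J \<subseteq> {x. (d * e) * x \<in> ints}"
  proof (rule ideal_prod_complex_subset)
    fix x y assume "x \<in> I" "y \<in> J"
    hence "(d * x) * (e * y) \<in> ints"
      by (intro ints_mult d e)
    thus "x * y \<in> {x. (d * e) * x \<in> ints}"
      by (simp add: mult_ac)
  qed (auto simp: ring_distribs intro: ints_add)
  moreover have "d * e \<in> ints" "d * e \<noteq> 0"
    using d e by (auto intro: ints_mult)
  ultimately show ?thesis
    unfolding fractional_ideal_iff
    by (intro conjI ballI bexI[of _ "d * e"] bexI[of _ "x * y"] ideal_prod_complex_add) auto
qed

lemma ints_ideal_prod: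
  assumes "fractional_ideal F I"
  shows "ideal_prod complex_ring ints I = I"
proof
  show "ideal_prod complex_ring ints I \<subseteq> I"
    by (rule ideal_prod_complex_subset) (use fractional_idealD[OF assms] in auto)
  show "I \<subseteq> ideal_prod complex_ring ints I"
    using ideal_prod_complexI[OF ints_one, of _ I] by auto
qed

section \<open>Finiteness modulo n and its consequences: ideals, powers, integral closedness\<close>

lemma ex_of_nat_mem:
  assumes "fractional_ideal F I" "I \<subseteq> ints"
  obtains n where "n > 0" "of_nat n \<in> I"
proof -
  obtain x where x: "x \<in> I" "x \<noteq> 0"
    using fractional_ideal_nonzeroE[OF assms(1)] by blast
  then obtain y n where "y \<in> ints" "n > 0" "x * y = of_nat n"
    using ex_mult_of_nat[of x] assms(2) by blast
  thus ?thesis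
    using that[of n] fractional_idealD(4)[OF assms(1), of y x] x(1) by (simp add: mult.commute)
qed

lemma ints_finite_mod:
  assumes "n > 0"
  obtains S where "finite S" "S \<subseteq> ints" "\<And>y. y \<in> ints \<Longrightarrow> \<exists>s\<in>S. \<exists>a\<in>ints. y = s + of_nat n * a"
  using finite_mod[OF ints_subset ints_zero ints_add ints_uminus assms] by blast

text \<open>An ideal containing n is determined by its intersection with a finite set of
  representatives modulo n. This yields the maximal elements and the induction measure used for
  ideals below.\<close>

lemma finite_integral_ideals_containing:
  assumes "n > 0"
  shows "finite {I. fractional_ideal F I \<and> I \<subseteq> ints \<and> of_nat n \<in> I}"
proof -
  obtain S where S: "finite S" "S \<subseteq> ints" "\<And>y. y \<in> ints \<Longrightarrow> \<exists>s\<in>S. \<exists>a\<in>ints. y = s + of_nat n * a"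
    using ints_finite_mod[OF assms] by blast
  have sub: "I \<subseteq> J" if IJ: "fractional_ideal F I" "I \<subseteq> ints" "of_nat n \<in> I"
    "fractional_ideal F J" "J \<subseteq> ints" "of_nat n \<in> J" "I \<inter> S \<subseteq> J" for I J
  proof
    fix x assume x: "x \<in> I"
    then obtain s a where s: "s \<in> S" "a \<in> ints" "x = s + of_nat n * a"
      using S(3) IJ(2) by blast
    have aI: "a * of_nat n \<in> I" and aJ: "a * of_nat n \<in> J"
      using fractional_idealD(4)[OF IJ(1) s(2) IJ(3)] fractional_idealD(4)[OF IJ(4) s(2) IJ(6)] .
    have "s = x - a * of_nat n"
      by (simp add: s(3))
    hence "s \<in> I"
      using fractional_idealD(6)[OF IJ(1) x aI] by simp
    hence "s \<in> J"
      using s(1) IJ(7) by blast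
    from fractional_idealD(3)[OF IJ(4) this aJ] show "x \<in> J"
      by (simp add: s(3) mult.commute)
  qed
  have "inj_on (\<lambda>I. I \<inter> S) {I. fractional_ideal F I \<and> I \<subseteq> ints \<and> of_nat n \<in> I}"
  proof (rule inj_onI)
    fix I J
    assume "I \<in> {I. fractional_ideal F I \<and> I \<subseteq> ints \<and> of_nat n \<in> I}"
      "J \<in> {I. fractional_ideal F I \<and> I \<subseteq> ints \<and> of_nat n \<in> I}" "I \<inter> S = J \<inter> S"
    thus "I = J"
      using sub[of I J] sub[of J I] by auto
  qed
  moreover have "(\<lambda>I. I \<inter> S) ` {I. fractional_ideal F I \<and> I \<subseteq> ints \<and> of_nat n \<in> I} \<subseteq> Pow S"
    by blast
  ultimately show ?thesis
    using S(1) by (meson finite_Pow_iff finite_subset inj_on_finite)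
qed

text \<open>Two powers of z share a representative modulo n. This periodicity later gives inverses
  modulo a prime ideal.\<close>

lemma power_pigeonhole:
  assumes "z \<in> ints" "n > 0"
  obtains i j a where "i < j" "a \<in> ints" "z ^ j - z ^ i = of_nat n * a"
proof -
  obtain S where S: "finite S" "S \<subseteq> ints" "\<And>y. y \<in> ints \<Longrightarrow> \<exists>s\<in>S. \<exists>a\<in>ints. y = s + of_nat n * a"
    using ints_finite_mod[OF assms(2)] by blast
  have "\<forall>k. \<exists>s\<in>S. \<exists>a\<in>ints. z ^ k = s + of_nat n * a"
    using S(3) ints_power[OF assms(1)] by blast
  then obtain s a where sa: "\<And>k. s k \<in> S" "\<And>k. a k \<in> ints" "\<And>k. z ^ k = s k + of_nat n * a k"
    by metis
  have "\<not> inj s"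
    using S(1) sa(1) by (meson finite_subset image_subsetI infinite_UNIV_nat finite_imageD)
  then obtain i j where ij: "i < j" "s i = s j"
    by (metis injI linorder_neqE_nat)
  have "z ^ j - z ^ i = of_nat n * (a j - a i)"
    using sa(3)[of i] sa(3)[of j] ij(2) by (simp add: algebra_simps)
  thus ?thesis
    using that[OF ij(1) ints_diff[OF sa(2) sa(2)]] by blast
qed

text \<open>All powers of x have a common denominator n, so two of the elements n * x ^ k agree
  modulo n * \<open>ints\<close>. Dividing by n gives x ^ j = x ^ i + b with i < j and b integral, a
  monic equation for x.\<close>

lemma mem_ints_if_stable:
  assumes I: "fractional_ideal F I" and x: "x \<in> F" "\<And>y. y \<in> I \<Longrightarrow> x * y \<in> I"
  shows "x \<in> ints"
proof -
  obtain d where d: "d \<in> ints" "d \<noteq> 0" "\<And>y. y \<in> I \<Longrightarrow> d * y \<in> ints"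
    using fractional_ideal_denomE[OF I] by blast
  obtain y where y: "y \<in> I" "y \<noteq> 0"
    using fractional_ideal_nonzeroE[OF I] by blast
  obtain z n where n: "z \<in> ints" "n > 0" "d * y * z = of_nat n"
    using ex_mult_of_nat[of "d * y"] d y by auto
  have xk: "x ^ k * y \<in> I" for k
    using y(1) x(2) by (induction k) (auto simp: mult.assoc)
  \<comment> \<open>Since n = d * y * z, the element n * x ^ k equals z * (d * (x ^ k * y)), and d
    clears the denominators of the ideal.\<close>
  have nx: "of_nat n * x ^ k \<in> ints" for k
    using ints_mult[OF n(1) d(3)[OF xk[of k]]] by (simp add: mult_ac flip: n(3))
  obtain S where S: "finite S" "S \<subseteq> ints" "\<And>y. y \<in> ints \<Longrightarrow> \<exists>s\<in>S. \<exists>a\<in>ints. y = s + of_nat n * a"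
    using ints_finite_mod[OF n(2)] by blast
  have "\<forall>k. \<exists>s\<in>S. \<exists>a\<in>ints. of_nat n * x ^ k = s + of_nat n * a"
    using S(3) nx by blast
  then obtain s a where sa: "\<And>k. s k \<in> S" "\<And>k. a k \<in> ints" "\<And>k. of_nat n * x ^ k = s k + of_nat n * a k"
    by metis
  have "\<not> inj s"
    using S(1) sa(1) by (meson finite_subset image_subsetI infinite_UNIV_nat finite_imageD)
  then obtain i j where ij: "i < j" "s i = s j"
    by (metis injI linorder_neqE_nat)
  have "of_nat n * (x ^ j - (a j - a i)) = of_nat n * x ^ i"
    using sa(3)[of i] sa(3)[of j] ij(2) by (simp add: algebra_simps)
  hence eq: "x ^ j - (a j - a i) = x ^ i"
    using n(2) by simp
  have "algebraic_int x"
  proof (rule algebraic_int_if_power_mem_span_add)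
    show "algebraic_int (a j - a i)"
      using ints_diff[OF sa(2) sa(2)] by (simp add: ints_iff)
    show "j > 0" using ij(1) by simp
    show "x ^ j - (a j - a i) \<in> int_span.span ((\<lambda>i. x ^ i) ` {..<j})"
      unfolding eq using ij(1) by (intro int_span.span_base) auto
  qed
  thus ?thesis
    using x(1) by (simp add: ints_iff)
qed

end

section \<open>Invertibility of fractional ideals\<close>

lemma ideal_prod_complex_left_comm:
  "ideal_prod complex_ring I (ideal_prod complex_ring J K) =
   ideal_prod complex_ring J (ideal_prod complex_ring I K)"
  by (metis ideal_prod_complex_assoc ideal_prod_complex_comm)

lemmas ideal_prod_complex_ac =
  ideal_prod_complex_assoc ideal_prod_complex_comm ideal_prod_complex_left_comm

context number_field
begin

lemma fractional_ideals_simps [simp]: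
  "carrier (fractional_ideals F) = {I. fractional_ideal F I}"
  "I \<otimes>\<^bsub>fractional_ideals F\<^esub> J = ideal_prod complex_ring I J"
  "\<one>\<^bsub>fractional_ideals F\<^esub> = ints"
  by (simp_all add: fractional_ideals_def)

lemma ideal_prod_principal_ideal:
  assumes "fractional_ideal F I"
  shows "ideal_prod complex_ring (principal_ideal F x) I = (\<lambda>a. x * a) ` I"
proof
  show "ideal_prod complex_ring (principal_ideal F x) I \<subseteq> (\<lambda>a. x * a) ` I"
  proof (rule ideal_prod_complex_subset)
    fix y z assume "y \<in> principal_ideal F x" "z \<in> I"
    then obtain a where "a \<in> ints" "y = x * a"
      by (auto simp: principal_ideal_def)
    thus "y * z \<in> (\<lambda>a. x * a) ` I"
      using fractional_idealD(4)[OF assms, of a z] \<open>z \<in> I\<close> by (auto simp: mult.assoc)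
  next
    fix y z assume "y \<in> (\<lambda>a. x * a) ` I" "z \<in> (\<lambda>a. x * a) ` I"
    then obtain a b where "y = x * a" "z = x * b" "a \<in> I" "b \<in> I" by auto
    thus "y + z \<in> (\<lambda>a. x * a) ` I"
      using fractional_idealD(3)[OF assms, of a b] by (auto simp flip: distrib_left)
  qed
  have "x \<in> principal_ideal F x"
    using ints_one by (force simp: principal_ideal_def)
  thus "(\<lambda>a. x * a) ` I \<subseteq> ideal_prod complex_ring (principal_ideal F x) I"
    by (auto intro: ideal_prod_complexI)
qed

lemma fractional_ideal_principal_ideal:
  assumes "x \<in> F" "x \<noteq> 0"
  shows "fractional_ideal F (principal_ideal F x)"
proof -
  obtain n where n: "n > 0" "of_nat n * x \<in> ints"
    using ex_of_nat_mult_mem_ints[OF assms(1)] .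
  have "principal_ideal F x \<subseteq> F"
    using assms(1) ints_subset by (auto simp: principal_ideal_def intro: mult_closed)
  moreover have "0 \<in> principal_ideal F x"
    using ints_zero by (force simp: principal_ideal_def)
  moreover have "y + z \<in> principal_ideal F x"
    if yz: "y \<in> principal_ideal F x" "z \<in> principal_ideal F x" for y z
  proof -
    obtain a b where "y = x * a" "z = x * b" "a \<in> ints" "b \<in> ints"
      using yz by (auto simp: principal_ideal_def)
    thus ?thesis
      using ints_add[of a b] by (auto simp: principal_ideal_def simp flip: distrib_left)
  qed
  moreover have "c * y \<in> principal_ideal F x" if yc: "y \<in> principal_ideal F x" "c \<in> ints" for y c
  proof -
    obtain a where "y = x * a" "a \<in> ints"
      using yc by (auto simp: principal_ideal_def)
    thus ?thesis
      using ints_mult[of c a] yc by (auto simp: principal_ideal_def image_iff mult_ac)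
  qed
  moreover have "\<exists>y\<in>principal_ideal F x. y \<noteq> 0"
    using assms(2) ints_one by (intro bexI[of _ x]) (force simp: principal_ideal_def)+
  moreover have "\<exists>d\<in>ints. d \<noteq> 0 \<and> (\<forall>y\<in>principal_ideal F x. d * y \<in> ints)"
    using n ints_of_nat
    by (intro bexI[of _ "of_nat n"]) (auto simp: principal_ideal_def simp flip: mult.assoc intro: ints_mult)
  ultimately show ?thesis
    unfolding fractional_ideal_iff by simp
qed

lemma principal_ideal_mult:
  assumes "x \<in> F" "y \<in> F" "y \<noteq> 0"
  shows "ideal_prod complex_ring (principal_ideal F x) (principal_ideal F y) = principal_ideal F (x * y)"
  unfolding ideal_prod_principal_ideal[OF fractional_ideal_principal_ideal[OF assms(2,3)]]
  by (simp add: principal_ideal_def image_image mult.assoc)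

lemma integer_ring_simps:
  "x \<otimes>\<^bsub>integer_ring F\<^esub> y = x * y" "x \<oplus>\<^bsub>integer_ring F\<^esub> y = x + y"
  "\<one>\<^bsub>integer_ring F\<^esub> = 1" "\<zero>\<^bsub>integer_ring F\<^esub> = 0"
  by (simp_all add: integer_ring_def ring_of_type_algebra_def)

lemma cring_integer_ring: "cring (integer_ring F)"
proof (intro cringI abelian_groupI comm_monoidI; unfold integer_ring_simps)
  fix x assume "x \<in> ints"
  thus "\<exists>y\<in>ints. y + x = 0"
    by (intro bexI[of _ "- x"]) (simp_all add: ints_uminus)
qed (simp_all add: ints_add ints_mult ints_zero ints_one algebra_simps)

lemma a_inv_integer_ring: "x \<in> ints \<Longrightarrow> \<ominus>\<^bsub>integer_ring F\<^esub> x = - x"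
proof -
  interpret cring "integer_ring F" by (rule cring_integer_ring)
  assume "x \<in> ints"
  thus ?thesis
    by (intro minus_equality) (simp_all add: integer_ring_simps ints_uminus)
qed

lemma primeideal_iff:
  "primeideal P (integer_ring F) \<longleftrightarrow>
    P \<subseteq> ints \<and> 0 \<in> P \<and> (\<forall>x\<in>P. \<forall>y\<in>P. x + y \<in> P) \<and> (\<forall>a\<in>ints. \<forall>x\<in>P. a * x \<in> P) \<and> P \<noteq> ints \<and>
    (\<forall>a\<in>ints. \<forall>b\<in>ints. a * b \<in> P \<longrightarrow> a \<in> P \<or> b \<in> P)" (is "_ \<longleftrightarrow> ?R")
proof
  assume P: "primeideal P (integer_ring F)"
  interpret primeideal P "integer_ring F" by (rule P)
  show ?R
    using a_subset additive_subgroup.zero_closed[OF is_additive_subgroup]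
      additive_subgroup.a_closed[OF is_additive_subgroup] I_l_closed I_notcarr I_prime
    by (auto simp: integer_ring_simps)
next
  assume R: ?R
  have um: "- x \<in> P" if "x \<in> P" for x
    using R that ints_uminus[OF ints_one] by (metis mult_minus1)
  have r: "x * a \<in> P" if "x \<in> P" "a \<in> ints" for x a
    using R that by (metis mult.commute)
  show "primeideal P (integer_ring F)"
  proof (intro primeidealI idealI cring_integer_ring)
    show "Ring.ring (integer_ring F)"
      using cring_integer_ring by (rule cring.axioms)
    show "subgroup P (add_monoid (integer_ring F))"
      unfolding subgroup_def
    proof (intro conjI allI impI)
      fix x assume "x \<in> P"
      thus "inv\<^bsub>add_monoid (integer_ring F)\<^esub> x \<in> P"
        using a_inv_integer_ring[of x] um R by (auto simp: a_inv_def)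
    qed (use R in \<open>auto simp: integer_ring_simps\<close>)
  qed (use R r in \<open>auto simp: integer_ring_simps\<close>)
qed

abbreviation nonzero_prime :: "complex set \<Rightarrow> bool" where
  "nonzero_prime P \<equiv> primeideal P (integer_ring F) \<and> P \<noteq> {0}"

lemma nonzero_primeD:
  assumes "nonzero_prime P"
  shows "P \<subseteq> ints" "fractional_ideal F P" "1 \<notin> P" "P \<noteq> ints"
    "a \<in> ints \<Longrightarrow> b \<in> ints \<Longrightarrow> a * b \<in> P \<Longrightarrow> a \<in> P \<or> b \<in> P"
proof -
  have P: "P \<subseteq> ints" "0 \<in> P" "\<And>x y. x \<in> P \<Longrightarrow> y \<in> P \<Longrightarrow> x + y \<in> P" "\<And>a x. a \<in> ints \<Longrightarrow> x \<in> P \<Longrightarrow> a * x \<in> P"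
     "P \<noteq> ints" "\<And>a b. a \<in> ints \<Longrightarrow> b \<in> ints \<Longrightarrow> a * b \<in> P \<Longrightarrow> a \<in> P \<or> b \<in> P"
    using assms unfolding primeideal_iff by auto
  show "P \<subseteq> ints" "P \<noteq> ints" "a \<in> ints \<Longrightarrow> b \<in> ints \<Longrightarrow> a * b \<in> P \<Longrightarrow> a \<in> P \<or> b \<in> P" 
    by (fact P)+
  obtain x where "x \<in> P" "x \<noteq> 0"
    using P(2) assms by blast
  thus "fractional_ideal F P"
    using fractional_ideal_if_integral[OF P(1,2) _ _ \<open>x \<in> P\<close> \<open>x \<noteq> 0\<close>] P(3,4) by simp
  show "1 \<notin> P"
    using P(1,5) P(4)[of _ 1] by auto
qed

lemma nonzero_prime_power:
  assumes "nonzero_prime P" "x \<in> ints" "x ^ n \<in> P"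
  shows "x \<in> P"
  using assms(3)
proof (induction n)
  case 0
  thus ?case using nonzero_primeD(3)[OF assms(1)] by simp
next
  case (Suc n)
  thus ?case using nonzero_primeD(5)[OF assms(1,2) ints_power[OF assms(2)], of n] by auto
qed

lemma nonzero_primeI:
  assumes "fractional_ideal F P" "P \<subseteq> ints" "P \<noteq> ints"
    "\<And>a b. a \<in> ints \<Longrightarrow> b \<in> ints \<Longrightarrow> a * b \<in> P \<Longrightarrow> a \<in> P \<or> b \<in> P"
  shows "nonzero_prime P"
proof
  show "primeideal P (integer_ring F)"
    unfolding primeideal_iff using assms fractional_idealD[OF assms(1)] by auto
  show "P \<noteq> {0}"
    using fractional_ideal_nonzeroE[OF assms(1)] by blast
qed

lemma fractional_ideal_add_multiples:
  assumes I: "fractional_ideal F I" "I \<subseteq> ints" and x: "x \<in> ints"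
  shows "fractional_ideal F {y + a * x | y a. y \<in> I \<and> a \<in> ints}" (is "fractional_ideal F ?J")
    and "{y + a * x | y a. y \<in> I \<and> a \<in> ints} \<subseteq> ints"
    and "I \<subseteq> {y + a * x | y a. y \<in> I \<and> a \<in> ints}"
    and "x \<in> {y + a * x | y a. y \<in> I \<and> a \<in> ints}"
proof -
  show 1: "?J \<subseteq> ints"
    using I(2) x by (auto intro!: ints_add ints_mult)
  show 2: "I \<subseteq> ?J"
  proof
    fix y assume "y \<in> I"
    moreover have "y = y + 0 * x" by simp
    ultimately show "y \<in> ?J"
      using ints_zero by blast
  qed
  have "x = 0 + 1 * x" by simp
  thus "x \<in> ?J"
    using ints_one fractional_idealD(2)[OF I(1)] by blast
  obtain z where z: "z \<in> I" "z \<noteq> 0"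
    using fractional_ideal_nonzeroE[OF I(1)] .
  show "fractional_ideal F ?J"
  proof (rule fractional_ideal_if_integral[OF 1])
    show "0 \<in> ?J" "z \<in> ?J"
      using 2 z(1) fractional_idealD(2)[OF I(1)] by blast+
    show "z \<noteq> 0" by (rule z(2))
  next
    fix u v assume "u \<in> ?J" "v \<in> ?J"
    then obtain y a y' a' where u: "y \<in> I" "a \<in> ints" "u = y + a * x"
      and v: "y' \<in> I" "a' \<in> ints" "v = y' + a' * x"
      by blast
    have "u + v = (y + y') + (a + a') * x"
      by (simp add: u v algebra_simps)
    thus "u + v \<in> ?J"
      using fractional_idealD(3)[OF I(1) u(1) v(1)] ints_add[OF u(2) v(2)] by blast
  next
    fix c u assume c: "c \<in> ints" and "u \<in> ?J"
    then obtain y a where u: "y \<in> I" "a \<in> ints" "u = y + a * x"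
      by blast
    have "c * u = c * y + (c * a) * x"
      by (simp add: u algebra_simps)
    thus "c * u \<in> ?J"
      using fractional_idealD(4)[OF I(1) c u(1)] ints_mult[OF c u(2)] by blast
  qed
qed

text \<open>Powers of x repeat modulo a positive integer in P, so x ^ i * (x ^ (k + 1) - 1) lies in
  P. As x is outside P, the second factor is in P, and x ^ k inverts x modulo P.\<close>

lemma nonzero_prime_coprime:
  assumes P: "nonzero_prime P" and x: "x \<in> ints" "x \<notin> P"
  obtains q r where "q \<in> P" "r \<in> ints" "q + r * x = 1"
proof -
  note frac = nonzero_primeD(2)[OF P]
  obtain n where n: "n > 0" "of_nat n \<in> P"
    using ex_of_nat_mem[OF frac nonzero_primeD(1)[OF P]] .
  obtain i j a where ij: "i < j" "a \<in> ints" "x ^ j - x ^ i = of_nat n * a"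
    using power_pigeonhole[OF x(1) n(1)] .
  define k where "k = j - i - 1"
  have j: "j = i + Suc k"
    using ij(1) by (simp add: k_def)
  have "x ^ i * (x ^ Suc k - 1) = a * of_nat n"
    using ij(3) by (simp add: j power_add algebra_simps)
  also have "\<dots> \<in> P"
    by (rule fractional_idealD(4)[OF frac ij(2) n(2)])
  finally have "x ^ Suc k - 1 \<in> P"
    using nonzero_primeD(5)[OF P ints_power[OF x(1)] ints_diff[OF ints_power[OF x(1)] ints_one]]
      nonzero_prime_power[OF P x(1)] x(2) by blast
  hence "- (x ^ Suc k - 1) \<in> P"
    by (rule fractional_idealD(5)[OF frac])
  thus ?thesis
    using ints_power[OF x(1), of k] by (rule that) simp
qed

lemma nonzero_prime_maximal:
  assumes P: "nonzero_prime P" and J: "fractional_ideal F J" "J \<subseteq> ints" "P \<subseteq> J"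
  shows "J = P \<or> J = ints"
proof (subst disj_imp, rule impI)
  assume "J \<noteq> P"
  then obtain x where x: "x \<in> J" "x \<notin> P"
    using J(3) by blast
  then obtain q r where q: "q \<in> P" "r \<in> ints" "q + r * x = 1"
    using nonzero_prime_coprime[OF P] J(2) by blast
  have "1 \<in> J"
    unfolding q(3)[symmetric] using J q x by (blast intro: fractional_idealD)
  hence "ints \<subseteq> J"
    using fractional_idealD(4)[OF J(1), of _ 1] by auto
  thus "J = ints"
    using J(2) by blast
qed

lemma ex_nonzero_prime_superset:
  assumes I: "fractional_ideal F I" "I \<subseteq> ints" "I \<noteq> ints"
  obtains P where "nonzero_prime P" "I \<subseteq> P"
proof -
  obtain n where n: "n > 0" "of_nat n \<in> I"
    using ex_of_nat_mem[OF I(1,2)] .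
  define C where "C = {J. fractional_ideal F J \<and> J \<subseteq> ints \<and> J \<noteq> ints \<and> I \<subseteq> J}"
  have "C \<subseteq> {J. fractional_ideal F J \<and> J \<subseteq> ints \<and> of_nat n \<in> J}"
    using n(2) by (auto simp: C_def)
  hence "finite C"
    using finite_integral_ideals_containing[OF n(1)] finite_subset by blast
  moreover have "I \<in> C"
    using I by (simp add: C_def)
  ultimately obtain P where P: "P \<in> C" "\<And>J. J \<in> C \<Longrightarrow> P \<subseteq> J \<Longrightarrow> P = J"
    using finite_has_maximal[of C] by (metis empty_iff)
  have frac: "fractional_ideal F P" "P \<subseteq> ints" "P \<noteq> ints" "I \<subseteq> P"
    using P(1) by (auto simp: C_def)
  have "nonzero_prime P"
  proof (rule nonzero_primeI[OF frac(1-3)], subst disj_imp, rule impI)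
    fix a b assume ab: "a \<in> ints" "b \<in> ints" "a * b \<in> P" "a \<notin> P"
    define J where "J = {y + c * a | y c. y \<in> P \<and> c \<in> ints}"
    note J = fractional_ideal_add_multiples[OF frac(1,2) ab(1), folded J_def]
    have "J = ints"
    proof (rule ccontr)
      assume "J \<noteq> ints"
      hence "J \<in> C"
        using J frac(4) by (auto simp: C_def)
      thus False
        using P(2)[of J] J(3,4) ab(4) by blast
    qed
    hence "1 \<in> J" using ints_one by simp
    then obtain y c where yc: "1 = y + c * a" "y \<in> P" "c \<in> ints"
      unfolding J_def by blast
    have "b = b * y + c * (a * b)"
      using arg_cong[OF yc(1), of "\<lambda>x. b * x"] by (simp add: algebra_simps)
    also have "\<dots> \<in> P"
      using ab yc frac(1) by (blast intro: fractional_idealD)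
    finally show "b \<in> P" .
  qed
  thus ?thesis
    using that frac(4) by blast
qed

text \<open>A maximal element among the ideals \<open>{z. z * b \<in> n * ints}\<close> contained in \<open>P\<close> is \<open>P\<close> itself.\<close>

lemma ex_mult_prime_subset_ints:
  assumes P: "nonzero_prime P"
  obtains x where "x \<in> F" "x \<notin> ints" "\<And>y. y \<in> P \<Longrightarrow> x * y \<in> ints"
proof -
  note frac = nonzero_primeD(2)[OF P] and sub = nonzero_primeD(1)[OF P]
  obtain n where n: "n > 0" "of_nat n \<in> P"
    using ex_of_nat_mem[OF frac sub] .
  \<comment> \<open>The annihilator of b modulo n. For x = b / n, the inclusion P \<subseteq>
    \<open>col b\<close> says that x * P is integral, and 1 \<notin> \<open>col b\<close> says that
    x is not.\<close>
  define col where "col b = {z \<in> ints. \<exists>o'\<in>ints. z * b = of_nat n * o'}" for b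
  have col: "fractional_ideal F (col b)" "col b \<subseteq> ints" "of_nat n \<in> col b" if b: "b \<in> ints" for b
  proof -
    show 1: "col b \<subseteq> ints" "of_nat n \<in> col b"
      using b ints_of_nat by (auto simp: col_def)
    show "fractional_ideal F (col b)"
    proof (rule fractional_ideal_if_integral[OF 1(1) _ _ _ 1(2)])
      show "0 \<in> col b"
        using ints_zero by (auto simp: col_def intro!: bexI[of _ 0])
      show "of_nat n \<noteq> (0::complex)"
        using n(1) by simp
    next
      fix x y assume "x \<in> col b" "y \<in> col b"
      then obtain u v where "u \<in> ints" "v \<in> ints" "x * b = of_nat n * u" "y * b = of_nat n * v" "x \<in> ints" "y \<in> ints"
        by (auto simp: col_def)
      thus "x + y \<in> col b"
        by (auto simp: col_def ring_distribs intro!: ints_add bexI[of _ "u + v"])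
    next
      fix a x assume "a \<in> ints" "x \<in> col b"
      then obtain u where "u \<in> ints" "x * b = of_nat n * u" "x \<in> ints" "a \<in> ints"
        by (auto simp: col_def)
      thus "a * x \<in> col b"
        by (auto simp: col_def mult.assoc mult.left_commute intro!: ints_mult bexI[of _ "a * u"])
    qed
  qed
  define C where "C = {col b | b. b \<in> ints \<and> col b \<subseteq> P}"
  have "C \<subseteq> {J. fractional_ideal F J \<and> J \<subseteq> ints \<and> of_nat n \<in> J}"
    using col by (auto simp: C_def)
  hence "finite C"
    using finite_integral_ideals_containing[OF n(1)] finite_subset by blast
  moreover have "col 1 \<subseteq> P"
    using fractional_idealD(4)[OF frac _ n(2)] by (auto simp: col_def mult.commute)
  hence "col 1 \<in> C"
    using ints_one by (auto simp: C_def)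
  ultimately obtain M where M: "M \<in> C" "\<And>J. J \<in> C \<Longrightarrow> M \<subseteq> J \<Longrightarrow> M = J"
    using finite_has_maximal[of C] by (metis empty_iff)
  then obtain b where b: "b \<in> ints" "M = col b" "col b \<subseteq> P"
    by (auto simp: C_def)
  have col_mult: "col b \<subseteq> col (b * w)" if w: "w \<in> ints" for w
  proof
    fix x assume "x \<in> col b"
    then obtain u where u: "x \<in> ints" "u \<in> ints" "x * b = of_nat n * u"
      by (auto simp: col_def)
    have "x * (b * w) = of_nat n * (u * w)"
      by (simp add: u(3) flip: mult.assoc)
    thus "x \<in> col (b * w)"
      unfolding col_def using u(1) ints_mult[OF u(2) w] by blast
  qed
  have max: "col (b * w) = col b" if "w \<in> ints" "col (b * w) \<subseteq> P" for w
  proof -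
    have "col (b * w) \<in> C"
      unfolding C_def using that ints_mult[OF b(1) that(1)] by blast
    thus ?thesis
      using M(2)[of "col (b * w)"] col_mult[OF that(1)] by (simp add: b(2))
  qed
  have "P \<subseteq> col b"
  proof (rule ccontr)
    assume "\<not> P \<subseteq> col b"
    then obtain z where z: "z \<in> P" "z \<notin> col b" by blast
    have zi: "z \<in> ints" using z sub by blast
    \<comment> \<open>An s outside P in \<open>col (b * z)\<close> would make b * s a competitor: P
      being prime keeps \<open>col (b * s)\<close> inside P, so maximality makes it equal to
      \<open>col b\<close>; but it contains z.\<close>
    have "col (b * z) \<subseteq> P"
    proof (rule ccontr)
      assume "\<not> col (b * z) \<subseteq> P"
      then obtain s u where s: "s \<in> ints" "s \<notin> P" "u \<in> ints" "s * (b * z) = of_nat n * u"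
        by (auto simp: col_def)
      have "col (b * s) \<subseteq> P"
      proof
        fix t assume "t \<in> col (b * s)"
        then obtain v where t: "t \<in> ints" "v \<in> ints" "t * (b * s) = of_nat n * v"
          by (auto simp: col_def)
        hence "t * s * b = of_nat n * v"
          by (simp add: mult_ac)
        hence "t * s \<in> col b"
          unfolding col_def using ints_mult[OF t(1) s(1)] t(2) by blast
        hence "t * s \<in> P" using b(3) by blast
        thus "t \<in> P"
          using nonzero_primeD(5)[OF P t(1) s(1)] s(2) by blast
      qed
      hence "col (b * s) = col b"
        using max s(1) by blast
      moreover have "z * (b * s) = of_nat n * u"
        using s(4) by (simp add: mult_ac)
      hence "z \<in> col (b * s)"
        unfolding col_def using s(3) zi by blast
      ultimately show False
        using z(2) by simp
    qed
    hence colz: "col (b * z) = col b"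
      using max zi by blast
    \<comment> \<open>Multiplying b by powers of z does not change the annihilator. The repetition
      of powers of z then puts some z ^ (k + 1) - 1 into \<open>col b\<close>, hence into P, which
      is impossible for z in P.\<close>
    have pow: "col (b * z ^ k) = col b" for k
    proof (induction k)
      case (Suc k)
      have "x \<in> col (b * z ^ Suc k) \<longleftrightarrow> x \<in> ints \<and> x * z \<in> col (b * z ^ k)" for x
        using ints_mult[OF _ zi] by (auto simp: col_def mult_ac)
      moreover have "x \<in> col (b * z) \<longleftrightarrow> x \<in> ints \<and> x * z \<in> col b" for x
        using ints_mult[OF _ zi] by (auto simp: col_def mult_ac)
      ultimately show ?case
        using colz Suc.IH by blast
    qed simp
    obtain i j a where ij: "i < j" "a \<in> ints" "z ^ j - z ^ i = of_nat n * a"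
      using power_pigeonhole[OF zi n(1)] .
    define k where "k = j - i - 1"
    have j: "j = i + Suc k"
      using ij(1) by (simp add: k_def)
    have "(z ^ Suc k - 1) * (b * z ^ i) = of_nat n * (a * b)"
      using arg_cong[OF ij(3), of "\<lambda>x. x * b"] by (simp add: j power_add algebra_simps)
    hence "z ^ Suc k - 1 \<in> col (b * z ^ i)"
      unfolding col_def using ints_mult[OF ij(2) b(1)] ints_diff[OF ints_power[OF zi] ints_one] by blast
    hence "z ^ Suc k - 1 \<in> P"
      using b(3) by (auto simp: pow)
    moreover have "z ^ k * z \<in> P"
      by (rule fractional_idealD(4)[OF frac ints_power[OF zi] z(1)])
    ultimately have "z ^ k * z - (z ^ Suc k - 1) \<in> P"
      using fractional_idealD(6)[OF frac] by blast
    thus False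
      using nonzero_primeD(3)[OF P] by (simp add: mult.commute)
  qed
  have n0: "of_nat n \<noteq> (0 :: complex)" using n(1) by simp
  show ?thesis
  proof (rule that)
    show "b / of_nat n \<in> F"
      using b(1) ints_subset by (intro divide_closed of_nat_closed) auto
    show "b / of_nat n \<notin> ints"
    proof
      assume "b / of_nat n \<in> ints"
      moreover have "1 * b = of_nat n * (b / of_nat n)"
        using n0 by simp
      ultimately have "1 \<in> col b"
        unfolding col_def using ints_one by blast
      thus False
        using b(3) nonzero_primeD(3)[OF P] by blast
    qed
    fix y assume "y \<in> P"
    then obtain u where "u \<in> ints" "y * b = of_nat n * u"
      using \<open>P \<subseteq> col b\<close> by (auto simp: col_def)
    thus "b / of_nat n * y \<in> ints"
      using n0 by (simp add: mult.commute)
  qed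
qed

section \<open>Inverses of prime ideals and the group of fractional ideals\<close>

definition inverse_ideal :: "complex set \<Rightarrow> complex set" where
  "inverse_ideal I = {x \<in> F. \<forall>y\<in>I. x * y \<in> ints}"

lemma fractional_ideal_inverse_ideal:
  assumes "fractional_ideal F I"
  shows "fractional_ideal F (inverse_ideal I)"
proof -
  obtain d where d: "d \<in> ints" "d \<noteq> 0" "\<And>x. x \<in> I \<Longrightarrow> d * x \<in> ints"
    using fractional_ideal_denomE[OF assms] by blast
  obtain y where y: "y \<in> I" "y \<noteq> 0"
    using fractional_ideal_nonzeroE[OF assms] .
  have "inverse_ideal I \<subseteq> F" "0 \<in> inverse_ideal I"
    by (auto simp: inverse_ideal_def zero_closed ints_zero)
  moreover have "\<forall>x\<in>inverse_ideal I. \<forall>y\<in>inverse_ideal I. x + y \<in> inverse_ideal I"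
    by (auto simp: inverse_ideal_def add_closed ring_distribs ints_add)
  moreover have "\<forall>a\<in>ints. \<forall>x\<in>inverse_ideal I. a * x \<in> inverse_ideal I"
    using ints_subset by (auto simp: inverse_ideal_def mult_closed ints_mult mult.assoc subset_iff)
  moreover have "\<exists>x\<in>inverse_ideal I. x \<noteq> 0"
    using d ints_subset by (intro bexI[of _ d]) (auto simp: inverse_ideal_def)
  moreover have "\<exists>e\<in>ints. e \<noteq> 0 \<and> (\<forall>x\<in>inverse_ideal I. e * x \<in> ints)"
  proof (intro bexI[of _ "d * y"] conjI ballI)
    fix x assume "x \<in> inverse_ideal I"
    hence "d * (x * y) \<in> ints"
      using y(1) by (intro ints_mult[OF d(1)]) (auto simp: inverse_ideal_def)
    thus "d * y * x \<in> ints"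
      by (simp add: mult_ac)
  qed (use d y in auto)
  ultimately show ?thesis
    unfolding fractional_ideal_iff by simp
qed

text \<open>The product lies between P and \<open>ints\<close>, so by maximality it is one of them.
  If it were P, the nonintegral x of \<open>ex_mult_prime_subset_ints\<close> would map P into
  itself and thus be integral.\<close>

lemma nonzero_prime_inverse_ideal:
  assumes P: "nonzero_prime P"
  shows "ideal_prod complex_ring P (inverse_ideal P) = ints"
proof -
  note frac = nonzero_primeD(2)[OF P] and sub = nonzero_primeD(1)[OF P]
  let ?Q = "ideal_prod complex_ring P (inverse_ideal P)"
  have Q: "fractional_ideal F ?Q"
    by (intro fractional_ideal_prod frac fractional_ideal_inverse_ideal)
  have "?Q \<subseteq> ints"
    by (rule ideal_prod_complex_subset) (auto simp: inverse_ideal_def mult.commute ints_add)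
  moreover have "P \<subseteq> ?Q"
  proof
    fix x assume x: "x \<in> P"
    have "1 \<in> inverse_ideal P"
      using sub one_closed by (auto simp: inverse_ideal_def)
    from ideal_prod_complexI[OF x this] show "x \<in> ?Q" by simp
  qed
  ultimately have "?Q = P \<or> ?Q = ints"
    using nonzero_prime_maximal[OF P Q] by blast
  moreover have "?Q \<noteq> P"
  proof
    assume eq: "?Q = P"
    obtain x where x: "x \<in> F" "x \<notin> ints" "\<And>y. y \<in> P \<Longrightarrow> x * y \<in> ints"
      using ex_mult_prime_subset_ints[OF P] by blast
    have "x * y \<in> P" if "y \<in> P" for y
      using ideal_prod_complexI[OF that, of x "inverse_ideal P"] x eq
      by (simp add: inverse_ideal_def mult.commute)
    thus False
      using mem_ints_if_stable[OF frac x(1)] x(2) by blast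
  qed
  ultimately show ?thesis by blast
qed

text \<open>For a proper I inside a prime P, the ideal J obtained by multiplying I with the inverse
  of P is integral and contains I strictly, since equality would again make a nonintegral x
  stabilize I. Fewer integral ideals lie above J, and P times J is I.\<close>

lemma integral_ideal_induct [consumes 2, case_names ints prod]:
  assumes "fractional_ideal F I" "I \<subseteq> ints"
    and ints: "R ints"
    and prod: "\<And>P I. nonzero_prime P \<Longrightarrow> fractional_ideal F I \<Longrightarrow> I \<subseteq> ints \<Longrightarrow> R I \<Longrightarrow>
      R (ideal_prod complex_ring P I)"
  shows "R I"
  using assms(1,2)
proof (induction "card {J. fractional_ideal F J \<and> J \<subseteq> ints \<and> I \<subseteq> J}" arbitrary: I rule: less_induct)
  case (less I)
  note I = less.prems
  show ?case
  proof (cases "I = ints")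
    case False
    then obtain P where P: "nonzero_prime P" "I \<subseteq> P"
      using ex_nonzero_prime_superset[OF I] by blast
    define J where "J = ideal_prod complex_ring (inverse_ideal P) I"
    have J: "fractional_ideal F J"
      unfolding J_def by (intro fractional_ideal_prod fractional_ideal_inverse_ideal I nonzero_primeD(2)[OF P(1)])
    have Jsub: "J \<subseteq> ints"
      unfolding J_def
      by (rule ideal_prod_complex_subset) (use P(2) in \<open>auto simp: inverse_ideal_def ints_add\<close>)
    have "1 \<in> inverse_ideal P"
      using nonzero_primeD(1)[OF P(1)] one_closed by (auto simp: inverse_ideal_def)
    hence IJ: "I \<subseteq> J"
      unfolding J_def using ideal_prod_complexI[of 1 "inverse_ideal P" _ I] by auto
    have "I \<noteq> J"
    proof
      assume eq: "I = J"
      obtain x where x: "x \<in> F" "x \<notin> ints" "\<And>y. y \<in> P \<Longrightarrow> x * y \<in> ints"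
        using ex_mult_prime_subset_ints[OF P(1)] by blast
      have "x * y \<in> I" if "y \<in> I" for y
        using ideal_prod_complexI[of x "inverse_ideal P" y I] x that
        by (subst eq) (simp add: J_def inverse_ideal_def)
      thus False
        using mem_ints_if_stable[OF I(1) x(1)] x(2) by blast
    qed
    obtain n where n: "n > 0" "of_nat n \<in> I"
      using ex_of_nat_mem[OF I] .
    have "{J. fractional_ideal F J \<and> J \<subseteq> ints \<and> I \<subseteq> J} \<subseteq> {J. fractional_ideal F J \<and> J \<subseteq> ints \<and> of_nat n \<in> J}"
      using n(2) by blast
    hence "finite {J. fractional_ideal F J \<and> J \<subseteq> ints \<and> I \<subseteq> J}"
      using finite_integral_ideals_containing[OF n(1)] finite_subset by blast
    moreover have "{K. fractional_ideal F K \<and> K \<subseteq> ints \<and> J \<subseteq> K} \<subset> {K. fractional_ideal F K \<and> K \<subseteq> ints \<and> I \<subseteq> K}"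
      using IJ \<open>I \<noteq> J\<close> I by blast
    ultimately have "R J"
      by (intro less.hyps psubset_card_mono J Jsub) auto
    hence "R (ideal_prod complex_ring P J)"
      by (intro prod P J Jsub)
    also have "ideal_prod complex_ring P J = I"
      by (simp add: J_def nonzero_prime_inverse_ideal[OF P(1)] ints_ideal_prod I flip: ideal_prod_complex_assoc)
    finally show ?thesis .
  qed (simp add: ints)
qed

lemma integral_ideal_ex_inverse:
  assumes "fractional_ideal F I" "I \<subseteq> ints"
  shows "\<exists>J. fractional_ideal F J \<and> ideal_prod complex_ring J I = ints"
  using assms
proof (induction rule: integral_ideal_induct)
  case ints
  thus ?case
    using fractional_ideal_ints ints_ideal_prod by blast
next
  case (prod P I)
  then obtain J where J: "fractional_ideal F J" "ideal_prod complex_ring J I = ints" by blast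
  note fracP = nonzero_primeD(2)[OF prod(1)]
  note fracP' = fractional_ideal_inverse_ideal[OF fracP]
  have "ideal_prod complex_ring (ideal_prod complex_ring J (inverse_ideal P)) (ideal_prod complex_ring P I) =
    ideal_prod complex_ring (ideal_prod complex_ring J I) (ideal_prod complex_ring P (inverse_ideal P))"
    by (simp only: ideal_prod_complex_ac)
  also have "\<dots> = ints"
    by (simp add: J nonzero_prime_inverse_ideal[OF prod(1)] ints_ideal_prod fractional_ideal_ints)
  finally show ?case
    using fractional_ideal_prod[OF J(1) fracP'] by blast
qed

lemma fractional_ideal_ex_integral_mult:
  assumes "fractional_ideal F I"
  obtains d where "d \<in> ints" "d \<noteq> 0" "ideal_prod complex_ring (principal_ideal F d) I \<subseteq> ints"
  using fractional_ideal_denomE[OF assms] ideal_prod_principal_ideal[OF assms] by (metis image_subsetI)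

lemma comm_group_fractional_ideals: "comm_group (fractional_ideals F)"
proof (rule comm_groupI)
  fix I assume "I \<in> carrier (fractional_ideals F)"
  hence I: "fractional_ideal F I" by simp
  obtain d where d: "d \<in> ints" "d \<noteq> 0" "ideal_prod complex_ring (principal_ideal F d) I \<subseteq> ints"
    using fractional_ideal_ex_integral_mult[OF I] .
  have D: "fractional_ideal F (principal_ideal F d)"
    using d ints_subset by (intro fractional_ideal_principal_ideal) auto
  obtain J where J: "fractional_ideal F J"
    "ideal_prod complex_ring J (ideal_prod complex_ring (principal_ideal F d) I) = ints"
    using integral_ideal_ex_inverse[OF fractional_ideal_prod[OF D I] d(3)] by blast
  thus "\<exists>J\<in>carrier (fractional_ideals F). J \<otimes>\<^bsub>fractional_ideals F\<^esub> I = \<one>\<^bsub>fractional_ideals F\<^esub>"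
    by (intro bexI[of _ "ideal_prod complex_ring J (principal_ideal F d)"])
      (simp_all add: fractional_ideal_prod D ideal_prod_complex_assoc)
qed (simp_all add: fractional_ideal_prod fractional_ideal_ints ints_ideal_prod ideal_prod_complex_assoc,
    rule ideal_prod_complex_comm)

end

section \<open>Prime factorization and valuations\<close>

context number_field
begin

sublocale fi: comm_group "fractional_ideals F"
  by (rule comm_group_fractional_ideals)

abbreviation ideal_power :: "complex set \<Rightarrow> int \<Rightarrow> complex set" where
  "ideal_power P k \<equiv> P [^]\<^bsub>fractional_ideals F\<^esub> k"

lemma fractional_ideal_power: "fractional_ideal F I \<Longrightarrow> fractional_ideal F (ideal_power I k)"
  using fi.int_pow_closed[of I k] by simp

lemma fractional_ideal_prime_power: "nonzero_prime P \<Longrightarrow> fractional_ideal F (ideal_power P k)"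
  by (rule fractional_ideal_power[OF nonzero_primeD(2)])

lemma ideal_power_add:
  "fractional_ideal F I \<Longrightarrow> ideal_power I (k + l) = ideal_prod complex_ring (ideal_power I k) (ideal_power I l)"
  using fi.int_pow_mult[of I k l] by simp

lemma ideal_power_0: "ideal_power I 0 = ints"
  by (simp only: int_pow_0 fractional_ideals_simps)

lemma ideal_power_1: "fractional_ideal F I \<Longrightarrow> ideal_power I 1 = I"
  using fi.int_pow_1[of I] by simp

lemma ideal_power_subset_ints:
  assumes "fractional_ideal F I" "I \<subseteq> ints" "k \<ge> 0"
  shows "ideal_power I k \<subseteq> ints"
  using assms(3)
proof (induction k rule: int_ge_induct)
  case (step k)
  have "ideal_prod complex_ring (ideal_power I k) I \<subseteq> ints"
    by (rule ideal_prod_complex_subset) (use step assms(2) in \<open>auto intro: ints_mult ints_add\<close>)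
  thus ?case
    by (simp add: ideal_power_add ideal_power_1 assms)
qed (simp add: ideal_power_0)

lemma ideal_power_subset:
  assumes "fractional_ideal F I" "I \<subseteq> ints" "k \<ge> 1"
  shows "ideal_power I k \<subseteq> I"
proof -
  have "ideal_power I k = ideal_prod complex_ring (ideal_power I (k - 1)) I"
    using ideal_power_add[OF assms(1), of "k - 1" 1] by (simp add: ideal_power_1 assms)
  also have "\<dots> \<subseteq> I"
    by (rule ideal_prod_complex_subset)
      (use ideal_power_subset_ints[OF assms(1,2), of "k - 1"] assms(3) fractional_idealD[OF assms(1)] in auto)
  finally show ?thesis .
qed

lemma power_mem_ideal_power:
  assumes "fractional_ideal F I" "x \<in> I"
  shows "x ^ n \<in> ideal_power I (int n)"
proof (induction n)
  case (Suc n)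
  have "x ^ n * x \<in> ideal_prod complex_ring (ideal_power I (int n)) (ideal_power I 1)"
    using Suc assms by (intro ideal_prod_complexI) (simp_all add: ideal_power_1)
  thus ?case
    using ideal_power_add[OF assms(1), of "int n" 1] by (simp add: add.commute mult.commute)
qed (simp add: ideal_power_0 ints_one)

text \<open>For k >= 0 a power of an element of Q outside P works; for k < 0 the power of Q contains
  1.\<close>

lemma ex_mem_ideal_power_not_mem:
  assumes P: "nonzero_prime P" and Q: "nonzero_prime Q" and ne: "P \<noteq> Q"
  shows "\<exists>s\<in>ints. s \<notin> P \<and> s \<in> ideal_power Q k"
proof (cases "k \<ge> 0")
  case True
  have "\<not> Q \<subseteq> P"
    using nonzero_prime_maximal[OF Q nonzero_primeD(2)[OF P] nonzero_primeD(1)[OF P]] ne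
      nonzero_primeD(4)[OF P] by blast
  then obtain q where q: "q \<in> Q" "q \<notin> P" by blast
  have "q \<in> ints" using q(1) nonzero_primeD(1)[OF Q] by blast
  moreover have "q ^ nat k \<in> ideal_power Q k"
    using power_mem_ideal_power[OF nonzero_primeD(2)[OF Q] q(1), of "nat k"] True by simp
  moreover have "q ^ nat k \<notin> P"
    using nonzero_prime_power[OF P \<open>q \<in> ints\<close>] q(2) by blast
  ultimately show ?thesis
    using ints_power by blast
next
  case False
  note frac = nonzero_primeD(2)[OF Q]
  have "ints = ideal_prod complex_ring (ideal_power Q (- k)) (ideal_power Q k)"
    using ideal_power_add[OF frac, of "- k" k] by (simp add: ideal_power_0)
  also have "\<dots> \<subseteq> ideal_prod complex_ring ints (ideal_power Q k)"
    using False ideal_power_subset_ints[OF frac nonzero_primeD(1)[OF Q], of "- k"]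
    by (intro ideal_prod_complex_mono) auto
  also have "\<dots> = ideal_power Q k"
    by (rule ints_ideal_prod[OF fractional_ideal_power[OF frac]])
  finally show ?thesis
    using ints_one nonzero_primeD(3)[OF P] by blast
qed

lemma ex_mem_finprod_not_mem:
  assumes P: "nonzero_prime P" and A: "finite A" "A \<subseteq> Collect nonzero_prime" "P \<notin> A"
  shows "\<exists>s\<in>ints. s \<notin> P \<and> s \<in> finprod (fractional_ideals F) (\<lambda>Q. ideal_power Q (e Q)) A"
  using A
proof (induction A)
  case empty
  thus ?case
    using ints_one nonzero_primeD(3)[OF P] by auto
next
  case (insert Q A)
  then obtain s where s: "s \<in> ints" "s \<notin> P" "s \<in> finprod (fractional_ideals F) (\<lambda>Q. ideal_power Q (e Q)) A"
    by blast
  have Q: "nonzero_prime Q" "P \<noteq> Q"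
    using insert.prems by auto
  obtain t where t: "t \<in> ints" "t \<notin> P" "t \<in> ideal_power Q (e Q)"
    using ex_mem_ideal_power_not_mem[OF P Q] by blast
  have "finprod (fractional_ideals F) (\<lambda>Q. ideal_power Q (e Q)) (insert Q A) =
    ideal_prod complex_ring (ideal_power Q (e Q)) (finprod (fractional_ideals F) (\<lambda>Q. ideal_power Q (e Q)) A)"
    using insert.hyps insert.prems
    by (subst fi.finprod_insert) (auto intro!: fractional_ideal_prime_power)
  moreover have "t * s \<notin> P"
    using nonzero_primeD(5)[OF P t(1) s(1)] s t by blast
  ultimately show ?case
    using ideal_prod_complexI[OF t(3) s(3)] ints_mult[OF t(1) s(1)] by auto
qed

text \<open>Enlarging the index set to a common finite one allows factorizations with different
  supports to be multiplied.\<close>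

lemma prime_factorization_superset:
  assumes "finite A" "A \<subseteq> Collect nonzero_prime" "{P. e P \<noteq> 0} \<subseteq> A"
  shows "prime_factorization_of F I e \<longleftrightarrow>
    I = finprod (fractional_ideals F) (\<lambda>P. ideal_power P (e P)) A"
proof -
  have "finprod (fractional_ideals F) (\<lambda>P. ideal_power P (e P)) {P. e P \<noteq> 0} =
    finprod (fractional_ideals F) (\<lambda>P. ideal_power P (e P)) A"
    using assms
    by (intro fi.finprod_mono_neutral_cong_left)
      (auto simp: ideal_power_0 intro!: fractional_ideal_prime_power)
  moreover have "finite {P. e P \<noteq> 0}"
    using assms finite_subset by blast
  ultimately show ?thesis
    unfolding prime_factorization_of_def using assms(2,3) by auto
qed

lemma prime_factorization_ofD:
  assumes "prime_factorization_of F I e"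
  shows "finite {P. e P \<noteq> 0}" "e P \<noteq> 0 \<Longrightarrow> nonzero_prime P" "fractional_ideal F I"
proof -
  show 1: "finite {P. e P \<noteq> 0}" "e P \<noteq> 0 \<Longrightarrow> nonzero_prime P" for P
    using assms unfolding prime_factorization_of_def by blast+
  have "finprod (fractional_ideals F) (\<lambda>P. ideal_power P (e P)) {P. e P \<noteq> 0} \<in> carrier (fractional_ideals F)"
    using 1 by (intro fi.finprod_closed) (auto intro!: fractional_ideal_prime_power)
  thus "fractional_ideal F I"
    using assms unfolding prime_factorization_of_def by simp
qed

lemma prime_factorization_mult:
  assumes I: "prime_factorization_of F I e" and J: "prime_factorization_of F J f"
  shows "prime_factorization_of F (ideal_prod complex_ring I J) (\<lambda>P. e P + f P)"
proof -
  define A where "A = {P. e P \<noteq> 0} \<union> {P. f P \<noteq> 0}"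
  have "finite A"
    using prime_factorization_ofD(1)[OF I] prime_factorization_ofD(1)[OF J] by (simp add: A_def)
  moreover have "A \<subseteq> Collect nonzero_prime"
    using prime_factorization_ofD(2)[OF I] prime_factorization_ofD(2)[OF J] unfolding A_def by blast
  ultimately have A: "finite A" "A \<subseteq> Collect nonzero_prime" .
  have sub: "{P. e P \<noteq> 0} \<subseteq> A" "{P. f P \<noteq> 0} \<subseteq> A" "{P. e P + f P \<noteq> 0} \<subseteq> A"
    by (auto simp: A_def)
  have "I = finprod (fractional_ideals F) (\<lambda>P. ideal_power P (e P)) A"
    "J = finprod (fractional_ideals F) (\<lambda>P. ideal_power P (f P)) A"
    using I J prime_factorization_superset[OF A sub(1)] prime_factorization_superset[OF A sub(2)] by blast+
  hence "ideal_prod complex_ring I J =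
      finprod (fractional_ideals F) (\<lambda>P. ideal_power P (e P)) A \<otimes>\<^bsub>fractional_ideals F\<^esub>
      finprod (fractional_ideals F) (\<lambda>P. ideal_power P (f P)) A"
    by simp
  also have "\<dots> = finprod (fractional_ideals F)
      (\<lambda>P. ideal_power P (e P) \<otimes>\<^bsub>fractional_ideals F\<^esub> ideal_power P (f P)) A"
    using A by (intro fi.finprod_multf[symmetric]) (auto intro!: fractional_ideal_prime_power)
  also have "\<dots> = finprod (fractional_ideals F) (\<lambda>P. ideal_power P (e P + f P)) A"
  proof (rule fi.finprod_cong'[OF refl])
    fix P assume "P \<in> A"
    hence "nonzero_prime P" using A(2) by blast
    thus "ideal_power P (e P) \<otimes>\<^bsub>fractional_ideals F\<^esub> ideal_power P (f P) = ideal_power P (e P + f P)"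
      using ideal_power_add[OF nonzero_primeD(2)] by simp
  qed (use A(2) in \<open>auto intro!: fractional_ideal_prime_power\<close>)
  finally show ?thesis
    unfolding prime_factorization_superset[OF A sub(3)] .
qed

lemma prime_factorization_ints: "prime_factorization_of F ints (\<lambda>_. 0)"
  by (simp add: prime_factorization_of_def)

lemma prime_factorization_inverse:
  assumes I: "prime_factorization_of F I e"
  shows "prime_factorization_of F (inv\<^bsub>fractional_ideals F\<^esub> I) (\<lambda>P. - e P)"
proof -
  define J where "J = finprod (fractional_ideals F) (\<lambda>P. ideal_power P (- e P)) {P. e P \<noteq> 0}"
  have J: "prime_factorization_of F J (\<lambda>P. - e P)"
    using prime_factorization_ofD[OF I] by (simp add: prime_factorization_of_def J_def)
  have "prime_factorization_of F (ideal_prod complex_ring J I) (\<lambda>P. - e P + e P)"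
    by (rule prime_factorization_mult[OF J I])
  hence "ideal_prod complex_ring J I = ints"
    by (simp add: prime_factorization_of_def)
  hence "inv\<^bsub>fractional_ideals F\<^esub> I = J"
    using prime_factorization_ofD(3)[OF I] prime_factorization_ofD(3)[OF J]
    by (intro fi.inv_equality) auto
  thus ?thesis using J by simp
qed

lemma prime_factorization_prime_power:
  assumes "nonzero_prime P"
  shows "prime_factorization_of F (ideal_power P k) (\<lambda>Q. if Q = P then k else 0)"
proof -
  let ?e = "\<lambda>Q. if Q = P then k else 0"
  have frac: "fractional_ideal F (ideal_power P k)"
    by (rule fractional_ideal_prime_power[OF assms])
  have "finprod (fractional_ideals F) (\<lambda>Q. ideal_power Q (?e Q)) (insert P {}) =
      ideal_power P (?e P) \<otimes>\<^bsub>fractional_ideals F\<^esub> finprod (fractional_ideals F) (\<lambda>Q. ideal_power Q (?e Q)) {}"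
    by (rule fi.finprod_insert) (use frac in auto)
  also have "\<dots> = ideal_power P k"
    using fi.r_one[of "ideal_power P k"] frac by simp
  finally have "finprod (fractional_ideals F) (\<lambda>Q. ideal_power Q (?e Q)) {P} = ideal_power P k" .
  moreover have "{Q. ?e Q \<noteq> 0} \<subseteq> {P}"
    by auto
  ultimately show ?thesis
    using assms prime_factorization_superset[of "{P}" ?e] by simp
qed

lemma ex_prime_factorization:
  assumes I: "fractional_ideal F I"
  shows "\<exists>e. prime_factorization_of F I e"
proof -
  have integral: "\<exists>e. prime_factorization_of F J e" if "fractional_ideal F J" "J \<subseteq> ints" for J
    using that
  proof (induction rule: integral_ideal_induct)
    case ints
    thus ?case using prime_factorization_ints by blast
  next
    case (prod P I)
    have "prime_factorization_of F P (\<lambda>Q. if Q = P then 1 else 0)"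
      using prime_factorization_prime_power[OF prod(1), of 1]
      by (simp add: ideal_power_1 nonzero_primeD(2)[OF prod(1)])
    thus ?case
      using prod.IH prime_factorization_mult by blast
  qed
  obtain d where d: "d \<in> ints" "d \<noteq> 0" "ideal_prod complex_ring (principal_ideal F d) I \<subseteq> ints"
    using fractional_ideal_ex_integral_mult[OF I] .
  let ?D = "principal_ideal F d"
  have "d \<in> F"
    using d(1) ints_subset by blast
  hence D: "fractional_ideal F ?D" "?D \<subseteq> ints"
    using d(2) ints_mult[OF d(1)] fractional_ideal_principal_ideal[of d]
    by (auto simp: principal_ideal_def)
  obtain e f where e: "prime_factorization_of F ?D e"
    and f: "prime_factorization_of F (ideal_prod complex_ring ?D I) f"
    using integral[OF D] integral[OF fractional_ideal_prod[OF D(1) I] d(3)] by blast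
  have "inv\<^bsub>fractional_ideals F\<^esub> ?D \<otimes>\<^bsub>fractional_ideals F\<^esub> (?D \<otimes>\<^bsub>fractional_ideals F\<^esub> I) = I"
    using D(1) I fi.m_assoc[symmetric, of "inv\<^bsub>fractional_ideals F\<^esub> ?D" ?D I] fi.inv_closed[of ?D] fi.l_inv[of ?D]
    by (simp add: ints_ideal_prod)
  thus ?thesis
    using prime_factorization_mult[OF prime_factorization_inverse[OF e] f] by auto
qed

text \<open>Once the P-part is cancelled only powers of other primes remain, and each of them
  contains an integral element outside P. The exponent at P thus becomes visible in the localization
  at P.\<close>

lemma prime_factorization_local:
  assumes I: "prime_factorization_of F I e" and P: "nonzero_prime P"
  shows "\<exists>s\<in>ints. s \<notin> P \<and> s \<in> ideal_prod complex_ring I (ideal_power P (- e P))"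
proof -
  define f where "f Q = e Q + (if Q = P then - e P else 0)" for Q
  have f: "prime_factorization_of F (ideal_prod complex_ring I (ideal_power P (- e P))) f"
    unfolding f_def by (rule prime_factorization_mult[OF I prime_factorization_prime_power[OF P]])
  have "f P = 0" by (simp add: f_def)
  thus ?thesis
    using ex_mem_finprod_not_mem[OF P, of "{P. f P \<noteq> 0}" f] prime_factorization_ofD[OF f] f
    unfolding prime_factorization_of_def by auto
qed

text \<open>The local elements s for I with exponents e, and t for the inverse of I with exponents
  -f, have their product in the power of P with exponent f P - e P. If e P < f P this power lies in
  P, although P is prime and contains neither s nor t.\<close>

lemma prime_factorization_le:
  assumes e: "prime_factorization_of F I e" and f: "prime_factorization_of F I f" and P: "nonzero_prime P"
  shows "e P \<ge> f P"
proof (rule ccontr)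
  assume less: "\<not> e P \<ge> f P"
  let ?G = "fractional_ideals F"
  note frac = prime_factorization_ofD(3)[OF e] and fracP = nonzero_primeD(2)[OF P]
  have inv: "fractional_ideal F (inv\<^bsub>?G\<^esub> I)" "ideal_prod complex_ring I (inv\<^bsub>?G\<^esub> I) = ints"
    using fi.inv_closed[of I] fi.r_inv[of I] frac by auto
  obtain s where s: "s \<in> ints" "s \<notin> P" "s \<in> ideal_prod complex_ring I (ideal_power P (- e P))"
    using prime_factorization_local[OF e P] by blast
  obtain t where t: "t \<in> ints" "t \<notin> P" "t \<in> ideal_prod complex_ring (inv\<^bsub>?G\<^esub> I) (ideal_power P (f P))"
    using prime_factorization_local[OF prime_factorization_inverse[OF f] P] by auto
  have "s * t \<in> ideal_prod complex_ring (ideal_prod complex_ring I (ideal_power P (- e P)))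
      (ideal_prod complex_ring (inv\<^bsub>?G\<^esub> I) (ideal_power P (f P)))"
    using s(3) t(3) by (rule ideal_prod_complexI)
  also have "\<dots> = ideal_prod complex_ring (ideal_prod complex_ring I (inv\<^bsub>?G\<^esub> I))
      (ideal_prod complex_ring (ideal_power P (- e P)) (ideal_power P (f P)))"
    by (simp only: ideal_prod_complex_ac)
  also have "\<dots> = ideal_power P (- e P + f P)"
    using ints_ideal_prod[OF fractional_ideal_power[OF fracP]]
    by (simp only: inv(2) ideal_power_add[OF fracP, symmetric])
  also have "\<dots> \<subseteq> P"
    using less by (intro ideal_power_subset fracP nonzero_primeD(1)[OF P]) simp
  finally show False
    using nonzero_primeD(5)[OF P s(1) t(1)] s(2) t(2) by blast
qed

lemma prime_factorization_unique:
  assumes "prime_factorization_of F I e" "prime_factorization_of F I f"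
  shows "e = f"
proof
  fix P
  show "e P = f P"
    using prime_factorization_le[OF assms, of P] prime_factorization_le[OF assms(2,1), of P]
      prime_factorization_ofD(2)[OF assms(1), of P] prime_factorization_ofD(2)[OF assms(2), of P]
    by (metis order_antisym)
qed

lemma prime_exponent_eq:
  assumes "prime_factorization_of F I e"
  shows "prime_exponent F P I = e P"
  unfolding prime_exponent_def
  using assms prime_factorization_unique by (metis the_equality)

section \<open>Exponents of elements and localization at a prime\<close>

abbreviation val :: "complex set \<Rightarrow> complex \<Rightarrow> int" where
  "val P x \<equiv> prime_exponent F P (principal_ideal F x)"

lemma prime_factorization_principal_ideal:
  assumes "x \<in> F" "x \<noteq> 0"
  shows "prime_factorization_of F (principal_ideal F x) (\<lambda>P. val P x)"
proof -
  obtain e where e: "prime_factorization_of F (principal_ideal F x) e"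
    using ex_prime_factorization[OF fractional_ideal_principal_ideal[OF assms]] by blast
  moreover have "(\<lambda>P. val P x) = e"
    using prime_exponent_eq[OF e] by blast
  ultimately show ?thesis by simp
qed

lemma val_mult:
  assumes "x \<in> F" "x \<noteq> 0" "y \<in> F" "y \<noteq> 0"
  shows "val P (x * y) = val P x + val P y"
proof -
  have "prime_factorization_of F (principal_ideal F (x * y)) (\<lambda>P. val P x + val P y)"
    using prime_factorization_mult[OF prime_factorization_principal_ideal prime_factorization_principal_ideal,
        OF assms] assms by (simp add: principal_ideal_mult)
  thus ?thesis by (rule prime_exponent_eq)
qed

lemma val_divide:
  assumes "x \<in> F" "x \<noteq> 0" "y \<in> F" "y \<noteq> 0"
  shows "val P (x / y) = val P x - val P y"
  using val_mult[of "x / y" y P] assms by (simp add: divide_closed)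

text \<open>The local element is taken from the inverse of the principal ideal of x times the
  corresponding power of P; multiplication by x cancels the inverse.\<close>

lemma ex_mult_mem_ideal_power:
  assumes x: "x \<in> F" "x \<noteq> 0" and P: "nonzero_prime P"
  obtains s where "s \<in> ints" "s \<notin> P" "s * x \<in> ideal_power P (val P x)"
proof -
  let ?G = "fractional_ideals F" and ?X = "principal_ideal F x"
  note frac = fractional_ideal_principal_ideal[OF x]
  have inv: "fractional_ideal F (inv\<^bsub>?G\<^esub> ?X)" "ideal_prod complex_ring ?X (inv\<^bsub>?G\<^esub> ?X) = ints"
    using fi.inv_closed[of ?X] fi.r_inv[of ?X] frac by auto
  obtain s where s: "s \<in> ints" "s \<notin> P" "s \<in> ideal_prod complex_ring (inv\<^bsub>?G\<^esub> ?X) (ideal_power P (val P x))"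
    using prime_factorization_local[OF prime_factorization_inverse[OF prime_factorization_principal_ideal[OF x]] P]
    by auto
  have "x \<in> ?X"
    using ints_one by (force simp: principal_ideal_def)
  hence "x * s \<in> ideal_prod complex_ring ?X (ideal_prod complex_ring (inv\<^bsub>?G\<^esub> ?X) (ideal_power P (val P x)))"
    using s(3) by (rule ideal_prod_complexI)
  also have "\<dots> = ideal_power P (val P x)"
    using ints_ideal_prod[OF fractional_ideal_power[OF nonzero_primeD(2)[OF P]]]
    by (simp only: inv(2) flip: ideal_prod_complex_assoc)
  finally show ?thesis
    using that[OF s(1,2)] by (simp add: mult.commute)
qed

text \<open>This translates exponents into the local ring of P. If the exponent were negative, some
  t = x * a outside P would have a in P; with s * x integral, s * t = (s * x) * a lies in P, against
  primality.\<close>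

lemma val_nonneg_iff:
  assumes x: "x \<in> F" "x \<noteq> 0" and P: "nonzero_prime P"
  shows "val P x \<ge> 0 \<longleftrightarrow> (\<exists>s\<in>ints. s \<notin> P \<and> s * x \<in> ints)"
proof
  assume "val P x \<ge> 0"
  thus "\<exists>s\<in>ints. s \<notin> P \<and> s * x \<in> ints"
    using ex_mult_mem_ideal_power[OF x P] ideal_power_subset_ints[OF nonzero_primeD(2,1)[OF P]] by blast
next
  assume "\<exists>s\<in>ints. s \<notin> P \<and> s * x \<in> ints"
  then obtain s where s: "s \<in> ints" "s \<notin> P" "s * x \<in> ints" by blast
  show "val P x \<ge> 0"
  proof (rule ccontr)
    assume neg: "\<not> val P x \<ge> 0"
    note fracP = nonzero_primeD(2)[OF P]
    obtain t where t: "t \<in> ints" "t \<notin> P" "t \<in> ideal_prod complex_ring (principal_ideal F x) (ideal_power P (- val P x))"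
      using prime_factorization_local[OF prime_factorization_principal_ideal[OF x] P] by blast
    then obtain a where a: "a \<in> ideal_power P (- val P x)" "t = x * a"
      by (auto simp: ideal_prod_principal_ideal[OF fractional_ideal_power[OF fracP]])
    have "a \<in> P"
      using a(1) ideal_power_subset[OF fracP nonzero_primeD(1)[OF P], of "- val P x"] neg by auto
    hence "(s * x) * a \<in> P"
      by (rule fractional_idealD(4)[OF fracP s(3)])
    thus False
      using nonzero_primeD(5)[OF P s(1) t(1)] s(2) t(2) by (simp add: a(2) mult_ac)
  qed
qed

lemma valuation_nonneg_iff:
  assumes "x \<in> F" "nonzero_prime P"
  shows "valuation F P x \<ge> 0 \<longleftrightarrow> (\<exists>s\<in>ints. s \<notin> P \<and> s * x \<in> ints)"
proof (cases "x = 0")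
  case True
  thus ?thesis
    using ints_zero ints_one nonzero_primeD(3)[OF assms(2)] by (auto simp: valuation_def)
next
  case False
  thus ?thesis
    using val_nonneg_iff[OF assms(1) _ assms(2)] by (simp add: valuation_def zero_extended_def)
qed

end

section \<open>The field generated by one algebraic number\<close>

lemma rat_span_mult_right:
  assumes "y \<in> rat_span.span S" "\<And>s. s \<in> S \<Longrightarrow> s * z \<in> rat_span.span T"
  shows "y * z \<in> rat_span.span T"
  using assms(1)
proof (induction rule: rat_span.span_induct_alt)
  case (step c s y)
  have "(of_rat c * s + y) * z = of_rat c * (s * z) + y * z"
    by (simp add: algebra_simps)
  thus ?case
    using step assms(2) by (simp add: rat_span.span_add rat_span.span_scale)
qed (simp add: rat_span.span_zero)

lemma algebraic_power_mem_rat_span: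
  fixes \<alpha> :: complex
  assumes "algebraic \<alpha>"
  obtains m where "\<alpha> ^ m \<in> rat_span.span ((\<lambda>i. \<alpha> ^ i) ` {..<m})"
proof -
  obtain p :: "int poly" where p: "p \<noteq> 0" "poly (map_poly of_int p) \<alpha> = 0"
    using assms by (erule algebraicE')
  define m where "m = Polynomial.degree p"
  define c where "c = lead_coeff p"
  have c: "c \<noteq> 0" using p(1) by (simp add: c_def)
  have "0 = (\<Sum>i\<le>m. of_int (coeff p i) * \<alpha> ^ i)"
    using p(2) by (simp add: poly_altdef degree_map_poly coeff_map_poly m_def)
  also have "\<dots> = (\<Sum>i<m. of_int (coeff p i) * \<alpha> ^ i) + of_int c * \<alpha> ^ m"
    by (simp add: lessThan_Suc_atMost[symmetric] c_def m_def)
  finally have "of_int c * \<alpha> ^ m = - (\<Sum>i<m. of_int (coeff p i) * \<alpha> ^ i)"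
    by (simp add: eq_neg_iff_add_eq_0 add.commute)
  hence eq: "\<alpha> ^ m = of_rat (- 1 / of_int c) * (\<Sum>i<m. of_rat (of_int (coeff p i)) * \<alpha> ^ i)"
    using c by (simp add: of_rat_divide field_simps)
  have "\<alpha> ^ m \<in> rat_span.span ((\<lambda>i. \<alpha> ^ i) ` {..<m})"
    by (subst eq) (intro rat_span.span_scale rat_span.span_sum rat_span.span_base, auto)
  thus ?thesis by (rule that)
qed

lemma number_field_span_powers:
  assumes m: "\<alpha> ^ m \<in> rat_span.span ((\<lambda>i. \<alpha> ^ i) ` {..<m})"
  shows "number_field (rat_span.span ((\<lambda>i. \<alpha> ^ i) ` {..<m}))"
    and "\<alpha> \<in> rat_span.span ((\<lambda>i. \<alpha> ^ i) ` {..<m})"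
proof -
  let ?B = "(\<lambda>i. \<alpha> ^ i) ` {..<m}"
  let ?V = "rat_span.span ?B"
  \<comment> \<open>For m = 0 the hypothesis would place 1 in the span of the empty set.\<close>
  have "m > 0"
    using m by (cases m) (auto simp: rat_span.span_empty)
  hence one: "1 \<in> ?V"
    by (intro rat_span.span_base) (force intro!: image_eqI[of _ _ 0])
  have \<alpha>: "y * \<alpha> \<in> ?V" if "y \<in> ?V" for y
    using that
  proof (rule rat_span_mult_right)
    fix s assume "s \<in> ?B"
    then obtain i where i: "i < m" "s = \<alpha> ^ i" by auto
    show "s * \<alpha> \<in> ?V"
    proof (cases "Suc i = m")
      case True
      thus ?thesis using m i by (simp add: mult.commute flip: power_Suc)
    next
      case False
      hence "\<alpha> ^ Suc i \<in> ?V"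
        using i by (intro rat_span.span_base imageI) simp
      thus ?thesis using i by (simp add: mult.commute)
    qed
  qed
  have pow: "\<alpha> ^ i * y \<in> ?V" if "y \<in> ?V" for i y
  proof (induction i)
    case (Suc i)
    have "(\<alpha> ^ i * y) * \<alpha> \<in> ?V" by (rule \<alpha>[OF Suc])
    thus ?case by (simp add: mult_ac)
  qed (use that in simp)
  have mult: "x * y \<in> ?V" if "x \<in> ?V" "y \<in> ?V" for x y
    using that(1) by (rule rat_span_mult_right) (use pow[OF that(2)] in auto)
  show "\<alpha> \<in> ?V"
    using \<alpha>[OF one] by simp
  interpret V: rational_algebra ?V
    by standard (auto simp: rat_span.span_zero one rat_span.span_add rat_span.span_neg mult)
  show "number_field ?V"
  proof
    fix x assume x: "x \<in> ?V"
    show "inverse x \<in> ?V"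
    proof (cases "x = 0")
      case False
      then obtain q :: "int poly" and c :: int where c: "c \<noteq> 0" "x * poly (map_poly of_int q) x = of_int c"
        using V.ex_int_poly_mult_eq_of_int[OF x] by blast
      have "inverse x = of_rat (1 / of_int c) * poly (map_poly of_int q) x"
        using c False by (simp add: of_rat_divide field_simps)
      thus ?thesis
        by (simp only: rat_span.span_scale[OF V.poly_closed[OF x]])
    qed (simp add: rat_span.span_zero)
  qed
qed

lemma rational_adjoin_subset:
  assumes "number_field V" "\<alpha> \<in> V"
  shows "rational_adjoin \<alpha> \<subseteq> V"
proof
  interpret number_field V by (rule assms)
  fix x assume "x \<in> rational_adjoin \<alpha>"
  hence "x \<in> generate_field complex_ring {\<alpha>}"
    by (simp add: rational_adjoin_def)
  thus "x \<in> V"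
  proof induction
    case (m_inv h)
    thus ?case by (simp add: complex_ring_m_inv inverse_closed)
  qed (use assms(2) in \<open>auto simp: one_closed add_closed uminus_closed mult_closed\<close>)
qed

lemma self_mem_rational_adjoin: "\<alpha> \<in> rational_adjoin \<alpha>"
  unfolding rational_adjoin_def by (rule generate_field.incl) simp

lemma number_field_rational_adjoin:
  assumes "algebraic \<alpha>"
  shows "number_field (rational_adjoin \<alpha>)"
proof -
  let ?K = "rational_adjoin \<alpha>"
  obtain m where m: "\<alpha> ^ m \<in> rat_span.span ((\<lambda>i. \<alpha> ^ i) ` {..<m})"
    using algebraic_power_mem_rat_span[OF assms] .
  have one: "1 \<in> ?K"
    using generate_field.one[of complex_ring "{\<alpha>}"] by (simp add: rational_adjoin_def)
  have uminus: "- x \<in> ?K" if "x \<in> ?K" for x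
    using generate_field.a_inv[of x complex_ring "{\<alpha>}"] that by (simp add: rational_adjoin_def)
  have add: "x + y \<in> ?K" if "x \<in> ?K" "y \<in> ?K" for x y
    using generate_field.eng_add[of x complex_ring "{\<alpha>}" y] that by (simp add: rational_adjoin_def)
  have mult: "x * y \<in> ?K" if "x \<in> ?K" "y \<in> ?K" for x y
    using generate_field.eng_mult[of x complex_ring "{\<alpha>}" y] that by (simp add: rational_adjoin_def)
  have zero: "0 \<in> ?K"
    using add[OF one uminus[OF one]] by simp
  have inv: "inverse x \<in> ?K" if "x \<in> ?K" for x
  proof (cases "x = 0")
    case False
    thus ?thesis
      using generate_field.m_inv[of x complex_ring "{\<alpha>}"] that
      by (simp add: rational_adjoin_def complex_ring_m_inv)
  qed (simp add: zero)
  have "\<exists>B. finite B \<and> ?K \<subseteq> rat_span.span B"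
    using rational_adjoin_subset[OF number_field_span_powers[OF m]] by blast
  thus ?thesis
    using one uminus add mult zero inv by unfold_locales
qed

text \<open>Powers of \<alpha> lie in the ring and span the field over the rationals, so only
  rational coefficients have to be cleared. These denominators later bound divisibility by p and
  start the final descent.\<close>

lemma ex_of_nat_mult_mem_binomial_ring:
  assumes "algebraic \<alpha>" "x \<in> rational_adjoin \<alpha>"
  obtains d where "d > 0" "of_nat d * x \<in> binomial_ring \<alpha>"
proof -
  obtain m where m: "\<alpha> ^ m \<in> rat_span.span ((\<lambda>i. \<alpha> ^ i) ` {..<m})"
    using algebraic_power_mem_rat_span[OF assms(1)] .
  have "x \<in> rat_span.span ((\<lambda>i. \<alpha> ^ i) ` {..<m})"
    using rational_adjoin_subset[OF number_field_span_powers[OF m]] assms(2) by blast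
  hence "\<exists>d>0. of_nat d * x \<in> binomial_ring \<alpha>"
  proof (induction rule: rat_span.span_induct_alt)
    case base
    show ?case by (intro exI[of _ 1]) (simp add: zero_mem_binomial_ring)
  next
    case (step q s y)
    then obtain d where d: "d > 0" "of_nat d * y \<in> binomial_ring \<alpha>" by blast
    obtain a b where ab: "q = of_int a / of_int b" "b > (0::int)"
      using quotient_of_div[of q] quotient_of_denom_pos[of q] by (cases "quotient_of q") auto
    obtain i where "s = \<alpha> ^ i" using step by auto
    hence s: "s \<in> binomial_ring \<alpha>"
      by (simp add: power_mem_binomial_ring self_mem_binomial_ring)
    have "of_nat (nat b * d) * (of_rat q * s + y) = of_int (int d * a) * s + of_int b * (of_nat d * y)"
    proof -
      have "(of_rat q :: complex) = of_int a / of_int b"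
        by (simp add: ab(1) of_rat_divide)
      thus ?thesis using ab(2) by (simp add: field_simps)
    qed
    also have "\<dots> \<in> binomial_ring \<alpha>"
      by (intro add_mem_binomial_ring mult_mem_binomial_ring of_int_mem_binomial_ring s d)
    finally show ?case
      using d(1) ab(2) by (intro exI[of _ "nat b * d"]) auto
  qed
  thus ?thesis using that by blast
qed

lemma binomial_ring_subset_rational_adjoin:
  assumes "algebraic \<alpha>" 
  shows "binomial_ring \<alpha> \<subseteq> rational_adjoin \<alpha>"
proof
  interpret number_field "rational_adjoin \<alpha>"
    by (rule number_field_rational_adjoin[OF assms])
  have gb: "\<alpha> gchoose k \<in> rational_adjoin \<alpha>" for k
  proof (induction k)
    case (Suc k)
    have "\<alpha> gchoose Suc k = (\<alpha> - of_nat k) * (\<alpha> gchoose k) / of_nat (Suc k)"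
      using gbinomial_mult_1[of \<alpha> k] by (simp add: field_simps del: of_nat_Suc)
    also have "\<dots> \<in> rational_adjoin \<alpha>"
      by (intro divide_closed mult_closed diff_closed self_mem_rational_adjoin of_nat_closed Suc)
    finally show ?case .
  qed (simp add: one_closed)
  fix x assume "x \<in> binomial_ring \<alpha>"
  then obtain f where f: "x = poly f \<alpha>" "\<And>n::nat. poly f (of_nat n) \<in> \<int>"
    by (auto simp: binomial_ring_def)
  obtain c :: "nat \<Rightarrow> int" and D where "x = (\<Sum>k\<le>D. of_int (c k) * (\<alpha> gchoose k))"
    using poly_eq_int_sum_gbinomial[OF f(2)] f(1) by metis
  thus "x \<in> rational_adjoin \<alpha>"
    by (simp add: sum_closed mult_closed of_int_closed gb)
qed

lemma gbinomial_of_int_mem_Ints: "((of_int z :: complex) gchoose k) \<in> \<int>"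
proof (cases "z \<ge> 0")
  case True
  thus ?thesis
    using binomial_gbinomial[of "nat z" k, where 'a = complex] by (metis Ints_of_nat of_nat_nat)
next
  case False
  have "(of_int z :: complex) gchoose k = (- 1) ^ k * ((of_nat k - of_int z - 1) gchoose k)"
    by (rule gbinomial_negated_upper)
  also have "of_nat k - of_int z - 1 = (of_nat (nat (int k - z - 1)) :: complex)"
    using False by simp
  finally show ?thesis
    by (simp flip: binomial_gbinomial)
qed

text \<open>Composing with the integer-valued polynomial x gchoose k preserves integrality of
  values; as f(n) may be negative, \<open>gbinomial_of_int_mem_Ints\<close> is the relevant
  fact.\<close>

lemma gbinomial_closed_binomial_ring:
  assumes "x \<in> binomial_ring \<alpha>"
  shows "x gchoose k \<in> binomial_ring \<alpha>"
proof -
  obtain f where f: "x = poly f \<alpha>" "\<And>n::nat. poly f (of_nat n) \<in> \<int>"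
    using assms by (auto simp: binomial_ring_def)
  define g where "g = Polynomial.smult (inverse (fact k)) (\<Prod>i<k. f - [:of_nat i:])"
  have g: "poly g z = poly f z gchoose k" for z
    by (simp add: g_def poly_prod gbinomial_prod_rev lessThan_atLeast0 divide_inverse mult.commute)
  have "poly g (of_nat n) \<in> \<int>" for n
    using f(2)[of n] by (auto elim!: Ints_cases simp: g gbinomial_of_int_mem_Ints)
  from binomial_ringI[OF this, of \<alpha>] show ?thesis
    by (simp add: g f(1))
qed

section \<open>Unramified primes of degree one\<close>

lemma lies_overD: "lies_over P p \<Longrightarrow> of_int n \<in> P \<longleftrightarrow> int p dvd n"
  unfolding lies_over_def by blast

context number_field
begin

definition local_ring :: "complex set \<Rightarrow> complex set" where
  "local_ring P = {x \<in> F. \<exists>s\<in>ints. s \<notin> P \<and> s * x \<in> ints}"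

lemma local_ringI: "x \<in> F \<Longrightarrow> s \<in> ints \<Longrightarrow> s \<notin> P \<Longrightarrow> s * x \<in> ints \<Longrightarrow> x \<in> local_ring P"
  unfolding local_ring_def by blast

lemma ints_subset_local_ring:
  assumes "nonzero_prime P"
  shows "ints \<subseteq> local_ring P"
  using ints_subset ints_one nonzero_primeD(3)[OF assms] by (auto intro!: local_ringI[of _ 1])

lemma local_ring_add_mult:
  assumes P: "nonzero_prime P" and "x \<in> local_ring P" "y \<in> local_ring P"
  shows "x + y \<in> local_ring P" "x * y \<in> local_ring P"
proof -
  obtain s where s: "s \<in> ints" "s \<notin> P" "s * x \<in> ints" "x \<in> F"
    using assms(2) by (auto simp: local_ring_def)
  obtain t where t: "t \<in> ints" "t \<notin> P" "t * y \<in> ints" "y \<in> F"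
    using assms(3) by (auto simp: local_ring_def)
  have st: "s * t \<in> ints" "s * t \<notin> P"
    using ints_mult[OF s(1) t(1)] nonzero_primeD(5)[OF P s(1) t(1)] s(2) t(2) by blast+
  have "t * (s * x) + s * (t * y) \<in> ints"
    by (intro ints_add ints_mult s t)
  thus "x + y \<in> local_ring P"
    using st s(4) t(4) by (intro local_ringI[of _ "s * t"]) (auto simp: algebra_simps add_closed)
  have "(s * x) * (t * y) \<in> ints"
    by (intro ints_mult s t)
  thus "x * y \<in> local_ring P"
    using st s(4) t(4) by (intro local_ringI[of _ "s * t"]) (auto simp: mult_ac mult_closed)
qed

lemma inverse_mem_local_ring:
  assumes "s \<in> ints" "s \<notin> P" "0 \<in> P"
  shows "1 / s \<in> local_ring P"
proof (rule local_ringI[OF _ assms(1,2)])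
  show "1 / s \<in> F"
    using assms(1) ints_subset one_closed by (auto intro: divide_closed)
  have "s \<noteq> 0" using assms by auto
  thus "s * (1 / s) \<in> ints" by (simp add: ints_one)
qed

text \<open>The integers 0, ..., p - 1 give p distinct cosets because P lies over p. So the quotient
  has order p precisely when these cosets exhaust it.\<close>

lemma card_quotient_eq_iff:
  assumes P: "nonzero_prime P" and p: "lies_over P p" "p > 0"
  shows "card (carrier (integer_ring F Quot P)) = p \<longleftrightarrow> (\<forall>x\<in>ints. \<exists>i::int. x - of_int i \<in> P)"
proof -
  let ?R = "integer_ring F"
  note frac = nonzero_primeD(2)[OF P]
  have coset: "P +>\<^bsub>?R\<^esub> x = (\<lambda>h. h + x) ` P" for x
    by (auto simp: a_r_coset_def' integer_ring_simps)
  have coset_eq: "P +>\<^bsub>?R\<^esub> x = P +>\<^bsub>?R\<^esub> y \<longleftrightarrow> x - y \<in> P" for x y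
  proof
    assume "P +>\<^bsub>?R\<^esub> x = P +>\<^bsub>?R\<^esub> y"
    moreover have "0 + x \<in> P +>\<^bsub>?R\<^esub> x"
      unfolding coset using fractional_idealD(2)[OF frac] by blast
    ultimately obtain h where "h \<in> P" "0 + x = h + y"
      unfolding coset by blast
    thus "x - y \<in> P" by simp
  next
    have sub: "P +>\<^bsub>?R\<^esub> x \<subseteq> P +>\<^bsub>?R\<^esub> y" if "x - y \<in> P" for x y
    proof
      fix z assume "z \<in> P +>\<^bsub>?R\<^esub> x"
      then obtain h where h: "h \<in> P" "z = h + x"
        unfolding coset by blast
      have "z = (h + (x - y)) + y"
        using h by simp
      thus "z \<in> P +>\<^bsub>?R\<^esub> y"
        unfolding coset using fractional_idealD(3)[OF frac h(1) that] by blast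
    qed
    assume "x - y \<in> P"
    moreover from this have "y - x \<in> P"
      using fractional_idealD(5)[OF frac, of "x - y"] by simp
    ultimately show "P +>\<^bsub>?R\<^esub> x = P +>\<^bsub>?R\<^esub> y"
      using sub by blast
  qed
  have carr: "carrier (?R Quot P) = (\<lambda>x. P +>\<^bsub>?R\<^esub> x) ` ints"
    by (auto simp: FactRing_def A_RCOSETS_def')
  define f where "f i = P +>\<^bsub>?R\<^esub> of_int i" for i
  have f_eq: "f i = f j \<longleftrightarrow> int p dvd i - j" for i j
    using lies_overD[OF p(1), of "i - j"] by (simp add: f_def coset_eq)
  have "inj_on f {0..<int p}"
  proof (rule inj_onI)
    fix i j assume ij: "i \<in> {0..<int p}" "j \<in> {0..<int p}" "f i = f j"
    hence "[i = j] (mod int p)"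
      by (simp add: f_eq cong_iff_dvd_diff)
    thus "i = j"
      using ij by (simp add: Cong.cong_def)
  qed
  hence card: "card (f ` {0..<int p}) = p"
    by (simp add: card_image)
  have sub: "f ` {0..<int p} \<subseteq> carrier (?R Quot P)"
    using ints_of_int by (auto simp: carr f_def)
  show ?thesis
  proof
    assume c: "card (carrier (?R Quot P)) = p"
    \<comment> \<open>\<open>card\<close> is 0 on infinite sets, so the positive value p entails
      finiteness.\<close>
    hence "finite (carrier (?R Quot P))"
      using p(2) by (metis card_ge_0_finite)
    hence eq: "f ` {0..<int p} = carrier (?R Quot P)"
      using sub c card by (intro card_subset_eq) auto
    show "\<forall>x\<in>ints. \<exists>i::int. x - of_int i \<in> P"
    proof
      fix x assume "x \<in> ints"
      hence "P +>\<^bsub>?R\<^esub> x \<in> f ` {0..<int p}"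
        unfolding eq carr by blast
      thus "\<exists>i::int. x - of_int i \<in> P"
        by (auto simp: f_def coset_eq)
    qed
  next
    assume ex: "\<forall>x\<in>ints. \<exists>i::int. x - of_int i \<in> P"
    have "carrier (?R Quot P) \<subseteq> f ` {0..<int p}"
    proof
      fix c assume "c \<in> carrier (?R Quot P)"
      then obtain x where x: "x \<in> ints" "c = P +>\<^bsub>?R\<^esub> x"
        by (auto simp: carr)
      then obtain i :: int where "x - of_int i \<in> P" using ex by blast
      hence "c = f i"
        by (simp add: x(2) f_def coset_eq)
      also have "\<dots> = f (i mod int p)"
        by (simp add: f_eq minus_mod_eq_mult_div)
      finally show "c \<in> f ` {0..<int p}"
        using p(2) by auto
    qed
    thus "card (carrier (?R Quot P)) = p"
      using sub card by (metis subset_antisym)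
  qed
qed

lemma val_one: "val P 1 = 0"
  using val_mult[of 1 1 P] one_closed by simp

text \<open>With exponent at most 0, the inverse of x would be P-integral: s / x is integral for
  some s outside P, and then s = (s / x) * x lies in P.\<close>

lemma val_pos_if_mem:
  assumes P: "nonzero_prime P" and x: "x \<in> P" "x \<noteq> 0"
  shows "val P x \<ge> 1"
proof (rule ccontr)
  assume "\<not> val P x \<ge> 1"
  note frac = nonzero_primeD(2)[OF P]
  have xF: "x \<in> F"
    using x(1) fractional_idealD(1)[OF frac] by blast
  have "val P (1 / x) \<ge> 0"
    using val_divide[OF one_closed _ xF x(2), of P] val_one \<open>\<not> val P x \<ge> 1\<close> by simp
  then obtain s where s: "s \<in> ints" "s \<notin> P" "s * (1 / x) \<in> ints"
    using val_nonneg_iff[OF divide_closed[OF one_closed xF] _ P] x(2) by auto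
  have "s * (1 / x) * x \<in> P"
    by (rule fractional_idealD(4)[OF frac s(3) x(1)])
  thus False
    using s(2) x(2) by simp
qed

lemma valuation_nonneg_iff_local_ring:
  "x \<in> F \<Longrightarrow> nonzero_prime P \<Longrightarrow> valuation F P x \<ge> 0 \<longleftrightarrow> x \<in> local_ring P"
  by (simp add: valuation_nonneg_iff local_ring_def)

text \<open>Residue degree one supplies integers a and b congruent to s and s * x modulo P; with c
  inverse to a modulo p, x is congruent to c * b. Ramification index one makes every element of P
  divisible by p in the local ring.\<close>

lemma ex_int_cong_local_ring:
  assumes P: "nonzero_prime P" "lies_over P p" "Factorial_Ring.prime p"
    and ram: "val P (of_nat p) = 1" and res: "\<And>x. x \<in> ints \<Longrightarrow> \<exists>i::int. x - of_int i \<in> P"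
    and x: "x \<in> local_ring P"
  shows "\<exists>i::int. \<exists>y\<in>local_ring P. x = of_int i + of_nat p * y"
proof -
  note frac = nonzero_primeD(2)[OF P(1)]
  have p0: "(of_nat p :: complex) \<noteq> 0"
    using P(3) by (simp add: prime_gt_0_nat)
  have div: "z / of_nat p \<in> local_ring P" if z: "z \<in> P" for z
  proof (cases "z = 0")
    case True
    thus ?thesis using ints_subset_local_ring[OF P(1)] ints_zero by auto
  next
    case False
    have zF: "z \<in> F" using z fractional_idealD(1)[OF frac] by blast
    have "val P (z / of_nat p) \<ge> 0"
      using val_divide[OF zF False of_nat_closed p0, of P] val_pos_if_mem[OF P(1) z False] ram by simp
    thus ?thesis
      using val_nonneg_iff[OF divide_closed[OF zF of_nat_closed[of p]] _ P(1)] False p0 zF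
      by (auto simp: local_ring_def divide_closed of_nat_closed)
  qed
  obtain s where s: "s \<in> ints" "s \<notin> P" "s * x \<in> ints"
    using x by (auto simp: local_ring_def)
  obtain a b :: int where a: "s - of_int a \<in> P" and b: "s * x - of_int b \<in> P"
    using res[OF s(1)] res[OF s(3)] by blast
  have "\<not> int p dvd a"
    using fractional_idealD(3)[OF frac a, of "of_int a"] s(2) lies_overD[OF P(2), of a] by auto
  hence "coprime a (int p)"
    using P(3) by (metis coprime_commute prime_imp_coprime prime_nat_int_transfer)
  then obtain c where "[a * c = 1] (mod int p)"
    using cong_solve_coprime_int by blast
  hence "of_int (a * c - 1) \<in> P"
    using lies_overD[OF P(2)] by (simp only: cong_iff_dvd_diff)
  hence ac: "of_int a * of_int c - 1 \<in> P"
    by (simp only: of_int_diff of_int_mult of_int_1)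
  have "s * (x - of_int (c * b)) =
    (s * x - of_int b) - of_int (c * b) * (s - of_int a) - of_int b * (of_int a * of_int c - 1)"
    by (simp add: algebra_simps)
  also have "\<dots> \<in> P"
    by (rule fractional_idealD(6)[OF frac fractional_idealD(6)[OF frac b
        fractional_idealD(4)[OF frac ints_of_int a]] fractional_idealD(4)[OF frac ints_of_int ac]])
  finally have "s * (x - of_int (c * b)) / of_nat p \<in> local_ring P"
    by (rule div)
  hence "1 / s * (s * (x - of_int (c * b)) / of_nat p) \<in> local_ring P"
    by (intro local_ring_add_mult[OF P(1)] inverse_mem_local_ring s fractional_idealD(2)[OF frac])
  moreover have "s \<noteq> 0"
    using s(2) fractional_idealD(2)[OF frac] by auto
  ultimately have "(x - of_int (c * b)) / of_nat p \<in> local_ring P" by simp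
  moreover have "x = of_int (c * b) + of_nat p * ((x - of_int (c * b)) / of_nat p)"
    using p0 by simp
  ultimately show ?thesis by blast
qed

text \<open>Let p ^ n be the exact power of p dividing k!. Replacing x by an integer i congruent to
  it modulo p ^ n changes the falling factorial by a multiple of p ^ n, so division by k! leaves a
  P-integral error. The value i gchoose k is an integer.\<close>

lemma gbinomial_mem_local_ring:
  assumes P: "nonzero_prime P" "lies_over P p" "Factorial_Ring.prime p"
    and ram: "val P (of_nat p) = 1" and res: "\<And>x. x \<in> ints \<Longrightarrow> \<exists>i::int. x - of_int i \<in> P"
    and x: "x \<in> local_ring P"
  shows "x gchoose k \<in> local_ring P"
proof -
  note add = local_ring_add_mult(1)[OF P(1)] and mult = local_ring_add_mult(2)[OF P(1)]
  have int: "of_int i \<in> local_ring P" for i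
    using ints_subset_local_ring[OF P(1)] ints_of_int by blast
  have approx: "\<exists>i::int. \<exists>y\<in>local_ring P. x = of_int i + of_nat p ^ n * y" for n
  proof (induction n)
    case 0
    show ?case using x by (intro exI[of _ 0] bexI[of _ x]) simp_all
  next
    case (Suc n)
    then obtain i :: int and y where y: "y \<in> local_ring P" "x = of_int i + of_nat p ^ n * y" by blast
    obtain j :: int and z where z: "z \<in> local_ring P" "y = of_int j + of_nat p * z"
      using ex_int_cong_local_ring[OF P ram res y(1)] by blast
    have "x = of_int (i + int p ^ n * j) + of_nat p ^ Suc n * z"
      by (simp add: y(2) z(2) algebra_simps)
    thus ?case using z(1) by blast
  qed
  define n where "n = multiplicity p (fact k :: nat)"
  obtain m where m: "fact k = p ^ n * m" "\<not> p dvd m"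
    using multiplicity_decompose'[of "fact k :: nat" p] P(3) unfolding n_def
    by (metis fact_nonzero not_prime_unit)
  obtain i :: int and y where y: "y \<in> local_ring P" "x = of_int i + of_nat p ^ n * y"
    using approx by blast
  have prod: "\<exists>z\<in>local_ring P. (\<Prod>j<l. x - of_nat j) = (\<Prod>j<l. of_int i - of_nat j) + of_nat p ^ n * z" for l
  proof (induction l)
    case 0
    show ?case using int[of 0] by (intro bexI[of _ 0]) simp_all
  next
    case (Suc l)
    then obtain z where z: "z \<in> local_ring P"
      "(\<Prod>j<l. x - of_nat j) = (\<Prod>j<l. of_int i - of_nat j) + of_nat p ^ n * z" by blast
    let ?w = "of_int (\<Prod>j<l. i - int j) * y + z * (x + of_int (- int l))"
    have "?w \<in> local_ring P"
      by (intro add mult int y z x)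
    moreover have "(\<Prod>j<Suc l. x - of_nat j) = (\<Prod>j<Suc l. of_int i - of_nat j) + of_nat p ^ n * ?w"
      by (simp add: z(2)) (simp add: y(2) algebra_simps)
    ultimately show ?case by blast
  qed
  obtain z where z: "z \<in> local_ring P"
    "(\<Prod>j<k. x - of_nat j) = (\<Prod>j<k. of_int i - of_nat j) + of_nat p ^ n * z"
    using prod by blast
  have "(of_nat m :: complex) \<notin> P"
    using lies_overD[OF P(2), of "int m"] m(2) by simp
  hence m_inv: "1 / of_nat m \<in> local_ring P"
    by (intro inverse_mem_local_ring ints_of_nat fractional_idealD(2)[OF nonzero_primeD(2)[OF P(1)]])
  obtain b where b: "(of_int i :: complex) gchoose k = of_int b"
    using gbinomial_of_int_mem_Ints[of i k] by (auto elim: Ints_cases)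
  have fact: "(fact k :: complex) = of_nat p ^ n * of_nat m"
    using arg_cong[OF m(1), of "of_nat :: nat \<Rightarrow> complex"] by simp
  have p0: "(of_nat p :: complex) \<noteq> 0"
    using P(3) by (simp add: prime_gt_0_nat)
  have "x gchoose k = (of_int i gchoose k) + of_nat p ^ n * z / fact k"
    by (simp add: gbinomial_prod_rev z(2) add_divide_distrib flip: lessThan_atLeast0)
  also have "\<dots> = of_int b + z * (1 / of_nat m)"
    using p0 by (simp add: b fact)
  also have "\<dots> \<in> local_ring P"
    by (intro add mult int z m_inv)
  finally show ?thesis .
qed

end

lemma R_plus_valuation_nonneg:
  assumes "algebraic \<alpha>" "x \<in> R_plus \<alpha>" "Factorial_Ring.prime p" "P \<in> unramified_degree_one_primes \<alpha> p"
  shows "valuation (rational_adjoin \<alpha>) P x \<ge> 0"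
proof -
  let ?F = "rational_adjoin \<alpha>"
  interpret number_field ?F by (rule number_field_rational_adjoin[OF assms(1)])
  have P: "primeideal P (integer_ring ?F)" "lies_over P p" "ramification_index ?F P p = 1"
      "card (carrier (integer_ring ?F Quot P)) = p" "valuation ?F P \<alpha> \<ge> 0"
    using assms(4) by (auto simp: unramified_degree_one_primes_def Let_def)
  have p: "p > 0" using assms(3) by (rule prime_gt_0_nat)
  \<comment> \<open>Lying over p is what makes P nonzero, as the theory of prime factorization
    requires.\<close>
  have "of_nat p \<in> P"
    using lies_overD[OF P(2), of "int p"] by simp
  hence prime: "nonzero_prime P"
    using P(1) p by auto
  have \<alpha>: "\<alpha> \<in> local_ring P"
    using P(5) valuation_nonneg_iff_local_ring[OF self_mem_rational_adjoin prime] by simp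
  have gb: "\<alpha> gchoose k \<in> local_ring P" for k
  proof (rule gbinomial_mem_local_ring[OF prime P(2) assms(3) _ _ \<alpha>])
    show "val P (of_nat p) = 1"
      using P(3) by (simp add: ramification_index_def)
    show "\<exists>i::int. x - of_int i \<in> P" if "x \<in> ints" for x
      using card_quotient_eq_iff[OF prime P(2) p] P(4) that by blast
  qed
  obtain a n where a: "x = (\<Sum>k\<le>n. of_nat (a k :: nat) * (\<alpha> gchoose k))"
    using assms(2) by (auto simp: R_plus_iff)
  have "(\<Sum>k\<le>m. of_nat (a k :: nat) * (\<alpha> gchoose k)) \<in> local_ring P" for m
    using ints_subset_local_ring[OF prime] ints_of_nat
    by (induction m) (auto intro!: local_ring_add_mult[OF prime] gb)
  hence x: "x \<in> local_ring P" by (simp add: a)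
  thus ?thesis
    using valuation_nonneg_iff_local_ring[OF _ prime] by (auto simp: local_ring_def)
qed

section \<open>Maximal ideals of the binomial ring\<close>

text \<open>Maximality is stated as invertibility modulo M, the form from which primality of M
  follows directly; \<open>p_mult\<close> says that M contains p R.\<close>

locale binomial_ring_maximal_ideal =
  fixes \<alpha> :: complex and p :: nat and M :: "complex set"
  assumes algebraic: "algebraic \<alpha>" and prime: "Factorial_Ring.prime p"
    and M_subset: "M \<subseteq> binomial_ring \<alpha>"
    and M_add: "x \<in> M \<Longrightarrow> y \<in> M \<Longrightarrow> x + y \<in> M"
    and M_mult: "a \<in> binomial_ring \<alpha> \<Longrightarrow> x \<in> M \<Longrightarrow> a * x \<in> M"
    and one_notin_M: "1 \<notin> M"
    and p_mult: "x \<in> binomial_ring \<alpha> \<Longrightarrow> of_nat p * x \<in> M"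
    and M_maximal: "x \<in> binomial_ring \<alpha> \<Longrightarrow> x \<notin> M \<Longrightarrow> \<exists>m\<in>M. \<exists>r\<in>binomial_ring \<alpha>. m + r * x = 1"
begin

sublocale number_field "rational_adjoin \<alpha>"
  by (rule number_field_rational_adjoin[OF algebraic])

abbreviation K :: "complex set" where "K \<equiv> rational_adjoin \<alpha>"
abbreviation R :: "complex set" where "R \<equiv> binomial_ring \<alpha>"

lemmas R_closed = add_mem_binomial_ring mult_mem_binomial_ring diff_mem_binomial_ring
  power_mem_binomial_ring of_int_mem_binomial_ring one_mem_binomial_ring

lemma R_of_nat: "of_nat n \<in> R"
  using of_int_mem_binomial_ring[of "int n" \<alpha>] by simp

lemma p_nonzero: "(of_nat p :: complex) \<noteq> 0"
  using prime by (simp add: prime_gt_0_nat)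

lemma M_zero: "0 \<in> M"
  using p_mult[OF zero_mem_binomial_ring] by simp

lemma M_uminus: "x \<in> M \<Longrightarrow> - x \<in> M"
  using M_mult[OF of_int_mem_binomial_ring[of "-1"], of x] by simp

lemma M_prime:
  assumes "x \<in> R" "y \<in> R" "x * y \<in> M"
  shows "x \<in> M \<or> y \<in> M"
proof (rule disjCI)
  assume "y \<notin> M"
  then obtain m r where m: "m \<in> M" "r \<in> R" "m + r * y = 1"
    using M_maximal[OF assms(2)] by blast
  have "x = x * (m + r * y)"
    by (simp add: m(3))
  also have "\<dots> = x * m + r * (x * y)"
    by (simp add: algebra_simps)
  also have "\<dots> \<in> M"
    by (intro M_add M_mult assms m)
  finally show "x \<in> M" .
qed

lemma of_int_mem_M_iff: "of_int n \<in> M \<longleftrightarrow> int p dvd n"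
proof
  assume n: "of_int n \<in> M"
  show "int p dvd n"
  proof (rule ccontr)
    assume "\<not> int p dvd n"
    hence "coprime n (int p)"
      using prime by (metis coprime_commute prime_imp_coprime prime_nat_int_transfer)
    then obtain c where "[n * c = 1] (mod int p)"
      using cong_solve_coprime_int by blast
    then obtain k where k: "n * c - 1 = int p * k"
      by (auto simp: cong_iff_dvd_diff elim: dvdE)
    have "(1::complex) = of_int c * of_int n + - (of_nat p * of_int k)"
      using arg_cong[OF k, of "of_int :: int \<Rightarrow> complex"] by (simp add: algebra_simps)
    also have "\<dots> \<in> M"
      by (intro M_add M_mult M_uminus p_mult n R_closed)
    finally show False using one_notin_M by simp
  qed
next
  assume "int p dvd n"
  then obtain k where "n = int p * k" by blast
  thus "of_int n \<in> M"
    using p_mult[OF of_int_mem_binomial_ring[of k]] by simp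
qed

lemma of_nat_notin_M: "\<not> p dvd n \<Longrightarrow> of_nat n \<notin> M"
  using of_int_mem_M_iff[of "int n"] by simp

text \<open>The product \<open>x (x - 1) \<dots> (x - p + 1) = p! * (x gchoose p)\<close> lies in \<open>M\<close>.\<close>

lemma ex_int_cong_M:
  assumes x: "x \<in> R"
  obtains i :: int where "x - of_int i \<in> M"
proof -
  have *: "\<exists>i::int. x - of_int i \<in> M" if "(\<Prod>i<n. x - of_nat i) \<in> M" for n
    using that
  proof (induction n)
    case 0
    thus ?case using one_notin_M by simp
  next
    case (Suc n)
    have "(\<Prod>i<n. x - of_nat i) \<in> R"
    proof (induction n)
      case (Suc n)
      thus ?case by (simp add: R_closed R_of_nat x)
    qed (simp add: one_mem_binomial_ring)
    hence "(\<Prod>i<n. x - of_nat i) \<in> M \<or> x - of_nat n \<in> M"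
      using Suc.prems by (intro M_prime) (simp_all add: R_closed R_of_nat x)
    thus ?case
    proof
      assume "x - of_nat n \<in> M"
      thus ?case by (intro exI[of _ "int n"]) simp
    qed (rule Suc.IH)
  qed
  have "(\<Prod>i<p. x - of_nat i) = fact p * (x gchoose p)"
    by (simp add: gbinomial_mult_fact lessThan_atLeast0)
  also have "fact p = of_nat p * (of_nat (fact (p - 1)) :: complex)"
    using prime by (subst fact_reduce) (simp_all add: prime_gt_0_nat)
  also have "\<dots> * (x gchoose p) = of_nat p * (of_nat (fact (p - 1)) * (x gchoose p))"
    by simp
  also have "\<dots> \<in> M"
    by (intro p_mult R_closed R_of_nat gbinomial_closed_binomial_ring x)
  finally show ?thesis
    using * that by blast
qed

section \<open>The localization \<open>W\<close> of the binomial ring at \<open>M\<close>, a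
  discrete valuation ring with uniformizer p\<close>

definition W :: "complex set" where
  "W = {x. \<exists>s\<in>R. s \<notin> M \<and> s * x \<in> R}"

lemma WI: "s \<in> R \<Longrightarrow> s \<notin> M \<Longrightarrow> s * x \<in> R \<Longrightarrow> x \<in> W"
  unfolding W_def by blast

lemma WE:
  assumes "x \<in> W"
  obtains s where "s \<in> R" "s \<notin> M" "s * x \<in> R"
  using assms unfolding W_def by blast

lemma R_subset_W: "R \<subseteq> W"
  using one_notin_M by (auto intro!: WI[of 1] R_closed)

lemma W_add_mult:
  assumes "x \<in> W" "y \<in> W"
  shows "x + y \<in> W" "x * y \<in> W"
proof -
  obtain s where s: "s \<in> R" "s \<notin> M" "s * x \<in> R" using WE[OF assms(1)] .
  obtain t where t: "t \<in> R" "t \<notin> M" "t * y \<in> R" using WE[OF assms(2)] .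
  have st: "s * t \<in> R" "s * t \<notin> M"
    using M_prime[OF s(1) t(1)] s t by (auto intro: R_closed)
  have "t * (s * x) + s * (t * y) \<in> R" "(s * x) * (t * y) \<in> R"
    using s t by (auto intro!: R_closed)
  thus "x + y \<in> W" "x * y \<in> W"
    by (auto intro!: WI[OF st] simp: algebra_simps)
qed

lemma W_of_int: "of_int i \<in> W"
  using R_subset_W of_int_mem_binomial_ring by blast

lemma W_uminus: "x \<in> W \<Longrightarrow> - x \<in> W"
  using W_add_mult(2)[OF W_of_int[of "-1"], of x] by simp

lemma W_power: "x \<in> W \<Longrightarrow> x ^ n \<in> W"
  by (induction n) (use W_of_int[of 1] in \<open>simp_all add: W_add_mult\<close>)

lemma W_sum: "(\<And>i. i \<in> A \<Longrightarrow> f i \<in> W) \<Longrightarrow> sum f A \<in> W"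
  by (induction A rule: infinite_finite_induct) (use W_of_int[of 0] in \<open>simp_all add: W_add_mult\<close>)

lemma inverse_mem_W: "s \<in> R \<Longrightarrow> s \<notin> M \<Longrightarrow> 1 / s \<in> W"
  using M_zero by (intro WI[of s]) (auto simp: one_mem_binomial_ring)

lemma inverse_p_notin_W: "1 / of_nat p \<notin> W"
proof
  assume "1 / of_nat p \<in> W"
  then obtain s where s: "s \<in> R" "s \<notin> M" "s * (1 / of_nat p) \<in> R" by (rule WE)
  have "of_nat p * (s * (1 / of_nat p)) \<in> M"
    by (rule p_mult[OF s(3)])
  thus False using s(2) p_nonzero by simp
qed

text \<open>The Frobenius identity makes \<open>p\<close> a uniformizer: \<open>m\<close> times the unit \<open>1 - m ^ (p - 1)\<close> of \<open>W\<close> is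
  divisible by \<open>p\<close>.\<close>

lemma divide_p_mem_W:
  assumes m: "m \<in> M"
  shows "m / of_nat p \<in> W"
proof -
  have p: "p \<ge> 2" using prime by (rule prime_ge_2_nat)
  have mR: "m \<in> R" using m M_subset by blast
  define s where "s = 1 - m ^ (p - 1)"
  have "m ^ (p - 2) * m \<in> M"
    by (intro M_mult m R_closed mR)
  moreover have "m ^ (p - 2) * m = m ^ (p - 1)"
    using p by (simp flip: power_Suc2 add: Suc_diff_Suc numeral_2_eq_2)
  ultimately have "m ^ (p - 1) \<in> M" by simp
  hence "s \<notin> M"
    using M_add[of s "m ^ (p - 1)"] one_notin_M by (auto simp: s_def)
  moreover have "s \<in> R"
    unfolding s_def by (intro R_closed mR)
  moreover have "s * (m / of_nat p) = - ((m ^ p - m) / of_nat p)"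
  proof -
    have "m ^ (p - 1) * m = m ^ p"
      using p by (simp flip: power_Suc2)
    thus ?thesis by (simp add: s_def left_diff_distrib diff_divide_distrib)
  qed
  moreover have "- ((m ^ p - m) / of_nat p) \<in> R"
    by (intro minus_mem_binomial_ring frobenius_mem_binomial_ring prime mR)
  ultimately show ?thesis
    by (intro WI[of s]) simp_all
qed

text \<open>With s * x in the binomial ring and s outside M, either s * x is in M, hence divisible
  by p in \<open>W\<close>, or it is outside M, hence invertible there.\<close>

lemma W_unit_or_divisible:
  assumes "x \<in> W"
  shows "1 / x \<in> W \<or> x / of_nat p \<in> W"
proof -
  obtain s where s: "s \<in> R" "s \<notin> M" "s * x \<in> R" using WE[OF assms] .
  have s0: "s \<noteq> 0" using s(2) M_zero by auto
  show ?thesis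
  proof (cases "s * x \<in> M")
    case True
    have "1 / s * (s * x / of_nat p) \<in> W"
      by (intro W_add_mult inverse_mem_W s divide_p_mem_W True)
    thus ?thesis using s0 by simp
  next
    case False
    have "s * (1 / (s * x)) \<in> W"
      using s(1) R_subset_W by (intro W_add_mult inverse_mem_W s False) blast
    thus ?thesis using s0 by simp
  qed
qed

lemma W_unit_not_divisible:
  assumes "1 / x \<in> W" "x / of_nat p \<in> W" "x \<noteq> 0"
  shows False
  using W_add_mult(2)[OF assms(1,2)] assms(3) inverse_p_notin_W by simp

text \<open>Division by p must stop at a unit: some positive d has d / x in the binomial ring, and
  if p divides d exactly n times, divisibility of x by p ^ (n + 1) would give d / p ^ (n + 1) in
  \<open>W\<close> and hence 1 / p in \<open>W\<close>.\<close>

lemma W_eq_power_times_unit: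
  assumes x: "x \<in> W" "x \<in> K" "x \<noteq> 0"
  obtains n where "x / of_nat p ^ n \<in> W" "of_nat p ^ n / x \<in> W"
proof (rule ccontr)
  assume contra: "\<not> thesis"
  have all: "x / of_nat p ^ n \<in> W" for n
  proof (induction n)
    case (Suc n)
    hence "1 / (x / of_nat p ^ n) \<notin> W"
      using contra that[of n] by auto
    hence "x / of_nat p ^ n / of_nat p \<in> W"
      using W_unit_or_divisible[OF Suc] by blast
    thus ?case by (simp add: mult.commute)
  qed (use x in simp)
  obtain d where d: "d > 0" "of_nat d * (1 / x) \<in> R"
    using ex_of_nat_mult_mem_binomial_ring[OF algebraic divide_closed[OF one_closed x(2)]] .
  obtain a where a: "d = p ^ multiplicity p d * a" "\<not> p dvd a"
    using multiplicity_decompose'[of d p] d(1) prime by (metis gr_implies_not0 not_prime_unit)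
  define n where "n = multiplicity p d"
  have "of_nat d * (1 / x) * (x / of_nat p ^ Suc n) \<in> W"
    using d(2) R_subset_W by (intro W_add_mult(2)[OF _ all]) blast
  also have "of_nat d * (1 / x) * (x / of_nat p ^ Suc n) = of_nat d / of_nat p ^ Suc n"
    using x(3) by simp
  also have "of_nat d = (of_nat p ^ n * of_nat a :: complex)"
    by (subst a(1)) (simp add: n_def)
  also have "\<dots> / of_nat p ^ Suc n = of_nat a / of_nat p"
    using p_nonzero by simp
  finally have "of_nat a / of_nat p \<in> W" .
  moreover have "1 / of_nat a \<in> W"
    by (intro inverse_mem_W R_of_nat of_nat_notin_M a)
  moreover have "(of_nat a :: complex) \<noteq> 0"
    using a(2) by (cases "a = 0") auto
  ultimately show False
    using W_unit_not_divisible by blast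
qed

text \<open>Write z = (d * z) / d and compare the exponents n and m of p in numerator and
  denominator. If n < m, the strict inequality leaves an extra factor p in 1 / z.\<close>

lemma mem_W_or_inverse_divisible:
  assumes z: "z \<in> K" "z \<noteq> 0"
  shows "z \<in> W \<or> 1 / z / of_nat p \<in> W"
proof -
  obtain d where d: "d > 0" "of_nat d * z \<in> R"
    using ex_of_nat_mult_mem_binomial_ring[OF algebraic z(1)] .
  have dz: "of_nat d * z \<in> W" "of_nat d * z \<in> K" "of_nat d * z \<noteq> 0"
    using d z R_subset_W by (auto intro!: mult_closed of_nat_closed)
  have dW: "of_nat d \<in> W" "of_nat d \<in> K" "(of_nat d :: complex) \<noteq> 0"
    using d R_subset_W R_of_nat by (auto intro!: of_nat_closed)
  obtain n where n: "of_nat d * z / of_nat p ^ n \<in> W" "of_nat p ^ n / (of_nat d * z) \<in> W"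
    using W_eq_power_times_unit[OF dz] .
  obtain m where m: "of_nat d / of_nat p ^ m \<in> W" "of_nat p ^ m / of_nat d \<in> W"
    using W_eq_power_times_unit[OF dW] .
  have pW: "of_nat p ^ k \<in> W" for k
    using W_power[OF W_of_int[of "int p"]] by simp
  show ?thesis
  proof (cases "n \<ge> m")
    case True
    have "of_nat p ^ (n - m) * (of_nat d * z / of_nat p ^ n * (of_nat p ^ m / of_nat d)) \<in> W"
      by (intro W_add_mult n m pW)
    also have "of_nat p ^ (n - m) * (of_nat d * z / of_nat p ^ n * (of_nat p ^ m / of_nat d)) = z"
      using dW(3) p_nonzero by (simp add: power_diff[OF p_nonzero True])
    finally show ?thesis ..
  next
    case False
    hence m_eq: "m = n + Suc (m - n - 1)" by simp
    define k where "k = m - n - 1"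
    have "of_nat p ^ k * (of_nat p ^ n / (of_nat d * z) * (of_nat d / of_nat p ^ m)) \<in> W"
      by (intro W_add_mult n m pW)
    also have "of_nat p ^ k * (of_nat p ^ n / (of_nat d * z) * (of_nat d / of_nat p ^ m)) = 1 / z / of_nat p"
      using dW(3) p_nonzero z(2) by (subst m_eq, fold k_def) (simp add: power_add field_simps)
    finally have "1 / z / of_nat p \<in> W" .
    thus ?thesis ..
  qed
qed

text \<open>A valuation ring is integrally closed: for z outside \<open>W\<close> the inverse w lies
  in p * \<open>W\<close>, and the monic equation of z multiplied by w ^ n would express 1 as an
  element of p * \<open>W\<close>.\<close>

lemma ints_subset_W: "ints \<subseteq> W"
proof
  fix z assume z: "z \<in> ints"
  show "z \<in> W"
  proof (rule ccontr)
    assume notin: "z \<notin> W"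
    have z0: "z \<noteq> 0"
      using notin W_of_int[of 0] by auto
    define w where "w = 1 / z"
    have zw: "z * w = 1" using z0 by (simp add: w_def)
    have wp: "w / of_nat p \<in> W"
      using mem_W_or_inverse_divisible[of z] z ints_subset z0 notin by (auto simp: w_def)
    have "of_int (int p) * (w / of_nat p) \<in> W"
      by (intro W_add_mult W_of_int wp)
    hence w: "w \<in> W"
      using p_nonzero by simp
    obtain q :: "int poly" where q: "poly (map_poly of_int q) z = 0" "lead_coeff q = 1"
      using z by (auto simp: ints_iff algebraic_int_altdef_ipoly)
    define n where "n = Polynomial.degree q"
    have "0 = (\<Sum>i\<le>n. of_int (coeff q i) * z ^ i)"
      using q by (simp add: poly_altdef degree_map_poly coeff_map_poly n_def)
    also have "\<dots> = (\<Sum>i<n. of_int (coeff q i) * z ^ i) + z ^ n"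
      using q(2) by (simp add: lessThan_Suc_atMost[symmetric] n_def)
    finally have eq: "z ^ n = - (\<Sum>i<n. of_int (coeff q i) * z ^ i)"
      by (simp add: eq_neg_iff_add_eq_0 add.commute)
    have "1 = z ^ n * w ^ n"
      by (simp add: zw flip: power_mult_distrib)
    also have "\<dots> = - (\<Sum>i<n. of_int (coeff q i) * w ^ (n - i - 1) * w)"
    proof -
      have "z ^ i * w ^ n = w ^ (n - i - 1) * w" if "i < n" for i
      proof -
        have "w ^ n = w ^ (i + (n - i - 1 + 1))"
          using that by simp
        hence "w ^ n = w ^ i * (w ^ (n - i - 1) * w)"
          by (simp only: power_add power_one_right)
        thus ?thesis
          by (simp add: zw flip: mult.assoc power_mult_distrib)
      qed
      thus ?thesis
        by (simp add: eq sum_distrib_right mult.assoc)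
    qed
    finally have "1 = - (\<Sum>i<n. of_int (coeff q i) * w ^ (n - i - 1) * w)" .
    hence "1 / of_nat p = - (\<Sum>i<n. of_int (coeff q i) * w ^ (n - i - 1) * w) / of_nat p"
      by (rule arg_cong)
    also have "\<dots> = - (\<Sum>i<n. of_int (coeff q i) * w ^ (n - i - 1) * (w / of_nat p))"
      by (simp add: sum_divide_distrib)
    also have "\<dots> \<in> W"
      by (intro W_uminus W_sum W_add_mult W_of_int W_power w wp)
    finally show False
      using inverse_p_notin_W by simp
  qed
qed

text \<open>The contraction to the ring of integers of the maximal ideal p *
  \<open>W\<close>.\<close>

definition P :: "complex set" where
  "P = {z \<in> ints. z / of_nat p \<in> W}"

lemma unit_if_notin_P:
  assumes "z \<in> ints" "z \<notin> P"
  shows "1 / z \<in> W"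
  using assms W_unit_or_divisible[of z] ints_subset_W by (auto simp: P_def)

lemma nonzero_prime_P: "nonzero_prime P"
proof (rule nonzero_primeI)
  show sub: "P \<subseteq> ints" by (auto simp: P_def)
  have one: "1 \<notin> P" using inverse_p_notin_W by (simp add: P_def)
  thus "P \<noteq> ints" using ints_one by auto
  show "fractional_ideal (rational_adjoin \<alpha>) P"
  proof (rule fractional_ideal_if_integral[OF sub])
    show "0 \<in> P" using ints_zero W_of_int[of 0] by (simp add: P_def)
    show "of_nat p \<in> P" using ints_of_nat W_of_int[of 1] p_nonzero by (simp add: P_def)
    show "(of_nat p :: complex) \<noteq> 0" by (rule p_nonzero)
  next
    fix x y assume "x \<in> P" "y \<in> P"
    thus "x + y \<in> P"
      by (simp add: P_def ints_add W_add_mult add_divide_distrib)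
  next
    fix a x assume "a \<in> ints" "x \<in> P"
    hence a: "a \<in> ints" "a \<in> W" and x: "x \<in> ints" "x / of_nat p \<in> W"
      using ints_subset_W by (auto simp: P_def)
    show "a * x \<in> P"
      using ints_mult[OF a(1) x(1)] W_add_mult(2)[OF a(2) x(2)] by (simp add: P_def)
  qed
  fix a b assume ab: "a \<in> ints" "b \<in> ints" "a * b \<in> P"
  show "a \<in> P \<or> b \<in> P"
  proof (rule ccontr)
    assume notin: "\<not> (a \<in> P \<or> b \<in> P)"
    hence "1 / a * (1 / b) \<in> W"
      using unit_if_notin_P[of a] unit_if_notin_P[of b] ab(1,2) by (intro W_add_mult(2)) auto
    moreover have "a \<noteq> 0" "b \<noteq> 0"
      using notin ints_zero W_of_int[of 0] by (auto simp: P_def)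
    moreover have "a * b / of_nat p \<in> W"
      using ab(3) by (simp add: P_def)
    ultimately show False
      using W_unit_not_divisible[of "a * b"] by simp
  qed
qed

lemma lies_over_P: "lies_over P p"
proof -
  have "of_int n \<in> P \<longleftrightarrow> int p dvd n" for n
  proof
    assume n: "of_int n \<in> P"
    show "int p dvd n"
    proof (rule ccontr)
      assume "\<not> int p dvd n"
      hence "1 / of_int n \<in> W"
        by (intro inverse_mem_W of_int_mem_binomial_ring) (simp add: of_int_mem_M_iff)
      moreover have "n \<noteq> 0"
        using \<open>\<not> int p dvd n\<close> by auto
      ultimately show False
        using W_unit_not_divisible[of "of_int n"] n by (simp add: P_def)
    qed
  next
    assume "int p dvd n"
    then obtain k where "n = int p * k" by blast
    thus "of_int n \<in> P"
      using p_nonzero W_of_int[of k] ints_of_int[of n] by (simp add: P_def)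
  qed
  thus ?thesis
    by (simp add: lies_over_def)
qed

text \<open>Integral elements outside P are units of \<open>W\<close>, so the local ring of P is
  contained in \<open>W\<close>.\<close>

lemma mem_W_if_valuation_nonneg:
  assumes "x \<in> K" "valuation K P x \<ge> 0"
  shows "x \<in> W"
proof -
  obtain s where s: "s \<in> ints" "s \<notin> P" "s * x \<in> ints"
    using assms valuation_nonneg_iff[OF _ nonzero_prime_P] by blast
  have "1 / s * (s * x) \<in> W"
    using s(3) ints_subset_W by (intro W_add_mult(2)[OF unit_if_notin_P[OF s(1,2)]]) blast
  moreover have "s \<noteq> 0"
    using s(2) fractional_idealD(2)[OF nonzero_primeD(2)[OF nonzero_prime_P]] by auto
  ultimately show ?thesis by simp
qed

text \<open>An exponent of at least 2 would put s * p into the square of P, hence into p^2 *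
  \<open>W\<close>, for some s outside P. Then s lies in p * \<open>W\<close>, which means s is in
  P.\<close>

lemma val_p: "val P (of_nat p) = 1"
proof (rule antisym)
  note frac = nonzero_primeD(2)[OF nonzero_prime_P]
  have "of_nat p \<in> P"
    using lies_overD[OF lies_over_P, of "int p"] by simp
  thus "val P (of_nat p) \<ge> 1"
    by (rule val_pos_if_mem[OF nonzero_prime_P _ p_nonzero])
  show "val P (of_nat p) \<le> 1"
  proof (rule ccontr)
    assume "\<not> val P (of_nat p) \<le> 1"
    \<comment> \<open>The exponent is kept as k + (1 + 1) so that \<open>ideal_power_add\<close>
      splits off two copies of P.\<close>
    then obtain k where k: "k \<ge> 0" "val P (of_nat p) = k + (1 + 1)"
      by (intro that[of "val P (of_nat p) - 2"]) simp_all
    obtain s where s: "s \<in> ints" "s \<notin> P" "s * of_nat p \<in> ideal_power P (k + (1 + 1))"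
      using ex_mult_mem_ideal_power[OF of_nat_closed p_nonzero nonzero_prime_P] unfolding k(2) by blast
    have PP: "ideal_prod complex_ring P P \<subseteq> {x. x / of_nat p ^ 2 \<in> W}"
    proof (rule ideal_prod_complex_subset)
      fix x y assume "x \<in> P" "y \<in> P"
      hence "x / of_nat p * (y / of_nat p) \<in> W"
        by (intro W_add_mult) (auto simp: P_def)
      thus "x * y \<in> {x. x / of_nat p ^ 2 \<in> W}"
        by (simp add: power2_eq_square)
    qed (auto simp: add_divide_distrib W_add_mult)
    have "ideal_power P (k + (1 + 1)) = ideal_prod complex_ring (ideal_power P k) (ideal_prod complex_ring P P)"
      by (simp only: ideal_power_add[OF frac] ideal_power_1[OF frac])
    also have "\<dots> \<subseteq> ideal_prod complex_ring ints (ideal_prod complex_ring P P)"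
      by (intro ideal_prod_complex_mono ideal_power_subset_ints frac k(1) nonzero_primeD(1)[OF nonzero_prime_P] order_refl)
    also have "\<dots> = ideal_prod complex_ring P P"
      by (rule ints_ideal_prod[OF fractional_ideal_prod[OF frac frac]])
    finally have "s * of_nat p / of_nat p ^ 2 \<in> W"
      using s(3) PP by blast
    hence "s \<in> P"
      using s(1) p_nonzero by (simp add: P_def power2_eq_square)
    thus False using s(2) by blast
  qed
qed

text \<open>With x = (s * x) / s, both numerator and denominator are congruent to integers modulo M;
  the error of the resulting integer approximation lies in M after multiplication by s, hence in p *
  \<open>W\<close>.\<close>

lemma ex_int_cong_P:
  assumes "x \<in> ints"
  shows "\<exists>i::int. x - of_int i \<in> P"
proof -
  obtain s where s: "s \<in> R" "s \<notin> M" "s * x \<in> R"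
    using WE assms ints_subset_W by blast
  obtain a :: int where a: "s - of_int a \<in> M" using ex_int_cong_M[OF s(1)] .
  obtain b :: int where b: "s * x - of_int b \<in> M" using ex_int_cong_M[OF s(3)] .
  have "\<not> int p dvd a"
    using M_add[OF a, of "of_int a"] s(2) of_int_mem_M_iff[of a] by auto
  hence "coprime a (int p)"
    using prime by (metis coprime_commute prime_imp_coprime prime_nat_int_transfer)
  then obtain c where "[a * c = 1] (mod int p)"
    using cong_solve_coprime_int by blast
  hence "of_int (a * c - 1) \<in> M"
    by (simp only: of_int_mem_M_iff cong_iff_dvd_diff)
  hence ac: "of_int a * of_int c - 1 \<in> M"
    by (simp only: of_int_diff of_int_mult of_int_1)
  have "s * (x - of_int (c * b)) =
    (s * x - of_int b) + (- (of_int (c * b) * (s - of_int a)) + - (of_int b * (of_int a * of_int c - 1)))"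
    by (simp add: algebra_simps)
  also have "\<dots> \<in> M"
    by (intro M_add[OF b] M_add M_uminus M_mult[OF _ a] M_mult[OF _ ac] of_int_mem_binomial_ring)
  finally have "1 / s * (s * (x - of_int (c * b)) / of_nat p) \<in> W"
    by (intro W_add_mult inverse_mem_W divide_p_mem_W s)
  moreover have "s \<noteq> 0" using s(2) M_zero by auto
  ultimately have "(x - of_int (c * b)) / of_nat p \<in> W" by simp
  hence "x - of_int (c * b) \<in> P"
    using ints_diff[OF assms ints_of_int, of "c * b"] by (simp add: P_def)
  thus ?thesis by blast
qed

text \<open>If \<alpha> had negative exponent, 1 / (p * \<alpha>) would have exponent at least 0,
  since p has exponent 1, and so lie in \<open>W\<close>. Multiplication by \<alpha> would then put
  1 / p into \<open>W\<close>.\<close>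

lemma valuation_self_nonneg: "valuation K P \<alpha> \<ge> 0"
proof (rule ccontr)
  assume neg: "\<not> valuation K P \<alpha> \<ge> 0"
  have \<alpha>: "\<alpha> \<in> K" "\<alpha> \<noteq> 0"
    using neg self_mem_rational_adjoin by (auto simp: valuation_def)
  have "val P \<alpha> < 0"
    using neg \<alpha>(2) by (simp add: valuation_def zero_extended_def)
  moreover have "of_nat p * \<alpha> \<in> K" "of_nat p * \<alpha> \<noteq> 0"
    using \<alpha> p_nonzero by (auto intro: mult_closed of_nat_closed)
  ultimately have "val P (1 / (of_nat p * \<alpha>)) \<ge> 0"
    using val_divide[OF one_closed one_neq_zero, of "of_nat p * \<alpha>" P] val_one val_p
      val_mult[OF of_nat_closed p_nonzero \<alpha>, of P] by simp
  hence "valuation K P (1 / (of_nat p * \<alpha>)) \<ge> 0"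
    by (simp add: valuation_def zero_extended_def)
  hence "1 / (of_nat p * \<alpha>) \<in> W"
    using \<open>of_nat p * \<alpha> \<in> K\<close> by (intro mem_W_if_valuation_nonneg divide_closed one_closed)
  moreover have "\<alpha> \<in> W"
    using self_mem_binomial_ring R_subset_W by blast
  ultimately have "1 / (of_nat p * \<alpha>) * \<alpha> \<in> W"
    by (rule W_add_mult(2))
  thus False
    using \<alpha>(2) inverse_p_notin_W by simp
qed

lemma P_mem: "P \<in> unramified_degree_one_primes \<alpha> p"
  unfolding unramified_degree_one_primes_def Let_def
  using nonzero_prime_P lies_over_P val_p valuation_self_nonneg ex_int_cong_P
    card_quotient_eq_iff[OF nonzero_prime_P lies_over_P prime_gt_0_nat[OF prime]]
  by (simp add: ramification_index_def)

text \<open>Outside M the element p * x would be a unit of \<open>W\<close>; multiplying its inverse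
  by x, which lies in \<open>W\<close>, would give 1 / p in \<open>W\<close>.\<close>

lemma mult_p_mem_M_if_valuation_nonneg:
  assumes "x \<in> K" "of_nat p * x \<in> R" "valuation K P x \<ge> 0"
  shows "of_nat p * x \<in> M"
proof (rule ccontr)
  assume "of_nat p * x \<notin> M"
  hence "1 / (of_nat p * x) \<in> W" "x \<noteq> 0"
    using inverse_mem_W[OF assms(2)] M_zero by auto
  hence "1 / (of_nat p * x) * x \<in> W"
    using mem_W_if_valuation_nonneg[OF assms(1,3)] by (intro W_add_mult)
  thus False
    using \<open>x \<noteq> 0\<close> inverse_p_notin_W by simp
qed

end

section \<open>Maximal ideals avoiding a given element, and removal of denominators\<close>

text \<open>The ideal of all \<open>x\<close> with \<open>x * y ^ (p - 1) \<in> p R\<close> is proper and contains \<open>1 - y ^ (p - 1)\<close>, since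
  \<open>y ^ p\<close> is congruent to \<open>y\<close> modulo \<open>p R\<close>; no maximal ideal above it contains \<open>y\<close>.\<close>

lemma ex_binomial_ring_maximal_ideal:
  assumes \<alpha>: "algebraic \<alpha>" and p: "Factorial_Ring.prime p"
    and y: "y \<in> binomial_ring \<alpha>" "y / of_nat p \<notin> binomial_ring \<alpha>"
  obtains M where "binomial_ring_maximal_ideal \<alpha> p M" "y \<notin> M"
proof -
  let ?R = "binomial_ring \<alpha>"
  define e where "e = y ^ (p - 1)"
  have p2: "p \<ge> 2" using p by (rule prime_ge_2_nat)
  have p0: "(of_nat p :: complex) \<noteq> 0" using p2 by auto
  have e: "e \<in> ?R" unfolding e_def by (rule power_mem_binomial_ring[OF y(1)])
  have ye: "y * e = y ^ p"
    using p2 by (simp add: e_def flip: power_Suc)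
  have frob: "(y ^ p - y) / of_nat p \<in> ?R"
    by (rule frobenius_mem_binomial_ring[OF p y(1)])
  define ideal where "ideal J \<longleftrightarrow> J \<subseteq> ?R \<and> (\<forall>x\<in>J. \<forall>z\<in>J. x + z \<in> J) \<and> (\<forall>a\<in>?R. \<forall>x\<in>J. a * x \<in> J)" for J
  \<comment> \<open>The annihilator of e modulo p R.\<close>
  define J0 where "J0 = {x \<in> ?R. x * e / of_nat p \<in> ?R}"
  have J0: "ideal J0"
    unfolding ideal_def J0_def
    by (auto simp: add_divide_distrib ring_distribs mult.assoc
        intro: add_mem_binomial_ring mult_mem_binomial_ring simp flip: times_divide_eq_right)
  have "y * e / of_nat p \<notin> ?R"
  proof
    assume "y * e / of_nat p \<in> ?R"
    hence "y * e / of_nat p - (y ^ p - y) / of_nat p \<in> ?R"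
      using frob by (rule diff_mem_binomial_ring)
    thus False using y(2) by (simp add: ye diff_divide_distrib)
  qed
  hence "e / of_nat p \<notin> ?R"
    using mult_mem_binomial_ring[OF y(1), of "e / of_nat p"] by auto
  hence J0_one: "1 \<notin> J0" by (simp add: J0_def)
  have J0_p: "of_nat p * x \<in> J0" if "x \<in> ?R" for x
    using that p0 e mult_mem_binomial_ring[OF of_int_mem_binomial_ring[of "int p"] that]
    by (simp add: J0_def mult_mem_binomial_ring)
  \<comment> \<open>In other words, e is idempotent modulo p R.\<close>
  have J0_e: "1 - e \<in> J0"
  proof -
    have "e = y ^ (p - 2) * y"
      using p2 by (simp add: e_def flip: power_Suc2 add: Suc_diff_Suc numeral_2_eq_2)
    hence "(1 - e) * e / of_nat p = - (y ^ (p - 2) * ((y ^ p - y) / of_nat p))"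
      using ye by (simp add: algebra_simps diff_divide_distrib)
    also have "\<dots> \<in> ?R"
      by (intro minus_mem_binomial_ring mult_mem_binomial_ring power_mem_binomial_ring y frob)
    finally show ?thesis
      by (simp add: J0_def diff_mem_binomial_ring one_mem_binomial_ring e)
  qed
  define Js where "Js = {J. ideal J \<and> J0 \<subseteq> J \<and> 1 \<notin> J}"
  have "\<exists>N\<in>Js. \<forall>J\<in>Js. N \<subseteq> J \<longrightarrow> J = N"
  proof (rule subset_Zorn_nonempty)
    show "Js \<noteq> {}" using J0 J0_one by (auto simp: Js_def)
  next
    fix D assume D: "D \<noteq> {}" "subset.chain Js D"
    have DC: "ideal J" "J0 \<subseteq> J" "1 \<notin> J" if "J \<in> D" for J
      using D(2) that by (auto simp: subset.chain_def Js_def)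
    have "x + z \<in> \<Union>D" if xz: "x \<in> \<Union>D" "z \<in> \<Union>D" for x z
    proof -
      obtain J1 J2 where JZ: "J1 \<in> D" "J2 \<in> D" "x \<in> J1" "z \<in> J2" using xz by blast
      have "J1 \<subseteq> J2 \<or> J2 \<subseteq> J1"
        using subset.chain_total[OF D(2) JZ(1,2)] by blast
      then obtain J3 where "J3 \<in> D" "x \<in> J3" "z \<in> J3" using JZ by blast
      thus ?thesis using DC(1)[of J3] unfolding ideal_def by blast
    qed
    moreover have "\<Union>D \<subseteq> ?R" "\<And>a x. a \<in> ?R \<Longrightarrow> x \<in> \<Union>D \<Longrightarrow> a * x \<in> \<Union>D"
      using DC(1) unfolding ideal_def by blast+
    ultimately have "ideal (\<Union>D)" unfolding ideal_def by blast
    thus "\<Union>D \<in> Js" using DC(2,3) D(1) unfolding Js_def by blast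
  qed
  then obtain M where M: "M \<in> Js" "\<And>J1. J1 \<in> Js \<Longrightarrow> M \<subseteq> J1 \<Longrightarrow> J1 = M" by blast
  have M_ideal: "M \<subseteq> ?R" "\<And>x z. x \<in> M \<Longrightarrow> z \<in> M \<Longrightarrow> x + z \<in> M" "\<And>a x. a \<in> ?R \<Longrightarrow> x \<in> M \<Longrightarrow> a * x \<in> M"
    "J0 \<subseteq> M" "1 \<notin> M"
    using M(1) by (auto simp: Js_def ideal_def)
  have "0 \<in> M"
    using M_ideal(4) J0_p[OF zero_mem_binomial_ring] by auto
  have "binomial_ring_maximal_ideal \<alpha> p M"
  proof
    fix x assume x: "x \<in> ?R" "x \<notin> M"
    let ?X = "{m + r * x | m r. m \<in> M \<and> r \<in> ?R}"
    have M_sub: "M \<subseteq> ?X"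
    proof
      fix m assume "m \<in> M"
      moreover have "m = m + 0 * x" by simp
      ultimately show "m \<in> ?X" using zero_mem_binomial_ring by blast
    qed
    have "x = 0 + 1 * x" by simp
    hence x_mem: "x \<in> ?X"
      using \<open>0 \<in> M\<close> one_mem_binomial_ring by blast
    have "ideal ?X"
      unfolding ideal_def
    proof (intro conjI ballI)
      show "?X \<subseteq> ?R"
        using M_ideal(1) x(1) by (auto intro!: add_mem_binomial_ring mult_mem_binomial_ring)
    next
      fix u v assume "u \<in> ?X" "v \<in> ?X"
      then obtain m r m' r' where u: "m \<in> M" "r \<in> ?R" "u = m + r * x"
        and v: "m' \<in> M" "r' \<in> ?R" "v = m' + r' * x" by blast
      have "u + v = (m + m') + (r + r') * x"
        by (simp add: u v algebra_simps)
      thus "u + v \<in> ?X"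
        using M_ideal(2)[OF u(1) v(1)] add_mem_binomial_ring[OF u(2) v(2)] by blast
    next
      fix a u assume a: "a \<in> ?R" and "u \<in> ?X"
      then obtain m r where u: "m \<in> M" "r \<in> ?R" "u = m + r * x" by blast
      have "a * u = a * m + (a * r) * x"
        by (simp add: u algebra_simps)
      thus "a * u \<in> ?X"
        using M_ideal(3)[OF a u(1)] mult_mem_binomial_ring[OF a u(2)] by blast
    qed
    moreover have "?X \<noteq> M" using x_mem x(2) by blast
    ultimately have "1 \<in> ?X"
      using M(2)[of ?X] M_sub M_ideal(4) unfolding Js_def by blast
    thus "\<exists>m\<in>M. \<exists>r\<in>?R. m + r * x = 1" by force
  qed (use \<alpha> p M_ideal J0_p in auto)
  moreover have "y \<notin> M"
  proof
    assume "y \<in> M"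
    hence "y ^ (p - 2) * y \<in> M"
      by (intro M_ideal(3) power_mem_binomial_ring y)
    moreover have "y ^ (p - 2) * y = e"
      using p2 by (simp add: e_def flip: power_Suc2 add: Suc_diff_Suc numeral_2_eq_2)
    ultimately have "e + (1 - e) \<in> M"
      using J0_e M_ideal(2,4) by blast
    thus False using M_ideal(5) by simp
  qed
  ultimately show ?thesis by (rule that)
qed

lemma mem_binomial_ring_if_valuation_nonneg:
  assumes \<alpha>: "algebraic \<alpha>" and \<beta>: "\<beta> \<in> rational_adjoin \<alpha>"
    and val: "\<And>p P. Factorial_Ring.prime (p::nat) \<Longrightarrow> P \<in> unramified_degree_one_primes \<alpha> p \<Longrightarrow>
      valuation (rational_adjoin \<alpha>) P \<beta> \<ge> 0"
  shows "\<beta> \<in> binomial_ring \<alpha>"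
proof -
  let ?R = "binomial_ring \<alpha>"
  define d where "d = (LEAST d. d > 0 \<and> of_nat d * \<beta> \<in> ?R)"
  have "\<exists>d>0. of_nat d * \<beta> \<in> ?R"
    using ex_of_nat_mult_mem_binomial_ring[OF \<alpha> \<beta>] by blast
  from LeastI_ex[OF this] have d: "d > 0" "of_nat d * \<beta> \<in> ?R"
    unfolding d_def by auto
  have "d = 1"
  proof (rule ccontr)
    assume "d \<noteq> 1"
    then obtain p where p: "Factorial_Ring.prime p" "p dvd d"
      using prime_factor_nat by blast
    then obtain c where c: "d = p * c" by blast
    have "c > 0" "c < d"
      using c d(1) prime_gt_1_nat[OF p(1)] by auto
    hence "of_nat c * \<beta> \<notin> ?R"
      using not_less_Least[of c "\<lambda>d. d > 0 \<and> of_nat d * \<beta> \<in> ?R"] by (auto simp: d_def)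
    moreover have p0: "(of_nat p :: complex) \<noteq> 0"
      using p(1) by (simp add: prime_gt_0_nat)
    ultimately have "of_nat d * \<beta> / of_nat p \<notin> ?R"
      by (simp add: c)
    \<comment> \<open>Minimality of d puts d * \<beta> outside p R, so some maximal ideal avoids it.
      But d * \<beta> is p times c * \<beta>, and integrality of c * \<beta> at the corresponding P
      forces it into that ideal.\<close>
    then obtain M where M: "binomial_ring_maximal_ideal \<alpha> p M" "of_nat d * \<beta> \<notin> M"
      using ex_binomial_ring_maximal_ideal[OF \<alpha> p(1) d(2)] by blast
    interpret binomial_ring_maximal_ideal \<alpha> p M by (rule M)
    have "\<beta> \<in> local_ring P"
      using val[OF p(1) P_mem] valuation_nonneg_iff_local_ring[OF \<beta> nonzero_prime_P] by simp
    moreover have "of_nat c \<in> local_ring P"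
      using ints_subset_local_ring[OF nonzero_prime_P] ints_of_nat by blast
    ultimately have "of_nat c * \<beta> \<in> local_ring P"
      by (intro local_ring_add_mult[OF nonzero_prime_P])
    moreover have cK: "of_nat c * \<beta> \<in> K"
      using \<beta> by (intro mult_closed of_nat_closed)
    ultimately have "valuation K P (of_nat c * \<beta>) \<ge> 0"
      using valuation_nonneg_iff_local_ring[OF _ nonzero_prime_P] by simp
    moreover have eq: "of_nat p * (of_nat c * \<beta>) = of_nat d * \<beta>"
      by (simp add: c)
    ultimately have "of_nat p * (of_nat c * \<beta>) \<in> M"
      using mult_p_mem_M_if_valuation_nonneg[OF cK, unfolded eq] d(2) by (simp only: eq)
    thus False using M(2) eq by simp
  qed
  thus ?thesis using d(2) by simp
qed

theorem theorem1p4: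
  fixes \<alpha> :: complex
  assumes "algebraic \<alpha>" and "\<alpha> \<notin> \<nat>"
  shows "R_plus \<alpha> =
    {\<beta> \<in> rational_adjoin \<alpha>.
       \<forall>p::nat. Factorial_Ring.prime p \<longrightarrow>
         (\<forall>P \<in> unramified_degree_one_primes \<alpha> p. valuation (rational_adjoin \<alpha>) P \<beta> \<ge> 0)}"
proof (intro equalityI subsetI CollectI conjI allI impI ballI)
  fix \<beta> assume \<beta>: "\<beta> \<in> R_plus \<alpha>"
  show "\<beta> \<in> rational_adjoin \<alpha>"
    using \<beta> binomial_ring_subset_rational_adjoin[OF assms(1)] R_plus_eq_binomial_ring[OF assms] by blast
  fix p :: nat and P
  assume "Factorial_Ring.prime p" "P \<in> unramified_degree_one_primes \<alpha> p"
  thus "valuation (rational_adjoin \<alpha>) P \<beta> \<ge> 0"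
    by (rule R_plus_valuation_nonneg[OF assms(1) \<beta>])
next
  fix \<beta>
  assume "\<beta> \<in> {\<beta> \<in> rational_adjoin \<alpha>.
       \<forall>p::nat. Factorial_Ring.prime p \<longrightarrow>
         (\<forall>P \<in> unramified_degree_one_primes \<alpha> p. valuation (rational_adjoin \<alpha>) P \<beta> \<ge> 0)}"
  hence "\<beta> \<in> binomial_ring \<alpha>"
    by (intro mem_binomial_ring_if_valuation_nonneg[OF assms(1)]) auto
  thus "\<beta> \<in> R_plus \<alpha>"
    by (simp add: R_plus_eq_binomial_ring[OF assms])
qed

end
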